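(* Let $\alpha>0$, let $\Omega\subset\mathbb{R}^3$ be a bounded smooth domain with $(0,0,0)\in\Omega$ which is $G_\alpha$-star-shaped with respect to the origin, and let $p>5$. Then the problem $$-\Delta_x u-|x|^{2\alpha}\frac{\partial^2u}{\partial y^2}=|x|^{2\alpha}|u|^{p-1}u\ \text{ in }\Omega,\qquad u=0\ \text{ on }\partial\Omega,$$ where $\Delta_x=\partial^2_{x_1}+\partial^2_{x_2}$, has no nontrivial solution $u\in\mathcal{S}_2(\overline{\Omega})$.
   Context: Points of $\mathbb{R}^3$ are $(x_1,x_2,y)$ with $x=(x_1,x_2)$, $|x|=\sqrt{x_1^2+x_2^2}$. $\Omega$ is called $G_\alpha$-star-shaped with respect to the origin if $(0,0,0)\in\Omega$ and $x_1\nu_1+x_2\nu_2+(1+\alpha)y\nu_3\ge0$ at every point of $\partial\Omega$, where $\nu=(\nu_1,\nu_2,\nu_3)$ is the outward unit normal. $\mathcal{S}_2(\overline{\Omega})$ denotes the linear space of functions $u\in C_0^1(\overline{\Omega})$ such that $\partial^2u/\partial x_1^2$, $\partial^2u/\partial x_2^2$ and $|x|^{2\alpha}\partial^2u/\partial y^2$ (in the distributional sense) are continuous in $\Omega$ and extend continuously to $\overline{\Omega}$; a solution in $\mathcal{S}_2(\overline{\Omega})$ means such a $u$ satisfying the equation and boundary condition. *)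

theory Defs
  imports "HOL-Analysis.Analysis"
begin

text \<open>Points of R^3 are vectors z :: real^3 with z$1 = x1, z$2 = x2, z$3 = y.\<close>

definition pdiff :: "3 \<Rightarrow> (real^3 \<Rightarrow> real) \<Rightarrow> real^3 \<Rightarrow> real" where
  "pdiff i f z = deriv (\<lambda>t. f (z + t *\<^sub>R axis i 1)) 0"

fun iter_pdiff :: "3 list \<Rightarrow> (real^3 \<Rightarrow> real) \<Rightarrow> real^3 \<Rightarrow> real" where
  "iter_pdiff [] f = f"
| "iter_pdiff (i # is) f = pdiff i (iter_pdiff is f)"

definition smooth_on3 :: "(real^3) set \<Rightarrow> (real^3 \<Rightarrow> real) \<Rightarrow> bool" where
  "smooth_on3 U f \<longleftrightarrow> (\<forall>is. continuous_on U (iter_pdiff is f) \<and>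
                              (\<forall>z\<in>U. iter_pdiff is f differentiable (at z)))"

definition grad3 :: "(real^3 \<Rightarrow> real) \<Rightarrow> real^3 \<Rightarrow> real^3" where
  "grad3 f z = (\<chi> i. pdiff i f z)"

definition local_defining_fun :: "(real^3) set \<Rightarrow> real^3 \<Rightarrow> real \<Rightarrow> (real^3 \<Rightarrow> real) \<Rightarrow> bool" where
  "local_defining_fun \<Omega> z r \<phi> \<longleftrightarrow> r > 0 \<and> smooth_on3 (ball z r) \<phi> \<and>
     (\<forall>w\<in>ball z r. grad3 \<phi> w \<noteq> 0) \<and>
     \<Omega> \<inter> ball z r = {w \<in> ball z r. \<phi> w < 0}"

definition smooth_bounded_domain :: "(real^3) set \<Rightarrow> bool" where
  "smooth_bounded_domain \<Omega> \<longleftrightarrow> open \<Omega> \<and> connected \<Omega> \<and> \<Omega> \<noteq> {} \<and> bounded \<Omega> \<and>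
     (\<forall>z\<in>frontier \<Omega>. \<exists>r \<phi>. local_defining_fun \<Omega> z r \<phi>)"

definition outward_normal :: "(real^3 \<Rightarrow> real) \<Rightarrow> real^3 \<Rightarrow> real^3" where
  "outward_normal \<phi> z = (1 / norm (grad3 \<phi> z)) *\<^sub>R grad3 \<phi> z"

definition G_star_shaped :: "real \<Rightarrow> (real^3) set \<Rightarrow> bool" where
  "G_star_shaped \<alpha> \<Omega> \<longleftrightarrow> 0 \<in> \<Omega> \<and>
     (\<forall>z\<in>frontier \<Omega>. \<forall>r \<phi>. local_defining_fun \<Omega> z r \<phi> \<longrightarrow>
        (let \<nu> = outward_normal \<phi> z in
          z$1 * \<nu>$1 + z$2 * \<nu>$2 + (1 + \<alpha>) * z$3 * \<nu>$3 \<ge> 0))"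

definition xnorm :: "real^3 \<Rightarrow> real" where
  "xnorm z = sqrt ((z$1)\<^sup>2 + (z$2)\<^sup>2)"

definition C1_0_closure :: "(real^3) set \<Rightarrow> (real^3 \<Rightarrow> real) \<Rightarrow> bool" where
  "C1_0_closure \<Omega> u \<longleftrightarrow> continuous_on (closure \<Omega>) u \<and>
     (\<forall>z\<in>\<Omega>. u differentiable (at z)) \<and>
     (\<forall>i. \<exists>g. continuous_on (closure \<Omega>) g \<and> (\<forall>z\<in>\<Omega>. pdiff i u z = g z)) \<and>
     (\<forall>z\<in>frontier \<Omega>. u z = 0)"

definition test_fun :: "(real^3) set \<Rightarrow> (real^3 \<Rightarrow> real) \<Rightarrow> bool" where
  "test_fun U \<psi> \<longleftrightarrow> smooth_on3 UNIV \<psi> \<and> compact (closure {z. \<psi> z \<noteq> 0}) \<and>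
     closure {z. \<psi> z \<noteq> 0} \<subseteq> U"

text \<open>u is a solution in S_2(closure Omega) of
  -Delta_x u - |x|^(2 alpha) u_yy = |x|^(2 alpha) |u|^(p-1) u in Omega, u = 0 on the boundary.
  A, B are the continuous (up to the closure) distributional derivatives u_x1x1, u_x2x2 on Omega;
  C is the continuous (up to the closure) function equal to |x|^(2 alpha) u_yy in the sense of
  distributions on Omega minus the line x = 0 (where |x|^(-2 alpha) is smooth).\<close>
definition S2_solution :: "real \<Rightarrow> real \<Rightarrow> (real^3) set \<Rightarrow> (real^3 \<Rightarrow> real) \<Rightarrow> bool" where
  "S2_solution \<alpha> p \<Omega> u \<longleftrightarrow> C1_0_closure \<Omega> u \<and>
    (\<exists>A B C. continuous_on (closure \<Omega>) A \<and> continuous_on (closure \<Omega>) B \<and>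
             continuous_on (closure \<Omega>) C \<and>
      (\<forall>\<psi>. test_fun \<Omega> \<psi> \<longrightarrow>
          integral \<Omega> (\<lambda>z. u z * iter_pdiff [1,1] \<psi> z) = integral \<Omega> (\<lambda>z. A z * \<psi> z)) \<and>
      (\<forall>\<psi>. test_fun \<Omega> \<psi> \<longrightarrow>
          integral \<Omega> (\<lambda>z. u z * iter_pdiff [2,2] \<psi> z) = integral \<Omega> (\<lambda>z. B z * \<psi> z)) \<and>
      (\<forall>\<psi>. test_fun (\<Omega> - {z. z$1 = 0 \<and> z$2 = 0}) \<psi> \<longrightarrow>
          integral \<Omega> (\<lambda>z. u z * iter_pdiff [3,3] \<psi> z) =
          integral \<Omega> (\<lambda>z. C z / (xnorm z powr (2 * \<alpha>)) * \<psi> z)) \<and>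
      (\<forall>z\<in>\<Omega>. - A z - B z - C z = xnorm z powr (2 * \<alpha>) * (\<bar>u z\<bar> powr (p - 1) * u z)))"

end

theory Submission
  imports Defs
begin

text \<open>
  The Pohozaev inequality is obtained by scaling, without boundary integrals. Let u_s be the dilate
  of u that shrinks its support by the anisotropic dilation with parameter s; star-shapedness makes
  the domain invariant under these dilations, so the zero extension of u_s is an admissible test
  function. Write a(u, v) for the energy form and I for the integral of |x|^(2 alpha) |u|^(p+1).
  Testing with u gives a(u, u) = I. From a(u - u_s, u - u_s) >= 0 and the homogeneity
  a(u_s, u_s) = exp(-(1+alpha) s) a(u, u), testing with u_s gives
  2 a(u, u_s) <= (1 + exp(-(1+alpha) s)) I. On the other hand a second-order Taylor bound for
  |u|^(p+1) and the homogeneity of I, of degree 3 (1+alpha), bound a(u, u_s) from below up to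
  O(s^2). Letting s tend to 0 yields (p+1) I <= 6 I, hence I = 0 when p > 5.

  Integration by parts needs only directional difference quotients of Lipschitz zero extensions,
  translation invariance of the integral, and that the boundary is a null set. Testing with products of
  one-dimensional bump functions shows that the distributional second derivatives are classical
  directional ones.
\<close>

section \<open>Integration by parts along a direction\<close>

text \<open>The classical multiplier, the inner product of \<open>dil_field \<alpha> z\<close> with
  \<open>grad3 u z\<close>, is no usable test function: \<open>u\<close> is only C^1 up to the
  boundary and S_2 gives no mixed second derivatives. The finite dilate replaces this infinitesimal
  generator; only first derivatives of \<open>u\<close> enter, and the sign of the boundary term
  becomes the fact that \<open>dil\<close> maps \<open>\<Omega>\<close> into itself. Since the
  hypothesis on the normal is a weak inequality, an orbit might touch the boundary tangentially, so
  invariance needs a quantitative estimate on defining functions. The degrees belong to the weights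
  1, 1, 1 + \<alpha>: volume has degree Q = 3 + \<alpha>, the energy Q - 2 = 1 + \<alpha>, the
  potential integral Q + 2 \<alpha> = 3 (1 + \<alpha>). The last two have quotient 3 for every
  \<alpha>, whence the threshold (p + 1) / 2 = 3. The y-derivative is controlled only off the line x
  = 0. This line is null, and the flux coefficient of the y-derivative vanishes along all of it, so
  the flux remains differentiable there.\<close>

lemma integral_directional_derivative_eq_0:
  fixes G g :: "'a::euclidean_space \<Rightarrow> real"
  assumes [measurable]: "G \<in> borel_measurable borel" "g \<in> borel_measurable borel"
    and bnd: "\<And>z. \<bar>G z\<bar> \<le> M"
    and lip: "\<And>z t. \<bar>G (z + t *\<^sub>R e) - G z\<bar> \<le> K * \<bar>t\<bar>"
    and supp: "\<And>z. G z \<noteq> 0 \<Longrightarrow> norm z \<le> R"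
    and der: "AE z in lborel. ((\<lambda>t. G (z + t *\<^sub>R e)) has_real_derivative g z) (at 0)"
  shows "(\<integral>z. g z \<partial>lborel) = 0"
proof -
  \<comment> \<open>A sequence, for dominated convergence; \<open>h n \<le> 1\<close> keeps all
    shifted supports in the single ball of radius \<open>R + norm e\<close>.\<close>
  define h where "h n = 1 / real (Suc n)" for n
  have h0: "h n > 0" "h n \<le> 1" for n by (auto simp: h_def)
  have hlim: "h \<longlonglongrightarrow> 0"
    unfolding h_def using LIMSEQ_inverse_real_of_nat by (simp add: inverse_eq_divide)
  define s where "s n z = (G (z + h n *\<^sub>R e) - G z) / h n" for n z
  have intG: "integrable lborel G"
  proof (rule Bochner_Integration.integrable_bound)
    show "integrable lborel (\<lambda>z. M * indicator (cball 0 R) z :: real)"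
      by (intro integrable_mult_right integrable_real_indicator)
         (use emeasure_bounded_finite[OF bounded_cball, of 0 "R"] in auto)
    show "AE x in lborel. norm (G x) \<le> norm (M * indicator (cball 0 R) x :: real)"
    proof (rule AE_I2)
      show "norm (G x) \<le> norm (M * indicator (cball 0 R) x :: real)" for x
        using bnd[of x] supp[of x] by (cases "G x = 0") auto
    qed
  qed auto
  have distr: "lborel = distr lborel borel (\<lambda>z. z + h n *\<^sub>R e)" for n
    using lborel_distr_plus[of "h n *\<^sub>R e"] by (simp add: add.commute[of _ "h n *\<^sub>R e"])
  have int0: "(\<integral>z. s n z \<partial>lborel) = 0" for n
  proof -
    have i2: "integrable lborel (\<lambda>z. G (z + h n *\<^sub>R e))"
      using intG by (subst (asm) distr[of n], subst (asm) integrable_distr_eq) auto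
    have "(\<integral>z. G z \<partial>lborel) = (\<integral>z. G (z + h n *\<^sub>R e) \<partial>lborel)"
      by (subst distr[of n], subst integral_distr) auto
    then show ?thesis
      unfolding s_def using i2 intG by simp
  qed
  have "(\<lambda>n. \<integral>z. s n z \<partial>lborel) \<longlonglongrightarrow> (\<integral>z. g z \<partial>lborel)"
  proof (rule integral_dominated_convergence)
    show "integrable lborel (\<lambda>z. K * indicator (cball 0 (R + norm e)) z :: real)"
      by (intro integrable_mult_right integrable_real_indicator)
         (use emeasure_bounded_finite[OF bounded_cball, of 0 "R + norm e"] in auto)
    show "AE z in lborel. (\<lambda>n. s n z) \<longlonglongrightarrow> g z"
    proof (rule AE_mp[OF der], rule AE_I2, rule impI)
      fix z assume "((\<lambda>t. G (z + t *\<^sub>R e)) has_real_derivative g z) (at 0)"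
      then have "((\<lambda>t. (G (z + t *\<^sub>R e) - G z) / t) \<longlongrightarrow> g z) (at 0)"
        by (simp add: DERIV_def)
      moreover have "filterlim h (at 0) sequentially"
        using hlim h0 by (auto simp: filterlim_at intro!: always_eventually) (metis less_irrefl)
      ultimately show "(\<lambda>n. s n z) \<longlonglongrightarrow> g z"
        unfolding s_def by (rule filterlim_compose)
    qed
    show "AE z in lborel. norm (s n z) \<le> K * indicator (cball 0 (R + norm e)) z" for n
    proof (rule AE_I2)
      fix z
      have K: "norm (s n z) \<le> K"
        using lip[of z "h n"] h0[of n] by (simp add: s_def divide_le_eq)
      have "s n z = 0" if z: "z \<notin> cball 0 (R + norm e)"
      proof -
        have nz: "norm z > R + norm e" using z by simp
        have "norm (h n *\<^sub>R e) \<le> norm e" using h0[of n] by (simp add: mult_left_le_one_le)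
        moreover have "norm z \<le> norm (z + h n *\<^sub>R e) + norm (h n *\<^sub>R e)"
          by (metis add_diff_cancel_right' norm_triangle_ineq4)
        ultimately have "norm (z + h n *\<^sub>R e) > R" using nz by linarith
        moreover have "norm z > R" using nz norm_ge_zero[of e] by linarith
        ultimately have "G z = 0" "G (z + h n *\<^sub>R e) = 0" using supp by force+
        then show ?thesis by (simp add: s_def)
      qed
      then show "norm (s n z) \<le> K * indicator (cball 0 (R + norm e)) z"
        using K by (cases "z \<in> cball 0 (R + norm e)") auto
    qed
  qed (auto simp: s_def)
  then show ?thesis using int0 by (simp add: LIMSEQ_const_iff)
qed

lemma set_integrable_bounded_open:
  fixes f :: "'a::euclidean_space \<Rightarrow> real"
  assumes "open \<Omega>" "bounded \<Omega>" "set_borel_measurable borel \<Omega> f"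
    and "\<And>z. z \<in> \<Omega> \<Longrightarrow> \<bar>f z\<bar> \<le> M"
  shows "set_integrable lborel \<Omega> f"
  unfolding set_integrable_def
proof (rule Bochner_Integration.integrable_bound)
  have "emeasure lborel \<Omega> < \<infinity>" using assms(2) by (rule emeasure_bounded_finite)
  then show "integrable lborel (\<lambda>z. M * indicator \<Omega> z :: real)"
    using assms(1) by (intro integrable_mult_right integrable_real_indicator) auto
  show "(\<lambda>x. indicat_real \<Omega> x *\<^sub>R f x) \<in> borel_measurable lborel"
    using assms(3) by (simp add: set_borel_measurable_def)
  show "AE x in lborel. norm (indicat_real \<Omega> x *\<^sub>R f x) \<le> norm (M * indicator \<Omega> x :: real)"
    using assms(4) by (intro AE_I2) (force simp: indicator_def abs_le_iff)
qed

text \<open>The zero extension of f v is Lipschitz along e; v may fail to be differentiable on a null set.\<close>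

lemma directional_integration_by_parts:
  fixes f v f' v' :: "'a::euclidean_space \<Rightarrow> real"
  assumes \<Omega>: "open \<Omega>" "bounded \<Omega>" "negligible (frontier \<Omega>)"
    and mf: "set_borel_measurable borel \<Omega> f" and mf': "set_borel_measurable borel \<Omega> f'"
    and mv: "set_borel_measurable borel \<Omega> v" and mv': "set_borel_measurable borel \<Omega> v'"
    and bf: "\<And>z. z \<in> \<Omega> \<Longrightarrow> \<bar>f z\<bar> \<le> M" and bf': "\<And>z. z \<in> \<Omega> \<Longrightarrow> \<bar>f' z\<bar> \<le> M'"
    and df: "\<And>z. z \<in> \<Omega> \<Longrightarrow> ((\<lambda>t. f (z + t *\<^sub>R e)) has_real_derivative f' z) (at 0)"
    and v0: "\<And>z. z \<notin> \<Omega> \<Longrightarrow> v z = 0"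
    and lv: "\<And>z t. \<bar>v (z + t *\<^sub>R e) - v z\<bar> \<le> K * \<bar>t\<bar>"
    and bv: "\<And>z. \<bar>v z\<bar> \<le> V" and bv': "\<And>z. z \<in> \<Omega> \<Longrightarrow> \<bar>v' z\<bar> \<le> V'"
    and dv: "AE z in lborel. z \<in> \<Omega> \<longrightarrow> ((\<lambda>t. v (z + t *\<^sub>R e)) has_real_derivative v' z) (at 0)"
  shows "(LINT z:\<Omega>|lborel. f z * v' z) = - (LINT z:\<Omega>|lborel. f' z * v z)"
proof (cases "\<Omega> = {}")
  case True then show ?thesis by (simp add: set_lebesgue_integral_def)
next
  case False
  then obtain z0 where z0: "z0 \<in> \<Omega>" by blast
  have M0: "0 \<le> M" "0 \<le> M'" "0 \<le> V" "0 \<le> V'"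
    using bf[OF z0] bf'[OF z0] bv[of z0] bv'[OF z0] by linarith+
  have K0: "0 \<le> K" using lv[of z0 1] by simp
  have meas_mult: "set_borel_measurable borel \<Omega> (\<lambda>z. p z * q z)"
    if "set_borel_measurable borel \<Omega> p" "set_borel_measurable borel \<Omega> q" for p q :: "'a \<Rightarrow> real"
  proof -
    have "(\<lambda>z. (indicator \<Omega> z *\<^sub>R p z) * (indicator \<Omega> z *\<^sub>R q z)) \<in> borel_measurable borel"
      using that unfolding set_borel_measurable_def by (rule borel_measurable_times)
    moreover have "(\<lambda>z. (indicator \<Omega> z *\<^sub>R p z) * (indicator \<Omega> z *\<^sub>R q z))
      = (\<lambda>z. indicator \<Omega> z *\<^sub>R (p z * q z))" by (auto simp: indicator_def)
    ultimately show ?thesis by (simp add: set_borel_measurable_def)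
  qed
  define G where "G z = indicator \<Omega> z * (f z * v z)" for z
  define g where "g z = indicator \<Omega> z * (f z * v' z + f' z * v z)" for z
  have i1: "set_integrable lborel \<Omega> (\<lambda>z. f z * v' z)"
    by (rule set_integrable_bounded_open[OF \<Omega>(1,2) meas_mult[OF mf mv'], of "M * V'"])
       (simp add: abs_mult bf bv' M0 mult_mono)
  have i2: "set_integrable lborel \<Omega> (\<lambda>z. f' z * v z)"
    by (rule set_integrable_bounded_open[OF \<Omega>(1,2) meas_mult[OF mf' mv], of "M' * V"])
       (simp add: abs_mult bf' bv M0 mult_mono)
  obtain R where R: "\<And>z. z \<in> \<Omega> \<Longrightarrow> norm z \<le> R"
    using \<Omega>(2) by (auto simp: bounded_iff)
  have "(\<integral>z. g z \<partial>lborel) = 0"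
  proof (rule integral_directional_derivative_eq_0)
    show "G \<in> borel_measurable borel"
      using meas_mult[OF mf mv] by (simp add: set_borel_measurable_def G_def[abs_def])
    show "g \<in> borel_measurable borel"
    proof -
      have "(\<lambda>z. indicator \<Omega> z *\<^sub>R (f z * v' z) + indicator \<Omega> z *\<^sub>R (f' z * v z)) \<in> borel_measurable borel"
        using meas_mult[OF mf mv'] meas_mult[OF mf' mv] unfolding set_borel_measurable_def
        by (rule borel_measurable_add)
      then show ?thesis by (simp add: g_def[abs_def] distrib_left)
    qed
    show "\<bar>G z\<bar> \<le> M * V" for z
      using bf[of z] bv[of z] M0 by (auto simp: G_def indicator_def abs_mult intro: mult_mono)
    show "G z \<noteq> 0 \<Longrightarrow> norm z \<le> R" for z
      using R by (auto simp: G_def indicator_def split: if_splits)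
    \<comment> \<open>A point outside \<open>\<Omega>\<close> within parameter distance
      \<open>\<bar>t\<bar>\<close> of \<open>z\<close> is a zero of \<open>v\<close>, so the
      Lipschitz bound makes \<open>G z\<close> itself of order \<open>t\<close>. Nothing is known
      about \<open>f\<close> outside \<open>\<Omega>\<close>.\<close>
    have near: "\<bar>G z\<bar> \<le> (M * K) * \<bar>t\<bar>" if "\<bar>r\<bar> \<le> \<bar>t\<bar>" "z + r *\<^sub>R e \<notin> \<Omega>" for z r t
    proof (cases "z \<in> \<Omega>")
      case True
      have "\<bar>v z\<bar> \<le> K * \<bar>r\<bar>" using lv[of z r] v0[OF that(2)] by simp
      also have "\<dots> \<le> K * \<bar>t\<bar>" using that(1) K0 by (rule mult_left_mono)
      finally have "\<bar>f z\<bar> * \<bar>v z\<bar> \<le> M * (K * \<bar>t\<bar>)"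
        using bf[OF True] M0 K0 by (intro mult_mono) auto
      then show ?thesis using True by (simp add: G_def abs_mult mult.assoc)
    next
      case False then show ?thesis using M0 K0 by (simp add: G_def)
    qed
    show "\<bar>G (z + t *\<^sub>R e) - G z\<bar> \<le> (2 * (M * K) + V * M') * \<bar>t\<bar>" for z t
    \<comment> \<open>\<open>f\<close> can be differenced only along a segment inside
      \<open>\<Omega>\<close>; otherwise both ends are estimated separately through a point where
      \<open>v\<close> vanishes.\<close>
    proof (cases "\<forall>r\<in>closed_segment 0 t. z + r *\<^sub>R e \<in> \<Omega>")
      case True
      have "norm (f (z + t *\<^sub>R e) - f (z + 0 *\<^sub>R e)) \<le> M' * norm (t - 0)"
      proof (rule field_differentiable_bound[of "closed_segment 0 t" "\<lambda>r. f (z + r *\<^sub>R e)"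
            "\<lambda>r. f' (z + r *\<^sub>R e)"])
        fix r assume r: "r \<in> closed_segment 0 t"
        then have "z + r *\<^sub>R e \<in> \<Omega>" using True by auto
        from df[OF this] have "((\<lambda>x. f (z + (r + x) *\<^sub>R e)) has_real_derivative f' (z + r *\<^sub>R e)) (at 0)"
          by (simp add: scaleR_left_distrib add.assoc)
        then have "((\<lambda>r. f (z + r *\<^sub>R e)) has_real_derivative f' (z + r *\<^sub>R e)) (at r)"
          using DERIV_at_within_shift[of "\<lambda>r. f (z + r *\<^sub>R e)" _ r 0 UNIV] by simp
        then show "((\<lambda>r. f (z + r *\<^sub>R e)) has_real_derivative f' (z + r *\<^sub>R e)) (at r within closed_segment 0 t)"
          by (rule has_field_derivative_at_within)
        show "norm (f' (z + r *\<^sub>R e)) \<le> M'" using True r bf' by auto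
      qed auto
      then have 1: "\<bar>f (z + t *\<^sub>R e) - f z\<bar> \<le> M' * \<bar>t\<bar>" by simp
      have zin: "z \<in> \<Omega>" "z + t *\<^sub>R e \<in> \<Omega>" using True by (force, auto)
      have "G (z + t *\<^sub>R e) - G z
         = f (z + t *\<^sub>R e) * (v (z + t *\<^sub>R e) - v z) + v z * (f (z + t *\<^sub>R e) - f z)"
        using zin by (simp add: G_def algebra_simps)
      also have "\<bar>\<dots>\<bar> \<le> \<bar>f (z + t *\<^sub>R e)\<bar> * \<bar>v (z + t *\<^sub>R e) - v z\<bar> + \<bar>v z\<bar> * \<bar>f (z + t *\<^sub>R e) - f z\<bar>"
        by (metis abs_mult abs_triangle_ineq)
      also have "\<dots> \<le> M * (K * \<bar>t\<bar>) + V * (M' * \<bar>t\<bar>)"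
        using bf[OF zin(2)] lv[of z t] bv[of z] 1 M0 K0 by (intro add_mono mult_mono) auto
      also have "\<dots> \<le> (2 * (M * K) + V * M') * \<bar>t\<bar>"
        using M0 K0 by (simp add: algebra_simps)
      finally show ?thesis .
    next
      case False
      then obtain r where r: "r \<in> closed_segment 0 t" "z + r *\<^sub>R e \<notin> \<Omega>" by blast
      then have rt: "\<bar>r\<bar> \<le> \<bar>t\<bar>" "\<bar>r - t\<bar> \<le> \<bar>t\<bar>"
        by (auto simp: closed_segment_eq_real_ivl split: if_splits)
      have a: "\<bar>G z\<bar> \<le> (M * K) * \<bar>t\<bar>" using near[OF rt(1) r(2)] .
      have b: "\<bar>G (z + t *\<^sub>R e)\<bar> \<le> (M * K) * \<bar>t\<bar>"
        by (rule near[OF rt(2)]) (use r(2) in \<open>simp add: algebra_simps\<close>)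
      have "\<bar>G (z + t *\<^sub>R e) - G z\<bar> \<le> \<bar>G (z + t *\<^sub>R e)\<bar> + \<bar>G z\<bar>" by (rule abs_triangle_ineq4)
      also have "\<dots> \<le> (2 * (M * K)) * \<bar>t\<bar>" using a b by (simp add: algebra_simps)
      also have "\<dots> \<le> (2 * (M * K) + V * M') * \<bar>t\<bar>"
        using M0 by (intro mult_right_mono) auto
      finally show ?thesis .
    qed
    \<comment> \<open>At frontier points \<open>G\<close> may have a corner; any other point has a
      neighbourhood inside \<open>\<Omega>\<close> or outside its closure.\<close>
    have "AE z in lborel. z \<notin> frontier \<Omega>"
    proof -
      have "frontier \<Omega> \<in> null_sets lebesgue" using \<Omega>(3) by (simp add: negligible_iff_null_sets)
      then have "frontier \<Omega> \<in> null_sets lborel" by (simp add: null_sets_completion_iff)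
      then show ?thesis by (rule AE_not_in)
    qed
    with dv show "AE z in lborel. ((\<lambda>t. G (z + t *\<^sub>R e)) has_real_derivative g z) (at 0)"
    proof eventually_elim
      case (elim z)
      have tend: "((\<lambda>t. z + t *\<^sub>R e) \<longlongrightarrow> z) (at 0)"
        by (auto intro!: tendsto_eq_intros)
      show ?case
      proof (cases "z \<in> \<Omega>")
        case True
        have ev: "eventually (\<lambda>t. z + t *\<^sub>R e \<in> \<Omega>) (at 0)"
          using topological_tendstoD[OF tend \<Omega>(1) True] .
        have "((\<lambda>t. f (z + t *\<^sub>R e) * v (z + t *\<^sub>R e)) has_real_derivative g z) (at 0)"
          using DERIV_mult[OF df[OF True] elim(1)[rule_format, OF True]] True
          by (simp add: g_def algebra_simps)
        moreover have "eventually (\<lambda>t. f (z + t *\<^sub>R e) * v (z + t *\<^sub>R e) = G (z + t *\<^sub>R e)) (nhds 0)"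
          using ev True by (auto simp: eventually_nhds_conv_at G_def elim: eventually_mono)
        ultimately show ?thesis
          by (subst (asm) DERIV_cong_ev[OF refl _ refl]) auto
      next
        case False
        then have "z \<notin> closure \<Omega>" using elim(2) \<Omega>(1) by (simp add: frontier_def interior_open)
        then have "eventually (\<lambda>t. z + t *\<^sub>R e \<in> - closure \<Omega>) (at 0)"
          using topological_tendstoD[OF tend, of "- closure \<Omega>"] by auto
        then have "eventually (\<lambda>t. 0 = G (z + t *\<^sub>R e)) (at 0)"
          by (rule eventually_mono) (use closure_subset in \<open>auto simp: G_def indicator_def\<close>)
        moreover have "0 = G z" using False by (simp add: G_def)
        ultimately have "eventually (\<lambda>t. 0 = G (z + t *\<^sub>R e)) (nhds 0)"
          by (simp add: eventually_nhds_conv_at)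
        then have "((\<lambda>t. G (z + t *\<^sub>R e)) has_real_derivative 0) (at 0)"
          by (subst DERIV_cong_ev[OF refl _ refl, where g="\<lambda>t. 0"]) (auto elim: eventually_mono)
        then show ?thesis using False by (simp add: g_def)
      qed
    qed
  qed
  also have "(\<integral>z. g z \<partial>lborel) = (LINT z:\<Omega>|lborel. f z * v' z) + (LINT z:\<Omega>|lborel. f' z * v z)"
    using set_integral_add(2)[OF i1 i2] by (simp add: set_lebesgue_integral_def g_def)
  finally show ?thesis by simp
qed

section \<open>Smooth boundaries\<close>

lemma axis_shift_derivative:
  fixes f :: "real^3 \<Rightarrow> real"
  assumes "f differentiable (at z)"
  shows "((\<lambda>t. f (z + t *\<^sub>R axis i 1)) has_real_derivative pdiff i f z) (at 0)"
proof -
  obtain f' where f': "(f has_derivative f') (at z)" using assms by (auto simp: differentiable_def)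
  have "((\<lambda>t. z + t *\<^sub>R axis i 1) has_derivative (\<lambda>t. t *\<^sub>R axis i 1)) (at 0)"
    by (auto intro!: derivative_eq_intros)
  then have "((\<lambda>t. f (z + t *\<^sub>R axis i 1)) has_derivative (\<lambda>t. f' (t *\<^sub>R axis i 1))) (at 0)"
    using has_derivative_compose[of "\<lambda>t. z + t *\<^sub>R axis i 1" _ 0 UNIV f f'] f' by simp
  moreover have "(\<lambda>t. f' (t *\<^sub>R axis i 1)) = (*) (f' (axis i 1))"
    using has_derivative_linear[OF f'] by (auto simp: linear_cmul)
  ultimately have D: "((\<lambda>t. f (z + t *\<^sub>R axis i 1)) has_real_derivative f' (axis i 1)) (at 0)"
    by (simp add: has_field_derivative_def)
  then show ?thesis unfolding pdiff_def by (simp add: DERIV_imp_deriv)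
qed

lemma has_derivative_grad3:
  fixes f :: "real^3 \<Rightarrow> real"
  assumes "f differentiable (at z)"
  shows "(f has_derivative (\<lambda>h. grad3 f z \<bullet> h)) (at z)"
proof -
  obtain f' where f': "(f has_derivative f') (at z)" using assms by (auto simp: differentiable_def)
  note lin = has_derivative_linear[OF f']
  have ax: "f' (axis i 1) = pdiff i f z" for i
  proof -
    have "((\<lambda>t. z + t *\<^sub>R axis i 1) has_derivative (\<lambda>t. t *\<^sub>R axis i 1)) (at 0)"
      by (auto intro!: derivative_eq_intros)
    then have "((\<lambda>t. f (z + t *\<^sub>R axis i 1)) has_derivative (\<lambda>t. f' (t *\<^sub>R axis i 1))) (at 0)"
      using has_derivative_compose[of "\<lambda>t. z + t *\<^sub>R axis i 1" _ 0 UNIV f f'] f' by simp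
    moreover have "(\<lambda>t. f' (t *\<^sub>R axis i 1)) = (*) (f' (axis i 1))"
      using lin by (auto simp: linear_cmul)
    ultimately have "((\<lambda>t. f (z + t *\<^sub>R axis i 1)) has_real_derivative f' (axis i 1)) (at 0)"
      by (simp add: has_field_derivative_def)
    with axis_shift_derivative[OF assms, of i] show ?thesis by (rule DERIV_unique[symmetric])
  qed
  have "f' h = grad3 f z \<bullet> h" for h
  proof -
    have "f' h = f' (\<Sum>i\<in>UNIV. h $ i *\<^sub>R axis i 1)"
      using basis_expansion[of h] by (simp add: scalar_mult_eq_scaleR)
    also have "\<dots> = (\<Sum>i\<in>UNIV. h $ i * f' (axis i 1))"
      by (simp add: linear_sum[OF lin] linear_cmul[OF lin])
    also have "\<dots> = grad3 f z \<bullet> h"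
      by (simp add: ax grad3_def inner_vec_def mult.commute)
    finally show ?thesis .
  qed
  then have "f' = (\<lambda>h. grad3 f z \<bullet> h)" by auto
  with f' show ?thesis by simp
qed

lemma pdiff_eq_grad3: "pdiff i f z = grad3 f z $ i"
  by (simp add: grad3_def)

lemma curve_derivative:
  fixes f :: "real^3 \<Rightarrow> real" and \<gamma> :: "real \<Rightarrow> real^3"
  assumes "f differentiable (at (\<gamma> t))" "(\<gamma> has_vector_derivative \<gamma>') (at t)"
  shows "((\<lambda>s. f (\<gamma> s)) has_real_derivative (grad3 f (\<gamma> t) \<bullet> \<gamma>')) (at t)"
proof -
  have "((\<lambda>s. f (\<gamma> s)) has_derivative (\<lambda>h. grad3 f (\<gamma> t) \<bullet> (h *\<^sub>R \<gamma>'))) (at t)"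
    using has_derivative_compose[OF assms(2)[unfolded has_vector_derivative_def]
      has_derivative_grad3[OF assms(1)]] .
  moreover have "(\<lambda>h. grad3 f (\<gamma> t) \<bullet> (h *\<^sub>R \<gamma>')) = (*) (grad3 f (\<gamma> t) \<bullet> \<gamma>')"
    by (auto simp: mult.commute)
  ultimately show ?thesis by (simp add: has_field_derivative_def)
qed

lemma smooth_on3_D:
  assumes "smooth_on3 U f"
  shows "\<And>z. z \<in> U \<Longrightarrow> f differentiable (at z)" "continuous_on U f"
    "continuous_on U (grad3 f)"
    "\<And>z. z \<in> U \<Longrightarrow> pdiff i f differentiable (at z)"
    "continuous_on U (grad3 (pdiff i f))"
proof -
  note s = assms[unfolded smooth_on3_def, rule_format]
  show "\<And>z. z \<in> U \<Longrightarrow> f differentiable (at z)" using s[of "[]"] by simp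
  show "continuous_on U f" using s[of "[]"] by simp
  show "continuous_on U (grad3 f)"
    unfolding grad3_def[abs_def] using s[of "[i]" for i] by (intro continuous_on_vec_lambda) auto
  show "\<And>z. z \<in> U \<Longrightarrow> pdiff i f differentiable (at z)" using s[of "[i]"] by simp
  show "continuous_on U (grad3 (pdiff i f))"
    unfolding grad3_def[abs_def] using s[of "[j,i]" for j] by (intro continuous_on_vec_lambda) auto
qed

text \<open>A frontier point is not in the open set, which excludes a negative value; a positive
  value would persist nearby by continuity and keep the point out of the closure.\<close>

lemma frontier_defining_fun_eq_0:
  assumes "open \<Omega>" "local_defining_fun \<Omega> z r \<phi>" "w \<in> frontier \<Omega>" "w \<in> ball z r"
  shows "\<phi> w = 0"
proof -
  note d = assms(2)[unfolded local_defining_fun_def]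
  have "w \<notin> \<Omega>" using assms(1,3) by (simp add: frontier_def interior_open)
  then have "\<not> \<phi> w < 0" using d assms(4) by blast
  moreover have "\<not> \<phi> w > 0"
  proof
    assume "\<phi> w > 0"
    have "isCont \<phi> w" using smooth_on3_D(1)[of "ball z r" \<phi> w] d assms(4)
      by (simp add: differentiable_imp_continuous_within)
    then have "eventually (\<lambda>x. \<phi> x > 0) (nhds w)"
      using \<open>\<phi> w > 0\<close> by (intro order_tendstoD(1)[of \<phi> "\<phi> w"]) (simp_all add: isCont_def tendsto_at_iff_tendsto_nhds)
    moreover have "eventually (\<lambda>x. x \<in> ball z r) (nhds w)"
      using assms(4) eventually_nhds_in_open open_ball by blast
    ultimately have "eventually (\<lambda>x. x \<notin> \<Omega>) (nhds w)"
      by eventually_elim (use d in force)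
    then obtain S where "open S" "w \<in> S" "\<forall>x\<in>S. x \<notin> \<Omega>" by (auto simp: eventually_nhds)
    then have "w \<notin> closure \<Omega>" by (metis closure_iff_nhds_not_empty Int_emptyI order_refl)
    then show False using assms(3) by (simp add: frontier_def)
  qed
  ultimately show ?thesis by linarith
qed

text \<open>Near a boundary point z0, every ray from z0 - grad phi(z0) meets the level set at most once.\<close>

lemma negligible_frontier_smooth:
  assumes "smooth_bounded_domain \<Omega>"
  shows "negligible (frontier \<Omega>)"
proof -
  have op: "open \<Omega>" using assms by (simp add: smooth_bounded_domain_def)
  have "\<exists>U. openin (top_of_set (frontier \<Omega>)) U \<and> z \<in> U \<and> negligible U" if z: "z \<in> frontier \<Omega>" for z
  proof -
    obtain r \<phi> where ldf: "local_defining_fun \<Omega> z r \<phi>"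
      using assms z by (meson smooth_bounded_domain_def)
    note d = ldf[unfolded local_defining_fun_def]
    have sm: "smooth_on3 (ball z r) \<phi>" and r: "r > 0" using d by auto
    \<comment> \<open>\<open>z - a\<close> is the gradient at \<open>z\<close>, so the inner product
      studied next equals its squared norm there and is positive.\<close>
    define a where "a = z - grad3 \<phi> z"
    have cg: "isCont (grad3 \<phi>) z"
      using smooth_on3_D(3)[OF sm] r by (simp add: continuous_on_eq_continuous_at)
    \<comment> \<open>The two points vary independently because the derivative along a ray pairs the
      gradient at \<open>a + s *\<^sub>R x\<close> with the direction of another point,
      \<open>a + x\<close>.\<close>
    have "((\<lambda>p. grad3 \<phi> (fst p) \<bullet> (snd p - a)) \<longlongrightarrow> grad3 \<phi> z \<bullet> (z - a)) (nhds z \<times>\<^sub>F nhds z)"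
    proof (intro tendsto_intros)
      have "(grad3 \<phi> \<longlongrightarrow> grad3 \<phi> z) (nhds z)" using cg by (simp add: isCont_def tendsto_at_iff_tendsto_nhds)
      then show "((\<lambda>p. grad3 \<phi> (fst p)) \<longlongrightarrow> grad3 \<phi> z) (nhds z \<times>\<^sub>F nhds z)"
        using filterlim_compose filterlim_fst by blast
      show "(snd \<longlongrightarrow> z) (nhds z \<times>\<^sub>F nhds z)" by (rule filterlim_snd)
    qed
    moreover have "grad3 \<phi> z \<bullet> (z - a) > 0"
      using d r by (simp add: a_def)
    ultimately have "eventually (\<lambda>p. grad3 \<phi> (fst p) \<bullet> (snd p - a) > 0) (nhds z \<times>\<^sub>F nhds z)"
      by (rule order_tendstoD(1))
    then obtain P where P: "eventually P (nhds z)"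
        "\<And>x y. P x \<Longrightarrow> P y \<Longrightarrow> grad3 \<phi> x \<bullet> (y - a) > 0"
      by (auto simp: eventually_prod_same)
    then obtain \<epsilon> where \<epsilon>: "\<epsilon> > 0" "\<And>x. dist x z < \<epsilon> \<Longrightarrow> P x"
      by (auto simp: eventually_nhds_metric)
    define \<delta> where "\<delta> = min (\<epsilon>/2) (r/2)"
    have \<delta>: "\<delta> > 0" "\<delta> < \<epsilon>" "\<delta> < r" using \<epsilon> r by (auto simp: \<delta>_def)
    have pos: "grad3 \<phi> x \<bullet> (y - a) > 0" if "x \<in> cball z \<delta>" "y \<in> cball z \<delta>" for x y
      using that \<delta> \<epsilon>(2) P(2) by (auto simp: dist_commute)
    have "negligible (frontier \<Omega> \<inter> cball z \<delta>)"
    \<comment> \<open>A closed set is null if no ray from \<open>a\<close> meets it twice; two hits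
      would be two zeros of \<open>\<phi>\<close> on a ray along which it strictly
      increases.\<close>
    proof (rule starlike_negligible_strong[where a=a])
      show "closed (frontier \<Omega> \<inter> cball z \<delta>)" by (simp add: closed_Int)
      fix c :: real and x assume c: "0 \<le> c" "c < 1" and ax: "a + x \<in> frontier \<Omega> \<inter> cball z \<delta>"
      show "a + c *\<^sub>R x \<notin> frontier \<Omega> \<inter> cball z \<delta>"
      proof
        assume acx: "a + c *\<^sub>R x \<in> frontier \<Omega> \<inter> cball z \<delta>"
        have seg: "a + s *\<^sub>R x \<in> cball z \<delta>" if "c \<le> s" "s \<le> 1" for s
        proof -
          have "closed_segment (a + c *\<^sub>R x) (a + x) \<subseteq> cball z \<delta>"
            using ax acx by (intro closed_segment_subset) auto
          moreover have "a + s *\<^sub>R x \<in> closed_segment (a + c *\<^sub>R x) (a + x)"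
          proof -
            \<comment> \<open>The affine parameter of \<open>a + s *\<^sub>R x\<close> on the
              segment from \<open>a + c *\<^sub>R x\<close> to \<open>a + x\<close>, which lies in
              the convex ball.\<close>
            define u where "u = (s - c) / (1 - c)"
            have u: "0 \<le> u" "u \<le> 1" "u * (1 - c) = s - c" using that c by (auto simp: u_def)
            have "(1 - u) *\<^sub>R (a + c *\<^sub>R x) + u *\<^sub>R (a + x) = a + (c + u * (1 - c)) *\<^sub>R x"
              by (simp add: algebra_simps)
            also have "\<dots> = a + s *\<^sub>R x" using u by simp
            finally show ?thesis using u by (auto simp: in_segment intro!: exI[of _ u])
          qed
          ultimately show ?thesis by blast
        qed
        have D: "\<exists>y. ((\<lambda>s. \<phi> (a + s *\<^sub>R x)) has_real_derivative y) (at s) \<and> y > 0" if s: "c \<le> s" "s \<le> 1" for s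
        proof -
          have "a + s *\<^sub>R x \<in> ball z r" using seg[OF s] \<delta> by auto
          then have "\<phi> differentiable (at (a + s *\<^sub>R x))" by (rule smooth_on3_D(1)[OF sm])
          then have "((\<lambda>s. \<phi> (a + s *\<^sub>R x)) has_real_derivative (grad3 \<phi> (a + s *\<^sub>R x) \<bullet> x)) (at s)"
            by (rule curve_derivative) (auto intro!: derivative_eq_intros)
          moreover have "grad3 \<phi> (a + s *\<^sub>R x) \<bullet> x > 0"
            using pos[OF seg[OF s], of "a + x"] ax by simp
          ultimately show ?thesis by blast
        qed
        have "\<phi> (a + c *\<^sub>R x) < \<phi> (a + 1 *\<^sub>R x)"
          by (rule DERIV_pos_imp_increasing[OF c(2)]) (use D in auto)
        moreover have "\<phi> (a + c *\<^sub>R x) = 0" "\<phi> (a + x) = 0"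
          using acx ax \<delta> by (auto intro!: frontier_defining_fun_eq_0[OF op ldf])
        ultimately show False by simp
      qed
    qed
    then have "negligible (frontier \<Omega> \<inter> ball z \<delta>)"
      by (rule negligible_subset) (auto simp: ball_def cball_def)
    moreover have "openin (top_of_set (frontier \<Omega>)) (frontier \<Omega> \<inter> ball z \<delta>)"
      by (auto intro: openin_open_Int)
    ultimately show ?thesis using z \<delta> by (intro exI[of _ "frontier \<Omega> \<inter> ball z \<delta>"]) auto
  qed
  then show ?thesis by (subst locally_negligible_alt) blast
qed

text \<open>Openness of \<open>\<Omega>\<close> makes the set of times spent outside closed, so its
  infimum is attained; the point reached then is outside \<open>\<Omega>\<close> but a limit of
  points inside. It serves both for dilation orbits and for straight segments.\<close>

lemma first_exit:
  fixes \<gamma> :: "real \<Rightarrow> 'a::real_normed_vector"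
  assumes "open \<Omega>" "continuous_on {0..s} \<gamma>" "\<gamma> 0 \<in> \<Omega>" "\<gamma> s \<notin> \<Omega>" "0 \<le> s"
  obtains t0 where "0 < t0" "t0 \<le> s" "\<gamma> t0 \<in> frontier \<Omega>" "\<And>t. 0 \<le> t \<Longrightarrow> t < t0 \<Longrightarrow> \<gamma> t \<in> \<Omega>"
proof -
  define E where "E = {0..s} \<inter> \<gamma> -` (- \<Omega>)"
  have clE: "closed E"
    unfolding E_def using assms(1,2) by (intro continuous_closed_preimage) auto
  have sE: "s \<in> E" using assms by (simp add: E_def)
  have bE: "bdd_below E" by (auto simp: E_def intro: bdd_belowI[of _ 0])
  define t0 where "t0 = Inf E"
  have t0E: "t0 \<in> E" unfolding t0_def using clE sE bE by (intro closed_contains_Inf) auto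
  have before: "\<gamma> t \<in> \<Omega>" if "0 \<le> t" "t < t0" for t
  proof (rule ccontr)
    assume "\<gamma> t \<notin> \<Omega>"
    then have "t \<in> E" using that t0E by (simp add: E_def)
    then have "t0 \<le> t" unfolding t0_def using bE by (rule cInf_lower)
    then show False using that by simp
  qed
  have t0pos: "t0 > 0"
    using t0E assms(3) by (cases "t0 = 0") (auto simp: E_def)
  have "\<gamma> t0 \<notin> \<Omega>" using t0E by (simp add: E_def)
  have lim: "(\<gamma> \<longlongrightarrow> \<gamma> t0) (at_left t0)"
  proof -
    have "(\<gamma> \<longlongrightarrow> \<gamma> t0) (at t0 within {0..t0})"
      using continuous_on_subset[OF assms(2), of "{0..t0}"] t0E t0pos
      by (auto simp: continuous_on_def E_def)
    then show ?thesis using t0pos by (simp add: at_within_Icc_at_left)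
  qed
  have "\<gamma> t0 \<in> closure \<Omega>"
  proof (rule Lim_in_closed_set[OF closed_closure _ _ lim])
    show "eventually (\<lambda>t. \<gamma> t \<in> closure \<Omega>) (at_left t0)"
      unfolding eventually_at_left[OF t0pos]
      using t0pos by (intro exI[of _ 0]) (auto intro!: subsetD[OF closure_subset] before)
  qed simp
  then have "\<gamma> t0 \<in> frontier \<Omega>" using \<open>\<gamma> t0 \<notin> \<Omega>\<close> assms(1) by (simp add: frontier_def interior_open)
  with that[of t0] show ?thesis using t0pos t0E before by (auto simp: E_def)
qed

section \<open>Invariance under the anisotropic dilations\<close>

text \<open>With y of weight 1 + \<alpha>, the operators u_x1x1, u_x2x2 and |x|^(2 \<alpha>) u_yy
  all scale with degree -2, since 2 \<alpha> - 2 (1 + \<alpha>) = -2.\<close>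

definition weight :: "real \<Rightarrow> 3 \<Rightarrow> real" where
  "weight \<alpha> i = (if i = 3 then 1 + \<alpha> else 1)"

text \<open>Contracting for positive \<open>s\<close>; a one-parameter group in \<open>s\<close>
  with generator \<open>- dil_field \<alpha>\<close>.\<close>

definition dil :: "real \<Rightarrow> real \<Rightarrow> real^3 \<Rightarrow> real^3" where
  "dil \<alpha> s z = (\<chi> i. exp (- weight \<alpha> i * s) * z $ i)"

text \<open>The vector field whose inner product with the normal is the quantity required to be
  nonnegative in \<open>G_star_shaped\<close>.\<close>

definition dil_field :: "real \<Rightarrow> real^3 \<Rightarrow> real^3" where
  "dil_field \<alpha> z = (\<chi> i. weight \<alpha> i * z $ i)"

lemma dil_nth [simp]: "dil \<alpha> s z $ i = exp (- weight \<alpha> i * s) * z $ i"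
  by (simp add: dil_def)

lemma dil_0 [simp]: "dil \<alpha> 0 z = z"
  by (simp add: vec_eq_iff)

lemma dil_dil [simp]: "dil \<alpha> s (dil \<alpha> t z) = dil \<alpha> (s + t) z"
  by (simp add: vec_eq_iff exp_add[symmetric] algebra_simps)

lemma dil_has_vector_derivative:
  "((\<lambda>s. dil \<alpha> s z) has_vector_derivative - dil_field \<alpha> (dil \<alpha> s z)) (at s)"
  unfolding has_vector_derivative_def
proof (subst has_derivative_componentwise_within, intro ballI)
  fix b :: "real^3" assume "b \<in> Basis"
  then obtain i where b: "b = axis i 1" by (auto simp: Basis_vec_def)
  have "((\<lambda>s. exp (- weight \<alpha> i * s) * z $ i) has_real_derivative
      - (weight \<alpha> i * (exp (- weight \<alpha> i * s) * z $ i))) (at s)"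
    by (auto intro!: derivative_eq_intros)
  moreover have "(\<lambda>x. dil \<alpha> x z \<bullet> b) = (\<lambda>s. exp (- weight \<alpha> i * s) * z $ i)"
    "(\<lambda>x. x *\<^sub>R - dil_field \<alpha> (dil \<alpha> s z) \<bullet> b) = (*) (- (weight \<alpha> i * (exp (- weight \<alpha> i * s) * z $ i)))"
    by (auto simp: b inner_axis dil_field_def fun_eq_iff)
  ultimately show "((\<lambda>x. dil \<alpha> x z \<bullet> b) has_derivative (\<lambda>x. x *\<^sub>R - dil_field \<alpha> (dil \<alpha> s z) \<bullet> b)) (at s)"
    by (simp only: has_field_derivative_def)
qed

lemma continuous_on_dil: "continuous_on S (dil \<alpha> s)"
  unfolding dil_def by (intro continuous_intros)

text \<open>Star-shapedness gives the sign only on the frontier. From an interior point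
  \<open>z\<close>, moving in the direction of the gradient at \<open>w\<close> hits the frontier
  after a distance at most a multiple of \<open>- \<phi> z\<close>. The inner product is Lipschitz
  near \<open>w\<close>, so it can have dropped below zero by at most such a multiple. A loss linear
  in \<open>\<phi>\<close> is exactly what an exponential integrating factor can absorb.\<close>

lemma dil_field_grad3_ge:
  assumes sbd: "smooth_bounded_domain \<Omega>" and star: "G_star_shaped \<alpha> \<Omega>"
    and w: "w \<in> frontier \<Omega>" and ldf: "local_defining_fun \<Omega> w r \<phi>"
  obtains C \<rho> where "\<rho> > 0" "\<rho> \<le> r"
    "\<And>z. z \<in> ball w \<rho> \<Longrightarrow> z \<in> \<Omega> \<Longrightarrow> grad3 \<phi> z \<bullet> dil_field \<alpha> z \<ge> C * \<phi> z"
proof -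
  have op: "open \<Omega>" using sbd by (simp add: smooth_bounded_domain_def)
  note d = ldf[unfolded local_defining_fun_def]
  have sm: "smooth_on3 (ball w r) \<phi>" and r: "r > 0" using d by auto
  define n where "n = grad3 \<phi> w"
  \<comment> \<open>Half the value at \<open>w\<close>; by continuity \<open>\<phi>\<close> still
    grows at rate above \<open>c\<close> in direction \<open>n\<close> nearby.\<close>
  define c where "c = (norm n)\<^sup>2 / 2"
  have n0: "n \<noteq> 0" using d r by (auto simp: n_def)
  have c0: "c > 0" using n0 by (simp add: c_def)
  have cg: "isCont (grad3 \<phi>) w"
    using smooth_on3_D(3)[OF sm] r by (simp add: continuous_on_eq_continuous_at)
  have "((\<lambda>z. grad3 \<phi> z \<bullet> n) \<longlongrightarrow> n \<bullet> n) (nhds w)"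
    using cg by (auto intro!: tendsto_intros simp: isCont_def tendsto_at_iff_tendsto_nhds n_def)
  moreover have "n \<bullet> n > c" using c0 by (simp add: c_def power2_norm_eq_inner)
  ultimately have "eventually (\<lambda>z. grad3 \<phi> z \<bullet> n > c) (nhds w)" by (rule order_tendstoD(1))
  then obtain \<epsilon> where \<epsilon>: "\<epsilon> > 0" "\<And>z. dist z w < \<epsilon> \<Longrightarrow> grad3 \<phi> z \<bullet> n > c"
    by (auto simp: eventually_nhds_metric)
  define \<rho>0 where "\<rho>0 = min (\<epsilon>/2) (r/2)"
  have \<rho>0: "\<rho>0 > 0" "\<rho>0 < \<epsilon>" "\<rho>0 < r" using \<epsilon> r by (auto simp: \<rho>0_def)
  have sub: "cball w \<rho>0 \<subseteq> ball w r" using \<rho>0 by auto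
  have gn: "grad3 \<phi> z \<bullet> n > c" if "z \<in> cball w \<rho>0" for z
    using that \<rho>0 \<epsilon>(2) by (auto simp: dist_commute)
  define h where "h z = grad3 \<phi> z \<bullet> dil_field \<alpha> z" for z
  \<comment> \<open>The gradient of \<open>h\<close>; it involves second derivatives of
    \<open>\<phi>\<close>, and its bound \<open>L\<close> is the Lipschitz constant of
    \<open>h\<close>.\<close>
  define H where "H z = (\<Sum>i\<in>UNIV. (weight \<alpha> i * z $ i) *\<^sub>R grad3 (pdiff i \<phi>) z
      + (weight \<alpha> i * pdiff i \<phi> z) *\<^sub>R axis i 1)" for z
  have hD: "(h has_derivative (\<lambda>k. H z \<bullet> k)) (at z)" if "z \<in> ball w r" for z
  proof -
    have "h = (\<lambda>z. \<Sum>i\<in>UNIV. pdiff i \<phi> z * (weight \<alpha> i * z $ i))"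
      by (auto simp: h_def inner_vec_def grad3_def dil_field_def)
    moreover have "((\<lambda>z. \<Sum>i\<in>UNIV. pdiff i \<phi> z * (weight \<alpha> i * z $ i)) has_derivative
       (\<lambda>k. \<Sum>i\<in>UNIV. pdiff i \<phi> z * (weight \<alpha> i * k $ i) + (grad3 (pdiff i \<phi>) z \<bullet> k) * (weight \<alpha> i * z $ i))) (at z)"
      by (intro has_derivative_sum has_derivative_mult has_derivative_grad3 smooth_on3_D(4)[OF sm that]
          has_derivative_mult_right bounded_linear.has_derivative[OF bounded_linear_vec_nth] has_derivative_ident)
    moreover have "(\<Sum>i\<in>UNIV. pdiff i \<phi> z * (weight \<alpha> i * k $ i) + (grad3 (pdiff i \<phi>) z \<bullet> k) * (weight \<alpha> i * z $ i)) = H z \<bullet> k" for k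
      by (simp add: H_def inner_sum_left inner_add_left inner_axis' algebra_simps)
    ultimately show ?thesis by simp
  qed
  have cH: "continuous_on (cball w \<rho>0) H"
    unfolding H_def
    by (intro continuous_intros continuous_on_subset[OF smooth_on3_D(5)[OF sm] sub]
        continuous_on_subset[OF _ sub])
       (use smooth_on3_D(3)[OF sm] in \<open>auto simp: pdiff_eq_grad3 intro!: continuous_intros\<close>)
  obtain L where L: "\<And>z. z \<in> cball w \<rho>0 \<Longrightarrow> norm (H z) \<le> L"
    using compact_imp_bounded[OF compact_continuous_image[OF cH compact_cball]]
    unfolding bounded_iff by blast
  have L0: "L \<ge> 0" using L[of w] \<rho>0 norm_ge_zero[of "H w"] by (simp add: order_trans[OF norm_ge_zero])
  have hL: "\<bar>h x - h y\<bar> \<le> L * norm (x - y)" if "x \<in> cball w \<rho>0" "y \<in> cball w \<rho>0" for x y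
  proof -
    have "norm (h x - h y) \<le> L * norm (x - y)"
    proof (rule differentiable_bound[of "cball w \<rho>0" h "\<lambda>z k. H z \<bullet> k"])
      show "(h has_derivative (\<lambda>k. H z \<bullet> k)) (at z within cball w \<rho>0)" if "z \<in> cball w \<rho>0" for z
        using hD sub that by (blast intro: has_derivative_at_withinI)
      show "onorm (\<lambda>k. H z \<bullet> k) \<le> L" if "z \<in> cball w \<rho>0" for z
      proof (rule onorm_bound)
        show "norm (H z \<bullet> k) \<le> L * norm k" for k
          using Cauchy_Schwarz_ineq2[of "H z" k] mult_right_mono[OF L[OF that] norm_ge_zero[of k]] by simp
      qed (rule L0)
    qed (use that in auto)
    then show ?thesis by simp
  qed
  have \<phi>w: "\<phi> w = 0" using frontier_defining_fun_eq_0[OF op ldf w] r by simp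
  have "isCont \<phi> w"
    using smooth_on3_D(1)[OF sm] r by (simp add: differentiable_imp_continuous_within)
  \<comment> \<open>The limit quantity bounds the length of the path taken below; making it less
    than \<open>\<rho>0 / 2\<close> keeps that path in the ball.\<close>
  then have "((\<lambda>z. \<bar>\<phi> z\<bar> * norm n / c) \<longlongrightarrow> \<bar>\<phi> w\<bar> * norm n / c) (nhds w)"
    using c0 by (intro tendsto_intros) (auto simp: isCont_def tendsto_at_iff_tendsto_nhds)
  then have "eventually (\<lambda>z. \<bar>\<phi> z\<bar> * norm n / c < \<rho>0 / 2) (nhds w)"
    using \<rho>0 \<phi>w by (intro order_tendstoD(2)) auto
  then obtain \<epsilon>1 where \<epsilon>1: "\<epsilon>1 > 0" "\<And>z. dist z w < \<epsilon>1 \<Longrightarrow> \<bar>\<phi> z\<bar> * norm n / c < \<rho>0 / 2"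
    by (auto simp: eventually_nhds_metric)
  define \<rho> where "\<rho> = min \<epsilon>1 (\<rho>0 / 2)"
  show ?thesis
  proof (rule that[of \<rho> "L * norm n / c"])
    show "\<rho> > 0" "\<rho> \<le> r" using \<epsilon>1 \<rho>0 by (auto simp: \<rho>_def)
    fix z assume z: "z \<in> ball w \<rho>" "z \<in> \<Omega>"
    have zr: "z \<in> ball w r" using z \<rho>0 by (auto simp: \<rho>_def)
    have \<phi>z: "\<phi> z < 0" using d z zr by blast
    \<comment> \<open>Growing at rate at least \<open>c\<close>, \<open>\<phi>\<close> has climbed
      to zero by time \<open>\<tau>\<close>.\<close>
    define \<tau> where "\<tau> = - \<phi> z / c"
    have \<tau>: "\<tau> > 0" "\<tau> * c = - \<phi> z" using \<phi>z c0 by (auto simp: \<tau>_def divide_neg_pos)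
    have \<tau>n: "\<tau> * norm n < \<rho>0 / 2"
      using \<epsilon>1(2)[of z] z \<phi>z by (auto simp: \<tau>_def \<rho>_def dist_commute abs_if)
    define p where "p t = z + t *\<^sub>R n" for t
    have pin: "p t \<in> cball w \<rho>0" if "0 \<le> t" "t \<le> \<tau>" for t
    proof -
      have "norm (t *\<^sub>R n) \<le> \<tau> * norm n" using that by (simp add: mult_right_mono)
      then have "dist z (p t) \<le> \<rho>0 / 2" using \<tau>n by (simp add: p_def dist_norm)
      moreover have "dist w z \<le> \<rho>0 / 2" using z by (simp add: \<rho>_def)
      ultimately show ?thesis using dist_triangle[of w "p t" z] by simp
    qed
    have D: "((\<lambda>t. \<phi> (p t)) has_real_derivative (grad3 \<phi> (p t) \<bullet> n)) (at t)" if "0 \<le> t" "t \<le> \<tau>" for t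
    proof (rule curve_derivative)
      show "\<phi> differentiable (at (p t))" using smooth_on3_D(1)[OF sm] pin[OF that] sub by blast
      show "(p has_vector_derivative n) (at t)" unfolding p_def by (auto intro!: derivative_eq_intros)
    qed
    have inc: "\<phi> (p t1) < \<phi> (p t2)" if "0 \<le> t1" "t1 < t2" "t2 \<le> \<tau>" for t1 t2
    proof (rule DERIV_pos_imp_increasing[OF that(2)])
      fix t assume "t1 \<le> t" "t \<le> t2"
      then have t: "0 \<le> t" "t \<le> \<tau>" using that by auto
      have "grad3 \<phi> (p t) \<bullet> n > 0" using gn[OF pin[OF t]] c0 by simp
      with D[OF t] show "\<exists>y. ((\<lambda>t. \<phi> (p t)) has_real_derivative y) (at t) \<and> 0 < y" by blast
    qed
    have "\<phi> (p \<tau>) \<ge> 0"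
    proof -
      obtain t where t: "0 < t" "t < \<tau>" "\<phi> (p \<tau>) - \<phi> (p 0) = (\<tau> - 0) * (grad3 \<phi> (p t) \<bullet> n)"
        using MVT2[OF \<tau>(1), of "\<lambda>t. \<phi> (p t)" "\<lambda>t. grad3 \<phi> (p t) \<bullet> n"] D by auto
      have "\<tau> * (grad3 \<phi> (p t) \<bullet> n) \<ge> \<tau> * c"
        using \<tau>(1) gn[OF pin[of t]] t by (intro mult_left_mono) auto
      then show ?thesis using t \<tau> by (simp add: p_def)
    qed
    moreover have "\<phi> (p 0) \<le> 0" using \<phi>z by (simp add: p_def)
    moreover have "continuous_on {0..\<tau>} (\<lambda>t. \<phi> (p t))"
      using DERIV_isCont[OF D] by (intro continuous_at_imp_continuous_on) auto
    ultimately obtain t where t: "0 \<le> t" "t \<le> \<tau>" "\<phi> (p t) = 0"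
      using IVT'[of "\<lambda>t. \<phi> (p t)" 0 0 \<tau>] \<tau>(1) by auto
    have t0: "t > 0" using t \<phi>z by (cases "t = 0") (auto simp: p_def)
    have ptr: "p t \<in> ball w r" using pin[OF t(1,2)] sub by blast
    have fr: "p t \<in> frontier \<Omega>"
    proof -
      have "\<not> \<phi> (p t) < 0" using t(3) by simp
      then have "p t \<notin> \<Omega>" using d ptr by blast
      moreover have "p t \<in> closure \<Omega>"
        unfolding closure_approachable
      proof (intro allI impI)
        fix e :: real assume e: "e > 0"
        \<comment> \<open>At a slightly earlier time \<open>\<phi>\<close> is negative, so the point
          is in \<open>\<Omega>\<close>; the factor 2 makes its distance to \<open>p t\<close>
          strictly less than \<open>e\<close>.\<close>
        define t1 where "t1 = max 0 (t - e / (2 * norm n))"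
        have t1: "0 \<le> t1" "t1 < t" "t - t1 \<le> e / (2 * norm n)" using e n0 t0 by (auto simp: t1_def)
        have "p t1 \<in> \<Omega>"
          using d inc[OF t1(1,2) t(2)] t(3) pin[of t1] t1 t(2) sub by fastforce
        moreover have "dist (p t1) (p t) < e"
        proof -
          have "dist (p t1) (p t) = (t - t1) * norm n"
            using t1 by (simp add: p_def dist_norm flip: scaleR_left_diff_distrib)
          also have "\<dots> \<le> e / (2 * norm n) * norm n" using t1 by (intro mult_right_mono) auto
          also have "\<dots> < e" using e n0 by simp
          finally show ?thesis .
        qed
        ultimately show "\<exists>y\<in>\<Omega>. dist y (p t) < e" by blast
      qed
      ultimately show ?thesis using op by (simp add: frontier_def interior_open)
    qed
    have h0: "h (p t) \<ge> 0"
    proof -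
      \<comment> \<open>Star-shapedness speaks of defining functions on balls centred at the
        frontier point, so \<open>\<phi>\<close> is restricted to a ball around
        \<open>p t\<close>.\<close>
      define r' where "r' = r - dist w (p t)"
      have r': "r' > 0" "ball (p t) r' \<subseteq> ball w r"
        using ptr le_less_trans[OF dist_triangle[of w _ "p t"]] by (auto simp: r'_def)
      have "smooth_on3 (ball (p t) r') \<phi>"
        using sm r'(2) unfolding smooth_on3_def by (meson continuous_on_subset subsetD)
      moreover have "\<Omega> \<inter> ball (p t) r' = {x \<in> ball (p t) r'. \<phi> x < 0}"
        using d r'(2) by blast
      ultimately have "local_defining_fun \<Omega> (p t) r' \<phi>"
        using d r' unfolding local_defining_fun_def by blast
      with star fr have g: "let \<nu> = outward_normal \<phi> (p t) in
          (p t)$1 * \<nu>$1 + (p t)$2 * \<nu>$2 + (1 + \<alpha>) * (p t)$3 * \<nu>$3 \<ge> 0"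
        unfolding G_star_shaped_def by blast
      have "h (p t) / norm (grad3 \<phi> (p t)) \<ge> 0"
        using g by (simp add: Let_def outward_normal_def h_def inner_vec_def sum_3 dil_field_def
            weight_def add_divide_distrib algebra_simps)
      moreover have "grad3 \<phi> (p t) \<noteq> 0" using d ptr by blast
      ultimately show ?thesis by (simp add: zero_le_divide_iff)
    qed
    have "z = p 0" by (simp add: p_def)
    then have "\<bar>h z - h (p t)\<bar> \<le> L * norm (p 0 - p t)"
      using hL[OF pin[of 0] pin[of t]] t \<tau> by simp
    also have "norm (p 0 - p t) \<le> \<tau> * norm n" using t by (simp add: p_def mult_right_mono)
    finally have "\<bar>h z - h (p t)\<bar> \<le> L * (\<tau> * norm n)" using L0 by (simp add: mult_left_mono)
    then have "h z \<ge> - (L * (\<tau> * norm n))" using h0 by linarith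
    moreover have "- (L * (\<tau> * norm n)) = L * norm n / c * \<phi> z" by (simp add: \<tau>_def)
    ultimately show "L * norm n / c * \<phi> z \<le> grad3 \<phi> z \<bullet> dil_field \<alpha> z" by (simp add: h_def)
  qed
qed

text \<open>At a first exit time the Gronwall estimate for phi along the flow contradicts phi = 0.\<close>

lemma dil_mem:
  assumes sbd: "smooth_bounded_domain \<Omega>" and star: "G_star_shaped \<alpha> \<Omega>"
    and z: "z \<in> \<Omega>" and s: "s \<ge> 0"
  shows "dil \<alpha> s z \<in> \<Omega>"
proof (rule ccontr)
  assume neg: "dil \<alpha> s z \<notin> \<Omega>"
  have op: "open \<Omega>" using sbd by (simp add: smooth_bounded_domain_def)
  define \<gamma> where "\<gamma> t = dil \<alpha> t z" for t
  have \<gamma>D: "(\<gamma> has_vector_derivative - dil_field \<alpha> (\<gamma> t)) (at t)" for t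
    unfolding \<gamma>_def by (rule dil_has_vector_derivative)
  have c\<gamma>: "continuous_on S \<gamma>" for S
    using \<gamma>D by (intro continuous_at_imp_continuous_on) (auto intro: has_vector_derivative_continuous)
  obtain t0 where t0pos: "0 < t0" and fr: "\<gamma> t0 \<in> frontier \<Omega>"
    and before: "\<And>t. 0 \<le> t \<Longrightarrow> t < t0 \<Longrightarrow> \<gamma> t \<in> \<Omega>"
    using first_exit[OF op c\<gamma> _ _ s] z neg by (auto simp: \<gamma>_def)
  have lim: "(\<gamma> \<longlongrightarrow> \<gamma> t0) (at_left t0)"
    using c\<gamma>[of UNIV] by (meson continuous_on_eq_continuous_at open_UNIV UNIV_I isCont_def filterlim_at_split)
  obtain r \<phi> where ldf: "local_defining_fun \<Omega> (\<gamma> t0) r \<phi>"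
    using sbd fr by (meson smooth_bounded_domain_def)
  obtain C \<rho> where C: "\<rho> > 0" "\<rho> \<le> r"
    "\<And>z. z \<in> ball (\<gamma> t0) \<rho> \<Longrightarrow> z \<in> \<Omega> \<Longrightarrow> grad3 \<phi> z \<bullet> dil_field \<alpha> z \<ge> C * \<phi> z"
    using dil_field_grad3_ge[OF sbd star fr ldf] by blast
  note d = ldf[unfolded local_defining_fun_def]
  have "eventually (\<lambda>t. \<gamma> t \<in> ball (\<gamma> t0) \<rho>) (at_left t0)"
    using topological_tendstoD[OF lim open_ball, of "\<gamma> t0" \<rho>] C by simp
  moreover have "eventually (\<lambda>t. t > 0 \<and> t < t0) (at_left t0)"
    using eventually_at_left[OF t0pos] t0pos by auto
  ultimately have "eventually (\<lambda>t. \<gamma> t \<in> ball (\<gamma> t0) \<rho> \<and> t > 0 \<and> t < t0) (at_left t0)"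
    by eventually_elim simp
  then obtain b where b: "b < t0" "\<And>t. b < t \<Longrightarrow> t < t0 \<Longrightarrow> \<gamma> t \<in> ball (\<gamma> t0) \<rho> \<and> t > 0"
    using eventually_at_left[OF t0pos] by auto
  define t1 where "t1 = (max 0 b + t0) / 2"
  have t1: "b < t1" "t1 < t0" using b(1) t0pos by (auto simp: t1_def max_def)
  have inb: "\<gamma> t \<in> ball (\<gamma> t0) \<rho>" if "t1 \<le> t" "t \<le> t0" for t
    using b(2)[of t] that t1 C by (cases "t = t0") auto
  have inO: "\<gamma> t \<in> \<Omega>" if "t1 \<le> t" "t < t0" for t
    using before[of t] b(2)[of t] that t1 by auto
  \<comment> \<open>Since \<open>\<gamma>\<close> runs against \<open>dil_field\<close>, the
    derivative of \<open>k\<close> is the positive factor times the difference bounded by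
    \<open>C\<close>. So \<open>k\<close> is nondecreasing, yet positive at \<open>t1\<close> and
    zero at \<open>t0\<close>.\<close>
  define k where "k t = exp (C * t) * - \<phi> (\<gamma> t)" for t
  have dk: "(k has_real_derivative exp (C * t) * (grad3 \<phi> (\<gamma> t) \<bullet> dil_field \<alpha> (\<gamma> t) - C * \<phi> (\<gamma> t))) (at t)"
    if "t1 \<le> t" "t \<le> t0" for t
  proof -
    have "\<phi> differentiable (at (\<gamma> t))"
      using d inb[OF that] C by (intro smooth_on3_D(1)[of "ball (\<gamma> t0) r"]) auto
    from curve_derivative[OF this \<gamma>D]
    show ?thesis unfolding k_def by (auto intro!: derivative_eq_intros simp: algebra_simps)
  qed
  have "k t1 \<le> k t0"
  \<comment> \<open>The bound holds only at points of \<open>\<Omega>\<close>, which excludes the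
    end time \<open>t0\<close>; continuity covers it.\<close>
  proof (rule DERIV_nonneg_imp_increasing_open[of t1 t0 k])
    show "t1 \<le> t0" using t1 by simp
    show "\<exists>y. (k has_real_derivative y) (at t) \<and> 0 \<le> y" if t: "t1 < t" "t < t0" for t
    proof -
      have "0 \<le> exp (C * t) * (grad3 \<phi> (\<gamma> t) \<bullet> dil_field \<alpha> (\<gamma> t) - C * \<phi> (\<gamma> t))"
        using C(3)[OF inb inO, of t] t by simp
      with dk[OF less_imp_le[OF t(1)] less_imp_le[OF t(2)]] show ?thesis by blast
    qed
    show "continuous_on {t1..t0} k"
      using DERIV_isCont[OF dk] by (intro continuous_at_imp_continuous_on) auto
  qed
  moreover have "\<phi> (\<gamma> t0) = 0" using frontier_defining_fun_eq_0[OF op ldf fr] d by simp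
  moreover have "\<phi> (\<gamma> t1) < 0" using inO[of t1] inb[of t1] t1 C d by auto
  ultimately show False by (simp add: k_def zero_le_mult_iff not_le[symmetric])
qed

section \<open>Smooth product test functions\<close>

text \<open>The shape of every derivative of the standard bump exp(-1 / (1 - t^2)): this family is
  closed under differentiation.\<close>

definition bump_term :: "real poly \<Rightarrow> nat \<Rightarrow> real \<Rightarrow> real" where
  "bump_term P m t = (if \<bar>t\<bar> < 1 then poly P t / (1 - t\<^sup>2) ^ m * exp (- (1 / (1 - t\<^sup>2))) else 0)"

text \<open>The numerator after one differentiation when the exponent of the denominator is raised
  by 2; \<open>[:1, 0, -1:]\<close> is 1 - t^2.\<close>

definition bump_next :: "real poly \<Rightarrow> nat \<Rightarrow> real poly" where
  "bump_next P m = pderiv P * [:1, 0, -1:]\<^sup>2 + [:0, 2 * of_nat m:] * P * [:1, 0, -1:] - [:0, 2:] * P"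

text \<open>The inequality (1 + x / n)^n <= exp x at x = 1 / y. It makes the bump vanish to any
  polynomial order at the edge of its support.\<close>

lemma exp_minus_inverse_le:
  fixes y :: real
  assumes "y > 0" "n > 0"
  shows "exp (- (1 / y)) \<le> (real n * y) ^ n"
proof -
  have "(1 / (y * real n)) ^ n \<le> (1 + (1 / y) / real n) ^ n"
    using assms by (intro power_mono) auto
  also have "\<dots> \<le> exp (1 / y)"
    using assms by (intro exp_ge_one_plus_x_over_n_power_n) (auto intro: order_trans[of _ 0])
  finally have "(1 / (y * real n)) ^ n \<le> exp (1 / y)" .
  then have "1 / exp (1 / y) \<le> 1 / (1 / (y * real n)) ^ n"
    using assms by (intro divide_left_mono) auto
  then show ?thesis by (simp add: exp_minus inverse_eq_divide power_divide mult.commute)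
qed

text \<open>Plain calculus inside and outside the support. At the edge the exponential beats the
  pole, leaving a bound quadratic in the distance to \<open>t\<close>, so the derivative exists
  there and is 0.\<close>

lemma bump_term_has_derivative:
  "(bump_term P m has_real_derivative bump_term (bump_next P m) (m + 2) t) (at t)"
proof -
  consider "\<bar>t\<bar> < 1" | "\<bar>t\<bar> > 1" | "\<bar>t\<bar> = 1" by linarith
  then show ?thesis
  proof cases
    case 1
    have y: "1 - t\<^sup>2 > 0" using 1 by (simp add: abs_square_less_1)
    define Y where "Y = 1 - t\<^sup>2"
    define E where "E = exp (- (1 / Y))"
    have Y: "Y > 0" using y by (simp add: Y_def)
    have d1: "((\<lambda>t. (1 - t\<^sup>2) ^ m) has_real_derivative - (real m * Y ^ (m - 1) * (2 * t))) (at t)"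
      by (auto intro!: derivative_eq_intros simp: Y_def)
    have "((\<lambda>t. poly P t / (1 - t\<^sup>2) ^ m) has_real_derivative
        (poly (pderiv P) t * Y ^ m - poly P t * - (real m * Y ^ (m - 1) * (2 * t))) / (Y ^ m * Y ^ m)) (at t)"
      using DERIV_divide[OF poly_DERIV[of P t] d1] Y by (simp add: Y_def)
    moreover have "((\<lambda>t. exp (- (1 / (1 - t\<^sup>2)))) has_real_derivative E * - (2 * t / Y\<^sup>2)) (at t)"
      using Y by (auto intro!: derivative_eq_intros simp: Y_def E_def power2_eq_square)
    ultimately have "((\<lambda>t. poly P t / (1 - t\<^sup>2) ^ m * exp (- (1 / (1 - t\<^sup>2)))) has_real_derivative
        (poly (pderiv P) t * Y ^ m - poly P t * - (real m * Y ^ (m - 1) * (2 * t))) / (Y ^ m * Y ^ m) * E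
        + E * - (2 * t / Y\<^sup>2) * (poly P t / Y ^ m)) (at t)"
      unfolding Y_def E_def by (rule DERIV_mult)
    moreover have "(poly (pderiv P) t * Y ^ m - poly P t * - (real m * Y ^ (m - 1) * (2 * t))) / (Y ^ m * Y ^ m) * E
        + E * - (2 * t / Y\<^sup>2) * (poly P t / Y ^ m) = bump_term (bump_next P m) (m + 2) t"
    proof -
      \<comment> \<open>The factor \<open>real m\<close> makes this true at \<open>m = 0\<close>,
        where \<open>m - 1\<close> is truncated.\<close>
      have pm: "real m * Y ^ (m - 1) = real m * Y ^ m / Y" using Y by (cases m) auto
      have pn: "poly (bump_next P m) t = poly (pderiv P) t * Y\<^sup>2 + 2 * real m * t * poly P t * Y - 2 * t * poly P t"
        by (simp add: bump_next_def Y_def power2_eq_square algebra_simps)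
      have "(poly (pderiv P) t * Y ^ m - poly P t * - (real m * Y ^ m / Y * (2 * t))) / (Y ^ m * Y ^ m) * E
          + E * - (2 * t / Y\<^sup>2) * (poly P t / Y ^ m)
        = (poly (pderiv P) t * Y\<^sup>2 + 2 * real m * t * poly P t * Y - 2 * t * poly P t) / Y ^ (m + 2) * E"
        using Y by (simp add: field_simps power_add power2_eq_square)
      then show ?thesis
        unfolding pm using 1 by (simp add: bump_term_def pn Y_def[symmetric] E_def[symmetric])
    qed
    ultimately have "((\<lambda>t. poly P t / (1 - t\<^sup>2) ^ m * exp (- (1 / (1 - t\<^sup>2)))) has_real_derivative
       bump_term (bump_next P m) (m + 2) t) (at t)" by simp
    moreover have "eventually (\<lambda>x. bump_term P m x = poly P x / (1 - x\<^sup>2) ^ m * exp (- (1 / (1 - x\<^sup>2)))) (nhds t)"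
    proof -
      have "open {x::real. \<bar>x\<bar> < 1}" by (intro open_Collect_less continuous_intros)
      then have "eventually (\<lambda>x. x \<in> {x::real. \<bar>x\<bar> < 1}) (nhds t)"
        using 1 by (intro eventually_nhds_in_open) auto
      then show ?thesis by eventually_elim (simp add: bump_term_def)
    qed
    ultimately show ?thesis by (subst DERIV_cong_ev[OF refl _ refl]) auto
  next
    case 2
    have "open {x::real. \<bar>x\<bar> > 1}" by (intro open_Collect_less continuous_intros)
    then have "eventually (\<lambda>x. x \<in> {x::real. \<bar>x\<bar> > 1}) (nhds t)"
      using 2 by (intro eventually_nhds_in_open) auto
    then have "eventually (\<lambda>x. bump_term P m x = 0) (nhds t)"
      by eventually_elim (simp add: bump_term_def)
    then have "(bump_term P m has_real_derivative 0) (at t)"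
      by (subst DERIV_cong_ev[OF refl _ refl]) auto
    then show ?thesis using 2 by (simp add: bump_term_def)
  next
    case 3
    have "bounded (poly P ` {-1..1})"
      by (intro compact_imp_bounded compact_continuous_image continuous_intros) auto
    then obtain C where C: "\<And>x. x \<in> {-1..1} \<Longrightarrow> \<bar>poly P x\<bar> \<le> C" unfolding bounded_iff real_norm_def by blast
    have C0: "C \<ge> 0" using C[of 0] by simp
    define D where "D = C * real (m + 2) ^ (m + 2) * 4"
    have D0: "D \<ge> 0" using C0 by (simp add: D_def)
    have bd: "\<bar>bump_term P m x\<bar> \<le> D * (x - t)\<^sup>2" for x
    proof (cases "\<bar>x\<bar> < 1")
      case True
      define y where "y = 1 - x\<^sup>2"
      have y: "y > 0" using True by (simp add: abs_square_less_1 y_def)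
      have y2: "y \<le> 2 * \<bar>x - t\<bar>"
      proof -
        have "t\<^sup>2 = 1" using 3 by (metis abs_1 power2_abs power_one)
        then have "y = (t - x) * (t + x)" by (simp add: y_def power2_eq_square algebra_simps)
        also have "\<dots> \<le> \<bar>t - x\<bar> * \<bar>t + x\<bar>" by (metis abs_ge_self abs_mult)
        also have "\<dots> \<le> \<bar>t - x\<bar> * 2" using True 3 by (intro mult_left_mono) auto
        finally show ?thesis by (simp add: abs_minus_commute mult.commute)
      qed
      have Cx: "\<bar>poly P x\<bar> \<le> C" using C[of x] True by (simp add: abs_less_iff)
      have "\<bar>bump_term P m x\<bar> = \<bar>poly P x\<bar> / y ^ m * exp (- (1 / y))"
        using True y by (simp add: bump_term_def y_def[symmetric] abs_mult)
      \<comment> \<open>The exponent \<open>m + 2\<close> cancels the pole of order \<open>m\<close>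
        and leaves a square.\<close>
      also have "\<dots> \<le> C / y ^ m * (real (m + 2) * y) ^ (m + 2)"
        using Cx y C0 exp_minus_inverse_le[OF y, of "m + 2"]
        by (intro mult_mono divide_right_mono) auto
      also have "\<dots> = C * real (m + 2) ^ (m + 2) * y\<^sup>2"
      proof -
        define k where "k = real (m + 2) ^ (m + 2)"
        have e: "(real (m + 2) * y) ^ (m + 2) = k * (y ^ m * y\<^sup>2)"
          unfolding k_def by (simp only: power_mult_distrib power_add[of y m 2])
        show ?thesis unfolding e k_def[symmetric] using y by simp
      qed
      also have "\<dots> \<le> C * real (m + 2) ^ (m + 2) * (2 * \<bar>x - t\<bar>)\<^sup>2"
        using y y2 C0 by (intro mult_left_mono power_mono) auto
      also have "\<dots> = D * (x - t)\<^sup>2" by (simp add: D_def power_mult_distrib)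
      finally show ?thesis .
    qed (use D0 in \<open>simp add: bump_term_def\<close>)
    have "((\<lambda>h. (bump_term P m (t + h) - bump_term P m t) / h) \<longlongrightarrow> 0) (at 0)"
    proof (rule Lim_null_comparison)
      show "eventually (\<lambda>h. norm ((bump_term P m (t + h) - bump_term P m t) / h) \<le> D * \<bar>h\<bar>) (at 0)"
      proof (intro always_eventually allI)
        show "norm ((bump_term P m (t + h) - bump_term P m t) / h) \<le> D * \<bar>h\<bar>" for h
          using bd[of "t + h"] 3 by (simp add: bump_term_def[of P m t] divide_le_eq power2_eq_square abs_mult_self_eq mult.assoc)
      qed
      show "((\<lambda>h. D * \<bar>h\<bar>) \<longlongrightarrow> 0) (at 0)" by (auto intro!: tendsto_eq_intros)
    qed
    then show ?thesis using 3 by (simp add: DERIV_def bump_term_def[of "bump_next P m"])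
  qed
qed

text \<open>Carrying all derivatives along as one sequence turns iterated partial derivatives of
  products into index arithmetic.\<close>

definition derivs :: "(nat \<Rightarrow> real \<Rightarrow> real) \<Rightarrow> bool" where
  "derivs F \<longleftrightarrow> (\<forall>n t. (F n has_real_derivative F (Suc n) t) (at t))"

lemma derivs_affine:
  assumes "derivs F"
  shows "derivs (\<lambda>n t. c ^ n * F n (c * (t - d)))"
  unfolding derivs_def
proof (intro allI)
  fix n t
  have F: "(F n has_real_derivative F (Suc n) s) (at s)" for s
    using assms by (simp add: derivs_def)
  show "((\<lambda>t. c ^ n * F n (c * (t - d))) has_real_derivative c ^ Suc n * F (Suc n) (c * (t - d))) (at t)"
    by (rule derivative_eq_intros DERIV_chain2[OF F] refl | simp)+
qed

lemma derivs_diff: "derivs F \<Longrightarrow> derivs G \<Longrightarrow> derivs (\<lambda>n t. F n t - G n t)"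
  unfolding derivs_def by (auto intro!: DERIV_diff)

lemma derivs_Suc: "derivs F \<Longrightarrow> derivs (\<lambda>n. F (Suc n))"
  by (simp add: derivs_def)

text \<open>The bump is entry 1; entry 0 is a primitive of it, a smooth step constant on either side
  of (-1, 1). The difference of two shifted steps is a compactly supported plateau whose derivative
  is a difference of two bumps.\<close>

definition bump_seq :: "(nat \<Rightarrow> real \<Rightarrow> real) \<Rightarrow> bool" where
  "bump_seq F \<longleftrightarrow> derivs F \<and> (\<forall>n t. \<bar>t\<bar> \<ge> 1 \<longrightarrow> F (Suc n) t = 0) \<and> (\<forall>t. \<bar>t\<bar> < 1 \<longrightarrow> F (Suc 0) t > 0)"

lemma ex_bump_seq: "\<exists>F. bump_seq F"
proof -
  \<comment> \<open>Numerator 1 and exponent 0 encode exp(-1 / (1 - t^2)); each iteration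
    differentiates once.\<close>
  define PM where "PM n = ((\<lambda>(P, m). (bump_next P m, m + 2)) ^^ n) (1, 0)" for n :: nat
  define \<beta> where "\<beta> n = case_prod bump_term (PM n)" for n
  have \<beta>D: "(\<beta> n has_real_derivative \<beta> (Suc n) t) (at t)" for n t
    using bump_term_has_derivative[of "fst (PM n)" "snd (PM n)" t]
    by (simp add: \<beta>_def PM_def case_prod_beta)
  have "\<exists>B. \<forall>x::real. -\<infinity> < ereal x \<longrightarrow> ereal x < \<infinity> \<longrightarrow> (B has_vector_derivative \<beta> 0 x) (at x)"
    by (rule einterval_antiderivative) (use DERIV_isCont[OF \<beta>D] in auto)
  then obtain B where B: "\<And>x. (B has_real_derivative \<beta> 0 x) (at x)"
    by (auto simp: has_real_derivative_iff_has_vector_derivative)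
  have B': "bump_seq (\<lambda>n. case n of 0 \<Rightarrow> B | Suc k \<Rightarrow> \<beta> k)"
    unfolding bump_seq_def
  proof (intro conjI allI impI)
    show "derivs (\<lambda>n. case n of 0 \<Rightarrow> B | Suc k \<Rightarrow> \<beta> k)"
      unfolding derivs_def
    proof (intro allI)
      show "((case n of 0 \<Rightarrow> B | Suc k \<Rightarrow> \<beta> k) has_real_derivative
          (case Suc n of 0 \<Rightarrow> B | Suc k \<Rightarrow> \<beta> k) t) (at t)" for n t
        by (cases n) (simp_all add: B \<beta>D)
    qed
  qed (simp_all add: \<beta>_def PM_def bump_term_def case_prod_beta)
  show ?thesis by (rule exI, rule B')
qed

lemma bump_seq_nonneg: "bump_seq F \<Longrightarrow> F (Suc 0) t \<ge> 0"
  by (cases "\<bar>t\<bar> < 1") (auto simp: bump_seq_def less_imp_le)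

lemma bump_seq_mono:
  assumes "bump_seq F" "s \<le> t"
  shows "F 0 s \<le> F 0 t"
  using bump_seq_nonneg[OF assms(1)] assms
  by (intro DERIV_nonneg_imp_nondecreasing[OF assms(2)]) (auto simp: bump_seq_def derivs_def)

lemma bump_seq_const:
  assumes F: "bump_seq F" and st: "s \<le> t" and "t \<le> -1 \<or> s \<ge> 1"
  shows "F 0 s = F 0 t"
proof (rule antisym)
  show "F 0 s \<le> F 0 t" by (rule bump_seq_mono[OF F st])
  show "F 0 t \<le> F 0 s"
  proof (rule DERIV_nonpos_imp_nonincreasing[OF st])
    fix x assume "s \<le> x" "x \<le> t"
    then have "F (Suc 0) x = 0" using assms(3) F by (auto simp: bump_seq_def)
    moreover have "(F 0 has_real_derivative F (Suc 0) x) (at x)" using F by (simp add: bump_seq_def derivs_def)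
    ultimately show "\<exists>y. (F 0 has_real_derivative y) (at x) \<and> y \<le> 0" by auto
  qed
qed

text \<open>\<open>n\<close> counts the derivatives taken in each coordinate, so a partial
  derivative raises one entry of \<open>n\<close>.\<close>

definition tens :: "(3 \<Rightarrow> nat \<Rightarrow> real \<Rightarrow> real) \<Rightarrow> (3 \<Rightarrow> nat) \<Rightarrow> real^3 \<Rightarrow> real" where
  "tens F n z = (\<Prod>j\<in>UNIV. F j (n j) (z $ j))"

lemma tens_axis_derivative:
  assumes "\<forall>j. derivs (F j)"
  shows "((\<lambda>t. tens F n (z + t *\<^sub>R axis i 1)) has_real_derivative tens F (n(i := Suc (n i))) z) (at 0)"
proof -
  have eq: "tens F k w = F i (k i) (w $ i) * (\<Prod>j\<in>UNIV-{i}. F j (k j) (w $ j))" for k w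
    unfolding tens_def by (rule prod.remove) auto
  have "(F i (n i) has_real_derivative F i (Suc (n i)) (z $ i)) (at (z $ i + 0))"
    using assms by (simp add: derivs_def)
  then have "((\<lambda>t. F i (n i) (z $ i + t)) has_real_derivative F i (Suc (n i)) (z $ i)) (at 0)"
    using DERIV_at_within_shift[of "F i (n i)" _ "z $ i" 0 UNIV] by simp
  then have "((\<lambda>t. F i (n i) (z $ i + t) * (\<Prod>j\<in>UNIV-{i}. F j (n j) (z $ j))) has_real_derivative
      F i (Suc (n i)) (z $ i) * (\<Prod>j\<in>UNIV-{i}. F j (n j) (z $ j))) (at 0)"
    by (rule DERIV_cmult_right)
  then show ?thesis by (simp add: eq axis_def cong: prod.cong_simp)
qed

lemma pdiff_tens:
  assumes "\<forall>j. derivs (F j)"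
  shows "pdiff i (tens F n) = tens F (n(i := Suc (n i)))"
  unfolding pdiff_def[abs_def] by (rule ext, rule DERIV_imp_deriv[OF tens_axis_derivative[OF assms]])

lemma iter_pdiff_tens:
  assumes "\<forall>j. derivs (F j)"
  shows "iter_pdiff is (tens F n) = tens F (\<lambda>j. n j + count_list is j)"
proof (induction "is")
  case Nil then show ?case by simp
next
  case (Cons i "is")
  have "(\<lambda>j. n j + count_list is j)(i := Suc (n i + count_list is i)) = (\<lambda>j. n j + count_list (i # is) j)"
    by auto
  then show ?case by (simp add: Cons pdiff_tens[OF assms])
qed

lemma tens_differentiable:
  assumes "\<forall>j. derivs (F j)"
  shows "tens F n differentiable (at z)"
proof -
  have "(\<lambda>z. F j (n j) (z $ j)) differentiable (at z)" for j
  proof -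
    have "(F j (n j) has_derivative (*) (F j (Suc (n j)) (z $ j))) (at (z $ j))"
      using assms by (simp add: derivs_def has_field_derivative_def)
    from has_derivative_compose[OF bounded_linear.has_derivative[OF bounded_linear_vec_nth has_derivative_ident] this]
    show ?thesis unfolding differentiable_def by blast
  qed
  then show ?thesis unfolding tens_def[abs_def] UNIV_3 by simp
qed

lemma continuous_on_tens:
  assumes "\<forall>j. derivs (F j)"
  shows "continuous_on S (tens F n)"
  using tens_differentiable[OF assms]
  by (intro continuous_at_imp_continuous_on) (auto intro: differentiable_imp_continuous_within)

lemma smooth_on3_tens:
  assumes "\<forall>j. derivs (F j)"
  shows "smooth_on3 UNIV (tens F n)"
  unfolding smooth_on3_def iter_pdiff_tens[OF assms]
  using continuous_on_tens[OF assms] tens_differentiable[OF assms] by blast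

lemma test_fun_tens:
  assumes "\<forall>j. derivs (F j)" "closed K" "bounded K" "K \<subseteq> U" "\<And>z. z \<notin> K \<Longrightarrow> tens F n z = 0"
  shows "test_fun U (tens F n)"
proof -
  have "closure {z. tens F n z \<noteq> 0} \<subseteq> K"
    using assms(2,5) by (intro closure_minimal) auto
  then show ?thesis
    unfolding test_fun_def using assms smooth_on3_tens[OF assms(1)]
    by (meson bounded_subset closed_closure compact_eq_bounded_closed order_trans)
qed

lemma tens_eq_0_outside:
  assumes "\<And>j k t. t < lo $ j \<or> t > hi $ j \<Longrightarrow> F j k t = 0" "z \<notin> cbox lo hi"
  shows "tens F n z = 0"
proof -
  obtain j where "z $ j < lo $ j \<or> z $ j > hi $ j" using assms(2) by (auto simp: mem_box_cart not_le)
  then show ?thesis using assms(1) by (auto simp: tens_def intro!: bexI[of _ j])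
qed

lemma tens_bounded:
  assumes "\<forall>j. derivs (F j)" "\<And>j k t. t < lo $ j \<or> t > hi $ j \<Longrightarrow> F j k t = 0"
  obtains V where "\<And>z. \<bar>tens F n z\<bar> \<le> V" "V \<ge> 0"
proof -
  have "bounded (tens F n ` cbox lo hi)"
    by (intro compact_imp_bounded compact_continuous_image continuous_on_tens assms(1) compact_cbox)
  then obtain V where V: "\<And>z. z \<in> cbox lo hi \<Longrightarrow> \<bar>tens F n z\<bar> \<le> V" unfolding bounded_iff by auto
  show ?thesis
  proof (rule that[of "max V 0"])
    show "\<bar>tens F n z\<bar> \<le> max V 0" for z
      using V[of z] tens_eq_0_outside[of lo hi F z n] assms(2) by (cases "z \<in> cbox lo hi") (auto simp: max_def)
  qed simp
qed

lemma set_borel_measurable_continuous_open: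
  fixes f :: "'a::euclidean_space \<Rightarrow> real"
  assumes "open \<Omega>" "continuous_on \<Omega> f"
  shows "set_borel_measurable borel \<Omega> f"
  unfolding set_borel_measurable_def
  using assms by (intro borel_measurable_continuous_on_indicator) auto

lemma tens_integration_by_parts:
  assumes \<Omega>: "open \<Omega>" "bounded \<Omega>" "negligible (frontier \<Omega>)"
    and F: "\<forall>j. derivs (F j)" and supp: "\<And>j k t. t < lo $ j \<or> t > hi $ j \<Longrightarrow> F j k t = 0"
    and sub: "cbox lo hi \<subseteq> \<Omega>"
    and mf: "set_borel_measurable borel \<Omega> f" and mf': "set_borel_measurable borel \<Omega> f'"
    and bf: "\<And>z. z \<in> \<Omega> \<Longrightarrow> \<bar>f z\<bar> \<le> M" and bf': "\<And>z. z \<in> \<Omega> \<Longrightarrow> \<bar>f' z\<bar> \<le> M'"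
    and df: "\<And>z. z \<in> \<Omega> \<Longrightarrow> ((\<lambda>t. f (z + t *\<^sub>R axis i 1)) has_real_derivative f' z) (at 0)"
  shows "(LINT z:\<Omega>|lborel. f z * tens F (n(i := Suc (n i))) z) = - (LINT z:\<Omega>|lborel. f' z * tens F n z)"
proof -
  obtain V where V: "\<And>z. \<bar>tens F n z\<bar> \<le> V" using tens_bounded[OF F supp] by metis
  obtain V' where V': "\<And>z. \<bar>tens F (n(i := Suc (n i))) z\<bar> \<le> V'" using tens_bounded[OF F supp] by metis
  show ?thesis
  proof (rule directional_integration_by_parts[OF \<Omega> mf mf' _ _ bf bf' df])
    show "tens F n z = 0" if "z \<notin> \<Omega>" for z
      using that sub by (intro tens_eq_0_outside[OF supp, where lo=lo and hi=hi]) auto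
    show "\<bar>tens F n (z + t *\<^sub>R axis i 1) - tens F n z\<bar> \<le> V' * \<bar>t\<bar>" for z t
    proof -
      have "((\<lambda>r. tens F n (z + r *\<^sub>R axis i 1)) has_real_derivative
          tens F (n(i := Suc (n i))) (z + r *\<^sub>R axis i 1)) (at r)" for r
        using tens_axis_derivative[OF F, of n "z + r *\<^sub>R axis i 1" i]
          DERIV_at_within_shift[of "\<lambda>r. tens F n (z + r *\<^sub>R axis i 1)" _ r 0 UNIV]
        by (simp add: scaleR_left_distrib add.assoc)
      then have "norm (tens F n (z + t *\<^sub>R axis i 1) - tens F n (z + 0 *\<^sub>R axis i 1)) \<le> V' * norm (t - 0)"
        using V' by (intro field_differentiable_bound[of UNIV "\<lambda>r. tens F n (z + r *\<^sub>R axis i 1)"]) auto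
      then show ?thesis by simp
    qed
  qed (use V V' tens_axis_derivative[OF F] continuous_on_tens[OF F] \<Omega>(1) in
      \<open>auto intro!: set_borel_measurable_continuous_open\<close>)
qed

lemma set_integrable_compact_support:
  fixes A \<psi> :: "'a::euclidean_space \<Rightarrow> real"
  assumes "compact K" "K \<subseteq> \<Omega>" "continuous_on K A" "continuous_on K \<psi>" "\<And>z. z \<notin> K \<Longrightarrow> \<psi> z = 0"
  shows "set_integrable lborel \<Omega> (\<lambda>z. A z * \<psi> z)"
proof -
  have "integrable lborel (\<lambda>z. indicator K z *\<^sub>R (A z * \<psi> z))"
    using assms by (intro borel_integrable_compact continuous_intros)
  moreover have "(\<lambda>z. indicator K z *\<^sub>R (A z * \<psi> z)) = (\<lambda>z. indicator \<Omega> z *\<^sub>R (A z * \<psi> z))"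
    using assms(2,5) by (auto simp: fun_eq_iff indicator_def)
  ultimately show ?thesis by (simp add: set_integrable_def)
qed

text \<open>Index \<open>Suc 0\<close> selects the bump instead of its primitive in every
  coordinate. The mass is not normalised; it is positive and independent of
  \<open>p\<close>.\<close>

definition bump3 :: "(nat \<Rightarrow> real \<Rightarrow> real) \<Rightarrow> real \<Rightarrow> real^3 \<Rightarrow> real^3 \<Rightarrow> real" where
  "bump3 F \<epsilon> p = tens (\<lambda>j n t. (1 / \<epsilon>) ^ n * F n (1 / \<epsilon> * (t - p $ j))) (\<lambda>_. Suc 0)"

lemma bump3:
  assumes F: "bump_seq F" and \<epsilon>: "\<epsilon> > 0"
  shows bump3_nonneg: "bump3 F \<epsilon> p z \<ge> 0"
    and bump3_eq_0: "z \<notin> cbox (\<chi> j. p $ j - \<epsilon>) (\<chi> j. p $ j + \<epsilon>) \<Longrightarrow> bump3 F \<epsilon> p z = 0"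
    and continuous_on_bump3: "continuous_on S (bump3 F \<epsilon> p)"
    and integrable_bump3: "integrable lborel (bump3 F \<epsilon> p)"
    and integral_bump3_shift: "(\<integral>z. bump3 F \<epsilon> p z \<partial>lborel) = (\<integral>z. bump3 F \<epsilon> 0 z \<partial>lborel)"
    and integral_bump3_pos: "(\<integral>z. bump3 F \<epsilon> p z \<partial>lborel) > 0"
proof -
  have dF: "derivs F" using F by (simp add: bump_seq_def)
  show nonneg: "bump3 F \<epsilon> p z \<ge> 0" for p z
    using \<epsilon> bump_seq_nonneg[OF F] by (auto simp: bump3_def tens_def intro!: prod_nonneg mult_nonneg_nonneg)
  show zero: "bump3 F \<epsilon> p z = 0" if z: "z \<notin> cbox (\<chi> j. p $ j - \<epsilon>) (\<chi> j. p $ j + \<epsilon>)" for p z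
  proof -
    obtain j where "z $ j < p $ j - \<epsilon> \<or> z $ j > p $ j + \<epsilon>" using z by (auto simp: mem_box_cart not_le)
    then have "\<bar>1 / \<epsilon> * (z $ j - p $ j)\<bar> \<ge> 1" using \<epsilon> by (auto simp: abs_mult field_simps abs_if)
    then have "F (Suc 0) (1 / \<epsilon> * (z $ j - p $ j)) = 0" using F unfolding bump_seq_def by blast
    then show ?thesis by (auto simp: bump3_def tens_def intro!: bexI[of _ j])
  qed
  show cont: "continuous_on S (bump3 F \<epsilon> p)" for S p
    unfolding bump3_def by (intro continuous_on_tens allI derivs_affine[OF dF])
  show int: "integrable lborel (bump3 F \<epsilon> p)" for p
  proof -
    have "set_integrable lborel UNIV (\<lambda>z. 1 * bump3 F \<epsilon> p z)"
      by (rule set_integrable_compact_support[of "cbox (\<chi> j. p $ j - \<epsilon>) (\<chi> j. p $ j + \<epsilon>)"])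
         (auto intro: cont zero)
    then show ?thesis by (simp add: set_integrable_def)
  qed
  have shift: "bump3 F \<epsilon> p (p + z) = bump3 F \<epsilon> 0 z" for p z
    by (simp add: bump3_def tens_def)
  have [measurable]: "bump3 F \<epsilon> p \<in> borel_measurable borel" for p
    using cont by (intro borel_measurable_continuous_onI)
  show sh: "(\<integral>z. bump3 F \<epsilon> p z \<partial>lborel) = (\<integral>z. bump3 F \<epsilon> 0 z \<partial>lborel)" for p
    by (subst lborel_distr_plus[of p, symmetric], subst integral_distr) (auto simp: shift)
  show "(\<integral>z. bump3 F \<epsilon> p z \<partial>lborel) > 0"
  proof (rule ccontr)
    assume "\<not> ?thesis"
    moreover have "(\<integral>z. bump3 F \<epsilon> p z \<partial>lborel) \<ge> 0"
      using nonneg by (intro Bochner_Integration.integral_nonneg)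
    ultimately have "(\<integral>z. bump3 F \<epsilon> p z \<partial>lborel) = 0" by linarith
    then have "AE z in lborel. bump3 F \<epsilon> p z = 0"
      using integral_nonneg_eq_0_iff_AE[OF int] nonneg by auto
    \<comment> \<open>A continuous function vanishing almost everywhere vanishes everywhere,
      contrary to its value at the centre.\<close>
    then have "AE z in lebesgue. bump3 F \<epsilon> p z = 0" by (rule AE_completion)
    then have "p \<in> {z. bump3 F \<epsilon> p z = 0}"
      using cont[of UNIV p] by (intro mem_closed_if_AE_lebesgue closed_Collect_eq continuous_intros) auto
    moreover have "bump3 F \<epsilon> p p > 0"
      using F \<epsilon> by (auto simp: bump3_def tens_def bump_seq_def intro!: prod_pos mult_pos_pos)
    ultimately show False by simp
  qed
qed

text \<open>Averaging against a small bump recovers the value at the centre up to the oscillation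
  \<open>\<eta>\<close>; the mass stays as a common factor to be cancelled later.\<close>

lemma bump3_mean:
  assumes F: "bump_seq F" and \<epsilon>: "\<epsilon> > 0"
    and sub: "cbox (\<chi> j. p $ j - \<epsilon>) (\<chi> j. p $ j + \<epsilon>) \<subseteq> \<Omega>"
    and g: "continuous_on (cbox (\<chi> j. p $ j - \<epsilon>) (\<chi> j. p $ j + \<epsilon>)) g"
    and bd: "\<And>z. z \<in> cbox (\<chi> j. p $ j - \<epsilon>) (\<chi> j. p $ j + \<epsilon>) \<Longrightarrow> \<bar>g z - a\<bar> \<le> \<eta>"
  shows "\<bar>(LINT z:\<Omega>|lborel. g z * bump3 F \<epsilon> p z) - a * (\<integral>z. bump3 F \<epsilon> 0 z \<partial>lborel)\<bar>
    \<le> \<eta> * (\<integral>z. bump3 F \<epsilon> 0 z \<partial>lborel)"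
proof -
  let ?K = "cbox (\<chi> j. p $ j - \<epsilon>) (\<chi> j. p $ j + \<epsilon>)"
  let ?b = "bump3 F \<epsilon> p"
  note int = integrable_bump3[OF F \<epsilon>, of p]
  have ig: "set_integrable lborel \<Omega> (\<lambda>z. g z * ?b z)"
    by (rule set_integrable_compact_support[OF _ sub g])
       (auto intro: continuous_on_bump3[OF F \<epsilon>] bump3_eq_0[OF F \<epsilon>])
  then have ig': "integrable lborel (\<lambda>z. indicator \<Omega> z * (g z * ?b z))"
    by (simp add: set_integrable_def)
  have "(LINT z:\<Omega>|lborel. g z * ?b z) - a * (\<integral>z. ?b z \<partial>lborel)
      = (\<integral>z. indicator \<Omega> z * (g z * ?b z) - a * ?b z \<partial>lborel)"
    using ig' int by (simp add: set_lebesgue_integral_def)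
  also have "\<bar>\<dots>\<bar> \<le> (\<integral>z. \<eta> * ?b z \<partial>lborel)"
  proof (rule integral_abs_bound[THEN order_trans], rule integral_mono)
    show "integrable lborel (\<lambda>z. \<bar>indicator \<Omega> z * (g z * ?b z) - a * ?b z\<bar>)"
      using ig' int by (intro integrable_abs Bochner_Integration.integrable_diff integrable_mult_right)
    show "integrable lborel (\<lambda>z. \<eta> * ?b z)" using int by simp
    show "\<bar>indicator \<Omega> z * (g z * ?b z) - a * ?b z\<bar> \<le> \<eta> * ?b z" for z
    proof (cases "z \<in> ?K")
      case True
      then have "indicator \<Omega> z * (g z * ?b z) - a * ?b z = (g z - a) * ?b z"
        using sub by (auto simp: algebra_simps indicator_def)
      then show ?thesis
        using mult_right_mono[OF bd[OF True] bump3_nonneg[OF F \<epsilon>, of p z]] bump3_nonneg[OF F \<epsilon>, of p z]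
        by (simp add: abs_mult)
    next
      case False then show ?thesis using bump3_eq_0[OF F \<epsilon> False] by simp
    qed
  qed
  finally show ?thesis by (simp add: integral_bump3_shift[OF F \<epsilon>, of p])
qed

section \<open>Distributional second derivatives\<close>

text \<open>The test function has the i-th derivative bump(p1) - bump(p2); subtracting the quadratic
  A(z0) x_i^2 / 2 from u leaves an error controlled by the oscillation of A.\<close>

lemma distributional_second_derivative_increment:
  fixes z0 :: "real^3"
  assumes \<Omega>: "open \<Omega>" "bounded \<Omega>" "negligible (frontier \<Omega>)"
    and U: "U \<subseteq> \<Omega>"
    and du: "\<And>z. z \<in> \<Omega> \<Longrightarrow> u differentiable (at z)"
    and bu: "\<And>z. z \<in> \<Omega> \<Longrightarrow> \<bar>u z\<bar> \<le> M"
    and cu': "continuous_on \<Omega> (pdiff i u)" and bu': "\<And>z. z \<in> \<Omega> \<Longrightarrow> \<bar>pdiff i u z\<bar> \<le> M'"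
    and A: "continuous_on U A"
    and weak: "\<And>\<psi>. test_fun U \<psi> \<Longrightarrow>
      integral \<Omega> (\<lambda>z. u z * iter_pdiff [i, i] \<psi> z) = integral \<Omega> (\<lambda>z. A z * \<psi> z)"
    and r: "r > 0" "cball z0 r \<subseteq> U" and osc: "\<And>z. z \<in> cball z0 r \<Longrightarrow> \<bar>A z - A z0\<bar> \<le> \<eta>"
    and s: "s1 < s2" "\<bar>s1\<bar> \<le> r / 4" "\<bar>s2\<bar> \<le> r / 4"
  shows "\<bar>pdiff i u (z0 + s2 *\<^sub>R axis i 1) - pdiff i u (z0 + s1 *\<^sub>R axis i 1) - A z0 * (s2 - s1)\<bar> \<le> \<eta> * (s2 - s1)"
proof -
  obtain B where B: "bump_seq B" using ex_bump_seq by blast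
  then have dB: "derivs B" by (simp add: bump_seq_def)
  define p where "p s = z0 + s *\<^sub>R axis i 1" for s
  \<comment> \<open>The first derivative after subtracting the quadratic from \<open>u\<close>; its
    increment is the quantity to be bounded.\<close>
  define h where "h z = pdiff i u z - A z0 * z $ i" for z
  have pj: "p s $ j = z0 $ j + (if j = i then s else 0)" for s j by (simp add: p_def axis_def)
  have \<eta>0: "\<eta> \<ge> 0" using osc[of z0] r by simp
  have cnt: "continuous_on U h" "continuous_on U (\<lambda>z. z $ i)"
    unfolding h_def by (intro continuous_intros continuous_on_subset[OF cu' U])+
  have cballU: "cball (p s) (r / 2) \<subseteq> U" if "\<bar>s\<bar> \<le> r / 4" for s
  proof -
    have "dist z0 (p s) \<le> r / 4" using that by (simp add: p_def dist_norm)
    then have "cball (p s) (r / 2) \<subseteq> cball z0 r"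
      using r(1) by (intro cball_subset_cball_iff[THEN iffD2]) (auto simp: dist_commute)
    then show ?thesis using r by blast
  qed
  \<comment> \<open>\<open>\<eta>'\<close> is the error of replacing values at \<open>p s1\<close>
    and \<open>p s2\<close> by averages over small cubes; it is removed at the end.\<close>
  have sol: "\<bar>h (p s2) - h (p s1)\<bar> \<le> \<eta> * (s2 - s1) + 2 * (1 + \<eta>) * \<eta>'" if \<eta>': "\<eta>' > 0" for \<eta>'
  proof -
    have "\<exists>d>0. \<forall>z. dist z (p s) < d \<longrightarrow> \<bar>h z - h (p s)\<bar> \<le> \<eta>' \<and> \<bar>z $ i - p s $ i\<bar> \<le> \<eta>'"
      if s: "\<bar>s\<bar> \<le> r / 4" for s
    proof -
      have int: "p s \<in> interior U" using cballU[OF s] r by (auto intro!: interiorI[of "ball (p s) (r/2)"])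
      have 1: "isCont h (p s)" "isCont (\<lambda>z. z $ i) (p s)"
        using cnt int by (auto intro: continuous_on_interior)
      then have "eventually (\<lambda>z. dist (h z) (h (p s)) < \<eta>') (nhds (p s))"
        "eventually (\<lambda>z. dist (z $ i) (p s $ i) < \<eta>') (nhds (p s))"
        using \<eta>' tendsto_at_iff_tendsto_nhds[of h] tendsto_at_iff_tendsto_nhds[of "\<lambda>z. z $ i"]
        by (auto intro!: tendstoD simp: isCont_def)
      then have "eventually (\<lambda>z. \<bar>h z - h (p s)\<bar> \<le> \<eta>' \<and> \<bar>z $ i - p s $ i\<bar> \<le> \<eta>') (nhds (p s))"
        by eventually_elim (simp add: dist_real_def)
      then show ?thesis by (simp add: eventually_nhds_metric)
    qed
    from this[OF s(2)] this[OF s(3)] obtain d1 d2 where d: "d1 > 0" "d2 > 0"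
      "\<And>z. dist z (p s1) < d1 \<Longrightarrow> \<bar>h z - h (p s1)\<bar> \<le> \<eta>' \<and> \<bar>z $ i - p s1 $ i\<bar> \<le> \<eta>'"
      "\<And>z. dist z (p s2) < d2 \<Longrightarrow> \<bar>h z - h (p s2)\<bar> \<le> \<eta>' \<and> \<bar>z $ i - p s2 $ i\<bar> \<le> \<eta>'" by metis
    \<comment> \<open>A cube of half side \<open>\<epsilon>\<close> has distance at most
      \<open>3 * \<epsilon>\<close> from its centre by the l1 bound, hence fits into both continuity
      radii and into \<open>U\<close>.\<close>
    define \<epsilon> where "\<epsilon> = min (min d1 d2) (r / 2) / 4"
    have \<epsilon>: "\<epsilon> > 0" "3 * \<epsilon> < d1" "3 * \<epsilon> < d2" "4 * \<epsilon> \<le> r / 2" using d r by (auto simp: \<epsilon>_def)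
    define Q where "Q s = cbox (\<chi> j. p s $ j - \<epsilon>) (\<chi> j. p s $ j + \<epsilon>)" for s
    have dist3: "dist w z \<le> a + b + c"
      if "\<bar>z $ 1 - w $ 1\<bar> \<le> a" "\<bar>z $ 2 - w $ 2\<bar> \<le> b" "\<bar>z $ 3 - w $ 3\<bar> \<le> c" for w z :: "real^3" and a b c
      using norm_le_l1_cart[of "w - z"] that by (simp add: dist_norm sum_3)
    have Qd: "dist z (p s) \<le> 3 * \<epsilon>" if "z \<in> Q s" for z s
    proof -
      have "\<bar>p s $ j - z $ j\<bar> \<le> \<epsilon>" for j
        using that by (simp add: Q_def mem_box_cart abs_le_iff) (metis add.commute diff_le_eq le_diff_eq)
      from dist3[OF this this this] show ?thesis by simp
    qed
    have QU: "Q s \<subseteq> U" if "\<bar>s\<bar> \<le> r / 4" for s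
      using Qd cballU[OF that] \<epsilon> by (force simp: dist_commute)
    define b where "b s = bump3 B \<epsilon> (p s)" for s
    \<comment> \<open>In direction \<open>i\<close> a difference of two steps, hence a plateau
      between \<open>s1\<close> and \<open>s2\<close>; in the other coordinates plain bumps, which
      is why their index is shifted by one.\<close>
    define F where "F j n t = (if j = i
        then (1 / \<epsilon>) ^ n * B n (1 / \<epsilon> * (t - p s1 $ i)) - (1 / \<epsilon>) ^ n * B n (1 / \<epsilon> * (t - p s2 $ i))
        else (1 / \<epsilon>) ^ Suc n * B (Suc n) (1 / \<epsilon> * (t - z0 $ j)))" for j :: 3 and n t
    have dF: "\<forall>j. derivs (F j)"
    proof
      fix j show "derivs (F j)"
      proof (cases "j = i")
        case True then show ?thesis
          unfolding F_def by (simp only: refl if_True) (intro derivs_diff derivs_affine dB)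
      next
        case False then show ?thesis
          unfolding F_def using derivs_Suc[OF derivs_affine[OF dB]] by (simp only: if_False)
      qed
    qed
    define lo hi :: "real^3" where "lo = (\<chi> j. p s1 $ j - \<epsilon>)" and "hi = (\<chi> j. p s2 $ j + \<epsilon>)"
    have supp: "F j k t = 0" if t: "t < lo $ j \<or> t > hi $ j" for j k t
    proof -
      have "F j k t = 0" if ji: "j = i"
      proof -
        let ?x1 = "1 / \<epsilon> * (t - p s1 $ i)" and ?x2 = "1 / \<epsilon> * (t - p s2 $ i)"
        have le: "?x2 \<le> ?x1" using \<epsilon> s by (simp add: pj divide_right_mono)
        have out: "?x1 \<le> -1 \<or> ?x2 \<ge> 1"
          using t ji \<epsilon> by (auto simp: lo_def hi_def field_simps)
        show ?thesis
        proof (cases k)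
          case 0 then show ?thesis using bump_seq_const[OF B le out] ji by (simp add: F_def)
        next
          case (Suc n)
          have "\<bar>?x1\<bar> \<ge> 1" "\<bar>?x2\<bar> \<ge> 1" using le out by linarith+
          then have "B (Suc n) ?x1 = 0" "B (Suc n) ?x2 = 0" using B unfolding bump_seq_def by blast+
          then show ?thesis using Suc ji by (simp add: F_def)
        qed
      qed
      moreover have "F j k t = 0" if ji: "j \<noteq> i"
      proof -
        have "\<bar>1 / \<epsilon> * (t - z0 $ j)\<bar> \<ge> 1"
          using t ji \<epsilon> by (auto simp: lo_def hi_def pj field_simps abs_if)
        then have "B (Suc k) (1 / \<epsilon> * (t - z0 $ j)) = 0" using B unfolding bump_seq_def by blast
        then show ?thesis using ji by (simp add: F_def)
      qed
      ultimately show ?thesis by blast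
    qed
    have K: "cbox lo hi \<subseteq> cball z0 r"
    proof
      fix z assume z: "z \<in> cbox lo hi"
      have zj: "\<bar>z $ j - z0 $ j\<bar> \<le> (if j = i then r / 4 else 0) + \<epsilon>" for j
        using z s by (auto simp: lo_def hi_def mem_box_cart pj abs_le_iff dest!: spec[of _ j])
      have "dist z0 z \<le> (\<Sum>j\<in>UNIV. (if j = i then r / 4 else 0) + \<epsilon>)"
        using dist3[OF zj zj zj] by (simp add: sum_3)
      also have "\<dots> = r / 4 + 3 * \<epsilon>" by (simp add: sum.distrib)
      also have "\<dots> \<le> r" using \<epsilon> by simp
      finally show "z \<in> cball z0 r" by simp
    qed
    have KU: "cbox lo hi \<subseteq> U" "cbox lo hi \<subseteq> \<Omega>" using K r U by auto
    define \<psi> where "\<psi> = tens F (\<lambda>_. 0)"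
    have \<psi>0: "\<psi> z = 0" if "z \<notin> cbox lo hi" for z
      unfolding \<psi>_def by (rule tens_eq_0_outside[OF supp that])
    have c\<psi>: "continuous_on S \<psi>" for S unfolding \<psi>_def by (rule continuous_on_tens[OF dF])
    have \<psi>pos: "\<psi> z \<ge> 0" for z
      unfolding \<psi>_def tens_def
    proof (intro prod_nonneg)
      fix j
      show "F j 0 (z $ j) \<ge> 0"
        \<comment> \<open>For \<open>j = i\<close> the step centred at \<open>s1 < s2\<close> is
          evaluated further to the right, so monotonicity gives the sign.\<close>
        using \<epsilon> s bump_seq_nonneg[OF B] by (auto simp: F_def pj intro!: bump_seq_mono[OF B] divide_right_mono)
    qed
    have test: "test_fun U \<psi>"
      unfolding \<psi>_def by (rule test_fun_tens[OF dF _ _ KU(1) tens_eq_0_outside[OF supp]]) auto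
    have d\<psi>: "tens F ((\<lambda>_. 0)(i := Suc 0)) z = b s1 z - b s2 z" for z
    proof -
      have 1: "tens F ((\<lambda>_. 0)(i := Suc 0)) z = F i (Suc 0) (z $ i) * (\<Prod>j\<in>UNIV-{i}. F j 0 (z $ j))"
        unfolding tens_def by (subst prod.remove[of UNIV i]) auto
      have 2: "b s z = (1 / \<epsilon> * B (Suc 0) (1 / \<epsilon> * (z $ i - p s $ i))) * (\<Prod>j\<in>UNIV-{i}. F j 0 (z $ j))" for s
        unfolding b_def bump3_def tens_def
        by (subst prod.remove[of UNIV i]) (auto simp: F_def pj intro!: prod.cong)
      show ?thesis unfolding 1 2 by (simp add: F_def left_diff_distrib)
    qed
    have dd\<psi>: "iter_pdiff [i, i] \<psi> = tens F ((\<lambda>_. 0)(i := Suc (Suc 0)))"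
      by (simp add: \<psi>_def pdiff_tens[OF dF])
    have cS: "set_integrable lborel \<Omega> (\<lambda>z. a z * \<psi> z)" if "continuous_on U a" for a
      by (rule set_integrable_compact_support[OF _ KU(2) continuous_on_subset[OF that KU(1)] c\<psi> \<psi>0]) auto
    have iu: "set_integrable lborel \<Omega> (\<lambda>z. u z * iter_pdiff [i, i] \<psi> z)"
      unfolding dd\<psi>
    proof (rule set_integrable_compact_support[OF _ KU(2) _ continuous_on_tens[OF dF] tens_eq_0_outside[OF supp]])
      show "continuous_on (cbox lo hi) u"
        using du KU(2) by (intro continuous_at_imp_continuous_on) (auto intro: differentiable_imp_continuous_within)
    qed auto
    have cu: "continuous_on \<Omega> u"
      using du by (intro continuous_at_imp_continuous_on) (auto intro: differentiable_imp_continuous_within)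
    have "(LINT z:\<Omega>|lborel. A z * \<psi> z) = (LINT z:\<Omega>|lborel. u z * iter_pdiff [i, i] \<psi> z)"
      using weak[OF test] set_borel_integral_eq_integral(2)[OF iu] set_borel_integral_eq_integral(2)[OF cS[OF A]]
      by simp
    also have "\<dots> = (LINT z:\<Omega>|lborel. u z * tens F (((\<lambda>_. 0)(i := Suc 0))(i := Suc (((\<lambda>_. 0)(i := Suc 0)) i))) z)"
      by (simp only: dd\<psi> fun_upd_upd fun_upd_same)
    also have "\<dots> = - (LINT z:\<Omega>|lborel. pdiff i u z * tens F ((\<lambda>_. 0)(i := Suc 0)) z)"
      by (rule tens_integration_by_parts[OF \<Omega> dF supp KU(2) _ _ bu bu' axis_shift_derivative[OF du]])
         (use \<Omega>(1) cu cu' in \<open>auto intro: set_borel_measurable_continuous_open\<close>)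
    finally have I1: "(LINT z:\<Omega>|lborel. A z * \<psi> z) = - (LINT z:\<Omega>|lborel. pdiff i u z * (b s1 z - b s2 z))"
      by (simp add: d\<psi>)
    obtain R where R: "\<And>z. z \<in> \<Omega> \<Longrightarrow> norm z \<le> R" using \<Omega>(2) by (auto simp: bounded_iff)
    \<comment> \<open>The same integration by parts for the coordinate function expresses the mass
      of \<open>\<psi>\<close> through first moments of the two bumps.\<close>
    have "(LINT z:\<Omega>|lborel. z $ i * tens F ((\<lambda>_. 0)(i := Suc ((\<lambda>_. 0) i))) z) = - (LINT z:\<Omega>|lborel. 1 * tens F (\<lambda>_. 0) z)"
    proof (rule tens_integration_by_parts[OF \<Omega> dF supp KU(2)])
      show "\<bar>z $ i\<bar> \<le> R" if "z \<in> \<Omega>" for z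
        using R[OF that] component_le_norm_cart[of z i] by linarith
      show "((\<lambda>t. (z + t *\<^sub>R axis i 1) $ i) has_real_derivative 1) (at 0)" for z :: "real^3"
        by (auto intro!: derivative_eq_intros)
    qed (use \<Omega>(1) in \<open>auto intro!: set_borel_measurable_continuous_open continuous_intros\<close>)
    then have I2: "(LINT z:\<Omega>|lborel. \<psi> z) = - (LINT z:\<Omega>|lborel. z $ i * (b s1 z - b s2 z))"
      by (simp add: d\<psi> \<psi>_def)
    define m where "m = (\<integral>z. bump3 B \<epsilon> 0 z \<partial>lborel)"
    have m0: "m > 0" unfolding m_def by (rule integral_bump3_pos[OF B \<epsilon>(1)])
    have ib: "set_integrable lborel \<Omega> (\<lambda>z. a z * b s z)" if "continuous_on U a" "\<bar>s\<bar> \<le> r / 4" for a s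
      unfolding b_def
      by (rule set_integrable_compact_support[of "Q s"])
         (use QU[OF that(2)] U that in \<open>auto intro: continuous_on_bump3[OF B \<epsilon>(1)] continuous_on_subset
            bump3_eq_0[OF B \<epsilon>(1)] simp: Q_def\<close>)
    have split: "(LINT z:\<Omega>|lborel. a z * (b s1 z - b s2 z))
        = (LINT z:\<Omega>|lborel. a z * b s1 z) - (LINT z:\<Omega>|lborel. a z * b s2 z)" if "continuous_on U a" for a
      using set_integral_diff(2)[OF ib[OF that s(2)] ib[OF that s(3)]] by (simp add: right_diff_distrib)
    have cpd: "continuous_on U (pdiff i u)" by (rule continuous_on_subset[OF cu' U])
    define H X where "H s = (LINT z:\<Omega>|lborel. h z * b s z)" and "X s = (LINT z:\<Omega>|lborel. z $ i * b s z)" for s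
    have Hs: "H s = (LINT z:\<Omega>|lborel. pdiff i u z * b s z) - A z0 * X s" if "\<bar>s\<bar> \<le> r / 4" for s
    proof -
      have "H s = (LINT z:\<Omega>|lborel. pdiff i u z * b s z - A z0 * (z $ i * b s z))"
        by (simp add: H_def h_def left_diff_distrib mult.assoc)
      also have "\<dots> = (LINT z:\<Omega>|lborel. pdiff i u z * b s z) - (LINT z:\<Omega>|lborel. A z0 * (z $ i * b s z))"
        using ib[OF cpd that] ib[OF cnt(2) that] by (intro set_integral_diff) auto
      finally show ?thesis by (simp add: X_def)
    qed
    have "H s2 - H s1 = (LINT z:\<Omega>|lborel. A z * \<psi> z) - A z0 * (LINT z:\<Omega>|lborel. \<psi> z)"
      unfolding Hs[OF s(2)] Hs[OF s(3)] I1 I2 split[OF cpd] split[OF cnt(2)] X_def by (simp add: algebra_simps)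
    also have "\<dots> = (LINT z:\<Omega>|lborel. A z * \<psi> z - A z0 * \<psi> z)"
      using cS[OF A] cS[of "\<lambda>_. 1"] by (subst set_integral_diff) auto
    \<comment> \<open>Since \<open>\<psi>\<close> is nonnegative, the oscillation of
      \<open>A\<close> costs \<open>\<eta>\<close> times its mass \<open>X s2 - X s1\<close>, which
      is close to \<open>(s2 - s1) * m\<close>.\<close>
    also have "\<bar>\<dots>\<bar> \<le> (LINT z:\<Omega>|lborel. \<eta> * \<psi> z)"
      unfolding set_lebesgue_integral_def
    proof (rule integral_abs_bound[THEN order_trans], rule integral_mono)
      show "integrable lborel (\<lambda>z. \<bar>indicator \<Omega> z *\<^sub>R (A z * \<psi> z - A z0 * \<psi> z)\<bar>)"
        using set_integral_diff(1)[OF cS[OF A] cS[of "\<lambda>_. A z0"]] by (auto simp: set_integrable_def)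
      show "integrable lborel (\<lambda>z. indicator \<Omega> z *\<^sub>R (\<eta> * \<psi> z))"
        using cS[of "\<lambda>_. \<eta>"] by (simp add: set_integrable_def)
      show "\<bar>indicator \<Omega> z *\<^sub>R (A z * \<psi> z - A z0 * \<psi> z)\<bar> \<le> indicator \<Omega> z *\<^sub>R (\<eta> * \<psi> z)" for z
      proof (cases "z \<in> cbox lo hi")
        case True
        then have "\<bar>A z - A z0\<bar> * \<psi> z \<le> \<eta> * \<psi> z" using osc K \<psi>pos by (intro mult_right_mono) auto
        then show ?thesis using \<psi>pos[of z] by (auto simp: indicator_def abs_mult simp flip: left_diff_distrib)
      qed (simp add: \<psi>0)
    qed
    also have "(LINT z:\<Omega>|lborel. \<eta> * \<psi> z) = \<eta> * (X s2 - X s1)"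
      by (simp add: I2 split[OF cnt(2)] X_def)
    finally have main: "\<bar>H s2 - H s1\<bar> \<le> \<eta> * (X s2 - X s1)" .
    have mean: "\<bar>H s - h (p s) * m\<bar> \<le> \<eta>' * m" "\<bar>X s - p s $ i * m\<bar> \<le> \<eta>' * m"
      if s: "\<bar>s\<bar> \<le> r / 4" and d: "\<And>z. dist z (p s) \<le> 3 * \<epsilon> \<Longrightarrow> \<bar>h z - h (p s)\<bar> \<le> \<eta>' \<and> \<bar>z $ i - p s $ i\<bar> \<le> \<eta>'" for s
      unfolding H_def X_def b_def m_def
      using QU[OF s] U Qd[of _ s] d
      by (intro bump3_mean[OF B \<epsilon>(1)] continuous_on_subset[OF cnt(1)] continuous_on_subset[OF cnt(2)];
          fastforce simp: Q_def)+
    have m1: "\<bar>H s1 - h (p s1) * m\<bar> \<le> \<eta>' * m" "\<bar>X s1 - p s1 $ i * m\<bar> \<le> \<eta>' * m"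
      using mean[OF s(2)] d(3) \<epsilon> by auto
    have m2: "\<bar>H s2 - h (p s2) * m\<bar> \<le> \<eta>' * m" "\<bar>X s2 - p s2 $ i * m\<bar> \<le> \<eta>' * m"
      using mean[OF s(3)] d(4) \<epsilon> by auto
    have "\<bar>h (p s2) * m - h (p s1) * m\<bar> \<le> 2 * (\<eta>' * m) + \<eta> * (X s2 - X s1)"
      using m1 m2 main by linarith
    also have "X s2 - X s1 \<le> p s2 $ i * m - p s1 $ i * m + 2 * (\<eta>' * m)" using m1 m2 by linarith
    also have "p s2 $ i * m - p s1 $ i * m = (s2 - s1) * m" by (simp add: pj algebra_simps)
    finally have "\<bar>h (p s2) * m - h (p s1) * m\<bar> \<le> (\<eta> * (s2 - s1) + 2 * (1 + \<eta>) * \<eta>') * m"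
      using \<eta>0 by (simp add: algebra_simps mult_left_mono mult_right_mono)
    moreover have "\<bar>h (p s2) - h (p s1)\<bar> * m = \<bar>h (p s2) * m - h (p s1) * m\<bar>"
      using m0 by (simp add: abs_mult flip: left_diff_distrib)
    ultimately have "\<bar>h (p s2) - h (p s1)\<bar> * m \<le> (\<eta> * (s2 - s1) + 2 * (1 + \<eta>) * \<eta>') * m" by simp
    then show ?thesis using m0 by simp
  qed
  have "\<bar>h (p s2) - h (p s1)\<bar> \<le> \<eta> * (s2 - s1)"
  proof (rule field_le_epsilon)
    fix e :: real assume e: "e > 0"
    have "2 * (1 + \<eta>) * (e / (2 * (1 + \<eta>))) = e" using \<eta>0 by simp
    then show "\<bar>h (p s2) - h (p s1)\<bar> \<le> \<eta> * (s2 - s1) + e"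
      using sol[of "e / (2 * (1 + \<eta>))"] e \<eta>0 by simp
  qed
  moreover have "h (p s2) - h (p s1) = pdiff i u (p s2) - pdiff i u (p s1) - A z0 * (s2 - s1)"
    by (simp add: h_def pj algebra_simps)
  ultimately show ?thesis by (simp add: p_def)
qed

text \<open>On a small ball the oscillation of \<open>A\<close> is as small as desired, and the
  increment bound then says that difference quotients at \<open>z0\<close> are close to
  \<open>A z0\<close>. The equation is assumed only on \<open>U\<close>, which may omit the
  degenerate line, while \<open>u\<close> and its first derivative live on
  \<open>\<Omega>\<close>.\<close>

lemma distributional_second_derivative:
  fixes z0 :: "real^3"
  assumes \<Omega>: "open \<Omega>" "bounded \<Omega>" "negligible (frontier \<Omega>)"
    and U: "open U" "U \<subseteq> \<Omega>"
    and du: "\<And>z. z \<in> \<Omega> \<Longrightarrow> u differentiable (at z)"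
    and bu: "\<And>z. z \<in> \<Omega> \<Longrightarrow> \<bar>u z\<bar> \<le> M"
    and cu': "continuous_on \<Omega> (pdiff i u)" and bu': "\<And>z. z \<in> \<Omega> \<Longrightarrow> \<bar>pdiff i u z\<bar> \<le> M'"
    and A: "continuous_on U A"
    and weak: "\<And>\<psi>. test_fun U \<psi> \<Longrightarrow>
      integral \<Omega> (\<lambda>z. u z * iter_pdiff [i, i] \<psi> z) = integral \<Omega> (\<lambda>z. A z * \<psi> z)"
    and z0: "z0 \<in> U"
  shows "((\<lambda>t. pdiff i u (z0 + t *\<^sub>R axis i 1)) has_real_derivative A z0) (at 0)"
  unfolding DERIV_def
proof (rule tendstoI)
  fix e :: real assume e: "e > 0"
  obtain r1 where r1: "r1 > 0" "cball z0 r1 \<subseteq> U" using U(1) z0 open_contains_cball by blast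
  have "isCont A z0" using A U(1) z0 by (simp add: continuous_on_eq_continuous_at)
  then obtain r2 where r2: "r2 > 0" "\<And>z. dist z z0 < r2 \<Longrightarrow> dist (A z) (A z0) < e / 2"
    using e by (metis continuous_at_eps_delta half_gt_zero)
  define r where "r = min r1 (r2 / 2)"
  have r: "r > 0" "cball z0 r \<subseteq> U" using r1 r2 by (auto simp: r_def)
  have osc: "\<bar>A z - A z0\<bar> \<le> e / 2" if "z \<in> cball z0 r" for z
  proof -
    have "dist z z0 < r2" using that r2(1) by (auto simp: r_def dist_commute)
    from r2(2)[OF this] show ?thesis by (simp add: dist_real_def)
  qed
  note inc = distributional_second_derivative_increment[OF \<Omega> U(2) du bu cu' bu' A weak r osc]
  show "eventually (\<lambda>t. dist ((pdiff i u (z0 + (0 + t) *\<^sub>R axis i 1) - pdiff i u (z0 + 0 *\<^sub>R axis i 1)) / t) (A z0) < e) (at 0)"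
    unfolding eventually_at
  proof (intro exI[of _ "r / 4"] conjI ballI impI)
    show "r / 4 > 0" using r by simp
    fix t :: real assume t: "t \<noteq> 0 \<and> dist t 0 < r / 4"
    let ?D = "pdiff i u (z0 + t *\<^sub>R axis i 1) - pdiff i u z0"
    have "\<bar>?D - A z0 * t\<bar> \<le> e / 2 * \<bar>t\<bar>"
    \<comment> \<open>The increment bound orders its two parameters, so \<open>0\<close> is the left
      one or the right one according to the sign of \<open>t\<close>.\<close>
    proof (cases "t > 0")
      case True
      then show ?thesis using inc[of 0 t] t r by simp
    next
      case False
      then have "t < 0" using t by simp
      then show ?thesis using inc[of t 0] t r by (simp add: abs_if split: if_splits)
    qed
    moreover have "?D / t - A z0 = (?D - A z0 * t) / t" using t by (simp add: field_simps)
    ultimately have "\<bar>?D / t - A z0\<bar> \<le> e / 2" using t by (simp add: pos_divide_le_eq)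
    then show "dist ((pdiff i u (z0 + (0 + t) *\<^sub>R axis i 1) - pdiff i u (z0 + 0 *\<^sub>R axis i 1)) / t) (A z0) < e"
      using e by (simp add: dist_real_def)
  qed
qed

section \<open>Lipschitz zero extension, Taylor bound and scaling\<close>

text \<open>The domain is not convex, so a segment may leave it. It does so through a frontier point
  where \<open>u\<close> vanishes, so the value at the start is bounded by \<open>L\<close> times
  the distance travelled.\<close>

lemma zero_extension_lipschitz:
  fixes u :: "real^3 \<Rightarrow> real"
  assumes op: "open \<Omega>" and cu: "continuous_on (closure \<Omega>) u"
    and du: "\<And>z. z \<in> \<Omega> \<Longrightarrow> u differentiable (at z)"
    and L: "\<And>z. z \<in> \<Omega> \<Longrightarrow> norm (grad3 u z) \<le> L" and L0: "L \<ge> 0"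
    and fr: "\<And>z. z \<in> frontier \<Omega> \<Longrightarrow> u z = 0"
  defines "v \<equiv> \<lambda>z. if z \<in> \<Omega> then u z else 0"
  shows "\<bar>v x - v y\<bar> \<le> L * norm (x - y)"
proof -
  have exit: "\<bar>u z\<bar> \<le> L * norm (z - y)" if z: "z \<in> \<Omega>" and y: "y \<notin> \<Omega>" for z y
  proof -
    define p where "p t = z + t *\<^sub>R (y - z)" for t
    have cp: "continuous_on S p" for S unfolding p_def by (intro continuous_intros)
    obtain t0 where t0: "0 < t0" "t0 \<le> 1" "p t0 \<in> frontier \<Omega>" "\<And>t. 0 \<le> t \<Longrightarrow> t < t0 \<Longrightarrow> p t \<in> \<Omega>"
      using first_exit[where \<Omega>=\<Omega> and s=1 and \<gamma>=p, OF op cp] z y by (auto simp: p_def)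
    have D: "((\<lambda>t. u (p t)) has_real_derivative (grad3 u (p t) \<bullet> (y - z))) (at t)" if "0 \<le> t" "t < t0" for t
    proof (rule curve_derivative)
      show "u differentiable (at (p t))" using du t0(4) that by blast
      show "(p has_vector_derivative (y - z)) (at t)" unfolding p_def by (auto intro!: derivative_eq_intros)
    qed
    have "p t \<in> closure \<Omega>" if "t \<in> {0..t0}" for t
      using t0(3) t0(4)[of t] that closure_subset[of \<Omega>] by (cases "t = t0") (auto simp: frontier_def)
    then have "continuous_on {0..t0} (\<lambda>t. u (p t))"
      by (intro continuous_on_compose2[OF cu cp]) auto
    \<comment> \<open>The mean value theorem uses derivatives only before the exit time; the exit
      point itself is covered by continuity on the closure.\<close>
    then obtain l t where t: "0 < t" "t < t0" "((\<lambda>t. u (p t)) has_real_derivative l) (at t)"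
        "u (p t0) - u (p 0) = (t0 - 0) * l"
      using MVT[OF t0(1), of "\<lambda>t. u (p t)"] D by (metis less_imp_le real_differentiable_def)
    have "l = grad3 u (p t) \<bullet> (y - z)" using D[of t] t DERIV_unique by force
    then have "\<bar>l\<bar> \<le> norm (grad3 u (p t)) * norm (y - z)" using Cauchy_Schwarz_ineq2 by simp
    also have "\<dots> \<le> L * norm (y - z)" using L t0(4)[of t] t by (intro mult_right_mono) auto
    finally have l: "\<bar>l\<bar> \<le> L * norm (y - z)" .
    have "u z = - t0 * l" using t(4) fr[OF t0(3)] by (simp add: p_def)
    then have "\<bar>u z\<bar> = t0 * \<bar>l\<bar>" using t0(1) by (simp add: abs_mult)
    also have "\<dots> \<le> 1 * \<bar>l\<bar>" using t0 by (intro mult_right_mono) auto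
    finally show ?thesis using l by (simp add: norm_minus_commute)
  qed
  consider "x \<notin> \<Omega>" "y \<notin> \<Omega>" | "x \<in> \<Omega>" "y \<notin> \<Omega>" | "x \<notin> \<Omega>" "y \<in> \<Omega>"
    | "closed_segment x y \<subseteq> \<Omega>" | "x \<in> \<Omega>" "y \<in> \<Omega>" "\<not> closed_segment x y \<subseteq> \<Omega>" by blast
  then show ?thesis
  proof cases
    case 1 then show ?thesis using L0 by (simp add: v_def)
  next
    case 2 then show ?thesis using exit[of x y] by (simp add: v_def)
  next
    case 3 then show ?thesis using exit[of y x] by (simp add: v_def norm_minus_commute)
  next
    case 4
    have "norm (u x - u y) \<le> L * norm (x - y)"
    proof (rule differentiable_bound[of "closed_segment x y" u "\<lambda>z k. grad3 u z \<bullet> k"])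
      fix z assume z: "z \<in> closed_segment x y"
      show "(u has_derivative (\<lambda>k. grad3 u z \<bullet> k)) (at z within closed_segment x y)"
        using has_derivative_grad3[OF du] z 4 by (blast intro: has_derivative_at_withinI)
      show "onorm (\<lambda>k. grad3 u z \<bullet> k) \<le> L"
      proof (rule onorm_bound)
        show "norm (grad3 u z \<bullet> k) \<le> L * norm k" for k
          using Cauchy_Schwarz_ineq2[of "grad3 u z" k] L[of z] z 4
            mult_right_mono[of "norm (grad3 u z)" L "norm k"] by force
      qed (rule L0)
    qed auto
    moreover have "x \<in> \<Omega>" "y \<in> \<Omega>" using 4 by auto
    ultimately show ?thesis by (simp add: v_def)
  next
    case 5
    then obtain q where q: "q \<in> closed_segment x y" "q \<notin> \<Omega>" by blast
    have "\<bar>u x - u y\<bar> \<le> \<bar>u x\<bar> + \<bar>u y\<bar>" by simp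
    also have "\<dots> \<le> L * norm (x - q) + L * norm (y - q)" using exit 5 q by (intro add_mono) auto
    \<comment> \<open>\<open>q\<close> lies on the segment, so the two distances add up and the
      constant does not grow.\<close>
    also have "\<dots> = L * norm (x - y)"
      using q(1) by (auto simp: between_mem_segment[symmetric] between dist_norm norm_minus_commute
          distrib_left[symmetric])
    finally show ?thesis using 5 by (simp add: v_def)
  qed
qed

text \<open>Away from 0 this is the power rule on each sign; at 0 the difference quotient is |h|^r,
  which tends to 0 because \<open>r > 0\<close>.\<close>

lemma abs_powr_mult_has_derivative:
  fixes x r :: real
  assumes "r > 0"
  shows "((\<lambda>x. \<bar>x\<bar> powr r * x) has_real_derivative (r + 1) * \<bar>x\<bar> powr r) (at x)"
proof -
  consider "x > 0" | "x < 0" | "x = 0" by linarith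
  then show ?thesis
  proof cases
    case 1
    have "((\<lambda>x. x powr (r + 1)) has_real_derivative (r + 1) * x powr r) (at x)"
      using has_real_derivative_powr[OF 1, of "r + 1"] by simp
    moreover have "eventually (\<lambda>y. y powr (r + 1) = \<bar>y\<bar> powr r * y) (nhds x)"
      using eventually_nhds_in_open[of "{0<..}" x] 1
      by (auto elim!: eventually_mono simp: powr_add)
    ultimately show ?thesis using 1 by (subst (asm) DERIV_cong_ev[OF refl _ refl]) auto
  next
    case 2
    have "((\<lambda>x. - ((- x) powr (r + 1))) has_real_derivative (r + 1) * (- x) powr r) (at x)"
      using DERIV_minus[OF DERIV_chain2[OF has_real_derivative_powr[of "- x" "r + 1"] DERIV_minus[OF DERIV_ident]]] 2
      by simp
    moreover have "eventually (\<lambda>y. - ((- y) powr (r + 1)) = \<bar>y\<bar> powr r * y) (nhds x)"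
      using eventually_nhds_in_open[of "{..<0}" x] 2
      by (auto elim!: eventually_mono simp: powr_add)
    ultimately show ?thesis using 2 by (subst (asm) DERIV_cong_ev[OF refl _ refl]) auto
  next
    case 3
    have "((\<lambda>h. \<bar>h\<bar> powr r) \<longlongrightarrow> \<bar>0\<bar> powr r) (at 0)"
      using assms by (intro tendsto_powr' tendsto_intros) auto
    moreover have "eventually (\<lambda>h. \<bar>h\<bar> powr r = \<bar>h\<bar> powr r * h / h) (at (0::real))"
      by (auto simp: eventually_at_filter)
    ultimately have "((\<lambda>h. \<bar>h\<bar> powr r * h / h) \<longlongrightarrow> 0) (at 0)"
      using assms by (auto intro: Lim_transform_eventually)
    then show ?thesis using 3 by (simp add: DERIV_def)
  qed
qed

lemma abs_powr_mult_self:
  fixes x q :: real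
  shows "\<bar>x\<bar> powr (q - 2) * x * x = \<bar>x\<bar> powr q"
proof (cases "x = 0")
  case False
  have "\<bar>x\<bar> powr q = \<bar>x\<bar> powr (q - 2) * \<bar>x\<bar> powr 2"
    by (subst powr_add[symmetric]) simp
  also have "\<bar>x\<bar> powr 2 = x * x" using False by (simp add: powr_numeral power2_eq_square abs_mult_self_eq)
  finally show ?thesis by simp
qed simp

text \<open>The product rule for |x|^q written as (|x|^(q-2) x) times x, which avoids another case
  split at 0.\<close>

lemma abs_powr_has_derivative:
  fixes x q :: real
  assumes "q > 2"
  shows "((\<lambda>x. \<bar>x\<bar> powr q) has_real_derivative q * (\<bar>x\<bar> powr (q - 2) * x)) (at x)"
proof -
  note eq = abs_powr_mult_self[of _ q, symmetric]
  have "((\<lambda>x. (\<bar>x\<bar> powr (q - 2) * x) * x) has_real_derivative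
      (q - 2 + 1) * \<bar>x\<bar> powr (q - 2) * x + 1 * (\<bar>x\<bar> powr (q - 2) * x)) (at x)"
    using assms by (intro DERIV_mult abs_powr_mult_has_derivative DERIV_ident) simp
  then show ?thesis by (simp add: eq[abs_def] algebra_simps)
qed

text \<open>Only the first derivative and its Lipschitz constant on [-M, M] are used, so the
  remainder lacks the factor 1/2; its order in \<open>b - a\<close> is all that matters for the
  limit.\<close>

lemma abs_powr_taylor:
  fixes a b q M :: real
  assumes q: "q > 2" and ab: "\<bar>a\<bar> \<le> M" "\<bar>b\<bar> \<le> M"
  shows "\<bar>b\<bar> powr q \<le> \<bar>a\<bar> powr q + q * (\<bar>a\<bar> powr (q - 2) * a) * (b - a)
    + q * (q - 1) * M powr (q - 2) * (b - a)\<^sup>2"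
proof -
  define f where "f x = \<bar>x\<bar> powr (q - 2) * x" for x :: real
  define K where "K = (q - 1) * M powr (q - 2)"
  have K0: "K \<ge> 0" using q by (simp add: K_def)
  have fL: "\<bar>f x - f y\<bar> \<le> K * \<bar>x - y\<bar>" if "x \<in> {-M..M}" "y \<in> {-M..M}" for x y
  proof -
    have "norm (f x - f y) \<le> K * norm (x - y)"
    proof (rule field_differentiable_bound[of "{-M..M}" f "\<lambda>x. (q - 2 + 1) * \<bar>x\<bar> powr (q - 2)"])
      fix z assume z: "z \<in> {-M..M}"
      show "(f has_field_derivative (q - 2 + 1) * \<bar>z\<bar> powr (q - 2)) (at z within {-M..M})"
        unfolding f_def[abs_def] using abs_powr_mult_has_derivative[of "q - 2" z] q
        by (simp add: has_field_derivative_at_within)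
      show "norm ((q - 2 + 1) * \<bar>z\<bar> powr (q - 2)) \<le> K"
        using z q by (auto simp: K_def abs_mult abs_le_iff intro!: mult_left_mono powr_mono2)
    qed (use that in auto)
    then show ?thesis by simp
  qed
  \<comment> \<open>Subtracting the linear part at \<open>a\<close> leaves a function whose
    derivative on the segment is at most \<open>q * K * \<bar>b - a\<bar>\<close>.\<close>
  define g where "g x = \<bar>x\<bar> powr q - q * f a * x" for x :: real
  have gD: "(g has_real_derivative q * (f x - f a)) (at x)" for x
    using DERIV_diff[OF abs_powr_has_derivative[OF q, of x] DERIV_cmult_Id[of "q * f a" x UNIV]]
    by (simp add: g_def[abs_def] f_def algebra_simps)
  have "norm (g b - g a) \<le> (q * K * \<bar>b - a\<bar>) * norm (b - a)"
  proof (rule field_differentiable_bound[of "closed_segment a b" g "\<lambda>x. q * (f x - f a)"])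
    fix z assume z: "z \<in> closed_segment a b"
    then have z': "\<bar>z - a\<bar> \<le> \<bar>b - a\<bar>" "z \<in> {-M..M}"
      using ab by (auto simp: closed_segment_eq_real_ivl split: if_splits)
    show "(g has_field_derivative q * (f z - f a)) (at z within closed_segment a b)"
      using gD by (rule has_field_derivative_at_within)
    have "\<bar>f z - f a\<bar> \<le> K * \<bar>z - a\<bar>" using fL[OF z'(2), of a] ab by (auto simp: abs_le_iff)
    also have "\<dots> \<le> K * \<bar>b - a\<bar>" by (rule mult_left_mono[OF z'(1) K0])
    finally show "norm (q * (f z - f a)) \<le> q * K * \<bar>b - a\<bar>" using q by (simp add: abs_mult)
  qed auto
  moreover have "(q * K * \<bar>b - a\<bar>) * norm (b - a) = q * K * (b - a)\<^sup>2"
    by (simp only: real_norm_def mult.assoc abs_mult_self_eq power2_eq_square)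
  ultimately have "\<bar>g b - g a\<bar> \<le> q * K * (b - a)\<^sup>2" by (simp only: real_norm_def)
  then have "g b - g a \<le> q * K * (b - a)\<^sup>2" by linarith
  moreover have "g b - g a = \<bar>b\<bar> powr q - \<bar>a\<bar> powr q - q * f a * (b - a)"
    by (simp add: g_def algebra_simps)
  ultimately have "\<bar>b\<bar> powr q \<le> \<bar>a\<bar> powr q + q * f a * (b - a) + q * K * (b - a)\<^sup>2" by linarith
  then show ?thesis by (simp only: f_def K_def mult.assoc)
qed

section \<open>Change of variables and displacement for the dilations\<close>

lemma dil_eq_affine:
  "dil \<alpha> s z = 0 + (\<Sum>b\<in>Basis. ((dil \<alpha> s b \<bullet> b) * (z \<bullet> b)) *\<^sub>R b)"
proof (rule euclidean_eqI)
  fix b :: "real^3" assume b: "b \<in> Basis"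
  then obtain i where bi: "b = axis i 1" by (auto simp: Basis_vec_def)
  show "dil \<alpha> s z \<bullet> b = (0 + (\<Sum>b\<in>Basis. ((dil \<alpha> s b \<bullet> b) * (z \<bullet> b)) *\<^sub>R b)) \<bullet> b"
    using b by (simp add: inner_sum_left_Basis) (simp add: bi inner_axis)
qed

text \<open>The Jacobian exponent 3 + \<alpha> is the sum of the weights 1, 1, 1 + \<alpha>.\<close>

lemma integral_dil:
  fixes f :: "real^3 \<Rightarrow> real"
  assumes [measurable]: "f \<in> borel_measurable borel"
  shows "(\<integral>z. f (dil \<alpha> (- s) z) \<partial>lborel) = exp (- (3 + \<alpha>) * s) * (\<integral>z. f z \<partial>lborel)"
proof -
  define c where "c b = dil \<alpha> (- s) b \<bullet> b" for b
  have cax: "c (axis i 1) = exp (weight \<alpha> i * s)" for i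
    by (simp add: c_def inner_axis)
  have c0: "c b > 0" if "b \<in> Basis" for b
    using that cax by (auto simp: Basis_vec_def)
  have Bs: "(Basis :: (real^3) set) = (\<lambda>i. axis i 1) ` UNIV" by (auto simp: Basis_vec_def)
  have "(\<Prod>b\<in>Basis. \<bar>c b\<bar>) = (\<Prod>i\<in>UNIV. \<bar>c (axis i 1)\<bar>)"
    unfolding Bs by (subst prod.reindex) (auto simp: inj_on_def axis_eq_axis)
  also have "\<dots> = exp (\<Sum>i\<in>UNIV. weight \<alpha> i * s)" by (simp add: cax exp_sum)
  also have "(\<Sum>i\<in>UNIV. weight \<alpha> i * s) = (3 + \<alpha>) * s"
    by (simp add: sum_3 weight_def algebra_simps)
  finally have pr: "(\<Prod>b\<in>Basis. \<bar>c b\<bar>) = exp ((3 + \<alpha>) * s)" .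
  have T: "dil \<alpha> (- s) = (\<lambda>z. 0 + (\<Sum>b\<in>Basis. (c b * (z \<bullet> b)) *\<^sub>R b))"
    unfolding c_def by (rule ext, rule dil_eq_affine)
  have [measurable]: "dil \<alpha> (- s) \<in> borel_measurable borel"
    by (intro borel_measurable_continuous_onI continuous_on_dil)
  have lb: "lborel = density (distr lborel borel (dil \<alpha> (- s))) (\<lambda>_. ennreal (exp ((3 + \<alpha>) * s)))"
    using lborel_affine_euclidean[of c 0] c0 by (simp add: T pr less_imp_neq[symmetric])
  have "(\<integral>z. f z \<partial>lborel) = exp ((3 + \<alpha>) * s) * (\<integral>z. f (dil \<alpha> (- s) z) \<partial>lborel)"
    by (subst lb, subst integral_density) (auto simp: integral_distr)
  moreover have "exp (- (3 + \<alpha>) * s) * exp ((3 + \<alpha>) * s) = 1"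
    by (subst exp_add[symmetric]) (simp add: algebra_simps)
  ultimately show ?thesis by (simp only: mult.assoc[symmetric] mult_1_left)
qed

text \<open>First order in \<open>s\<close>, so together with the Lipschitz bound the squared
  difference of \<open>u\<close> and its dilate is of order s^2. The factor 3 comes from summing
  components.\<close>

lemma dil_displacement:
  assumes "\<alpha> \<ge> 0" "0 \<le> s" "s \<le> 1"
  shows "norm (dil \<alpha> (- s) z - z) \<le> 3 * (1 + \<alpha>) * exp (1 + \<alpha>) * norm z * s"
proof -
  have comp: "\<bar>(dil \<alpha> (- s) z - z) $ i\<bar> \<le> (1 + \<alpha>) * exp (1 + \<alpha>) * norm z * s" for i
  proof -
    have w: "0 \<le> weight \<alpha> i" "weight \<alpha> i \<le> 1 + \<alpha>" using assms by (auto simp: weight_def)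
    define x where "x = weight \<alpha> i * s"
    have x: "0 \<le> x" "x \<le> (1 + \<alpha>) * s" "x \<le> 1 + \<alpha>"
      using w assms mult_mono[of "weight \<alpha> i" "1 + \<alpha>" s 1] by (auto simp: x_def mult_right_mono)
    \<comment> \<open>From exp(-x) >= 1 - x, rearranged into exp x - 1 <= x exp x.\<close>
    have "exp x * (1 - x) \<le> exp x * exp (- x)"
      using exp_ge_add_one_self[of "- x"] by (intro mult_left_mono) auto
    then have "exp x - 1 \<le> x * exp x" by (simp add: exp_minus algebra_simps)
    also have "\<dots> \<le> ((1 + \<alpha>) * s) * exp (1 + \<alpha>)" using x by (intro mult_mono) auto
    finally have e: "exp x - 1 \<le> (1 + \<alpha>) * s * exp (1 + \<alpha>)" .
    have "(dil \<alpha> (- s) z - z) $ i = (exp x - 1) * z $ i"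
      by (simp add: x_def algebra_simps)
    then have "\<bar>(dil \<alpha> (- s) z - z) $ i\<bar> = (exp x - 1) * \<bar>z $ i\<bar>"
      using x by (simp add: abs_mult)
    also have "\<dots> \<le> ((1 + \<alpha>) * s * exp (1 + \<alpha>)) * norm z"
      using e x component_le_norm_cart[of z i] assms by (intro mult_mono) auto
    finally show ?thesis by (simp add: mult_ac)
  qed
  have "norm (dil \<alpha> (- s) z - z) \<le> (\<Sum>i\<in>UNIV. \<bar>(dil \<alpha> (- s) z - z) $ i\<bar>)"
    by (rule norm_le_l1_cart)
  also have "\<dots> \<le> (\<Sum>i\<in>(UNIV::3 set). (1 + \<alpha>) * exp (1 + \<alpha>) * norm z * s)"
    by (intro sum_mono comp)
  finally show ?thesis by (simp add: algebra_simps)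
qed

text \<open>Both sides vanish at \<open>s = 0\<close>, so dividing by \<open>s\<close> compares
  their right derivatives there; the quadratic error disappears and the negative signs reverse the
  inequality.\<close>

lemma scaling_limit:
  fixes I K :: real
  assumes ineq: "\<And>s. 0 < s \<Longrightarrow> s \<le> 1 \<Longrightarrow> (exp (- a * s) - 1) * I - K * s\<^sup>2 \<le> c * (exp (- b * s) - 1) * I"
  shows "c * b * I \<le> a * I"
proof -
  have D: "((\<lambda>s. (exp (- k * s) - 1) / s) \<longlongrightarrow> - k) (at_right 0)" for k :: real
  proof -
    have "((\<lambda>s. exp (- k * s)) has_real_derivative - k) (at 0)"
      by (auto intro!: derivative_eq_intros)
    then show ?thesis by (simp add: DERIV_def filterlim_at_split)
  qed
  have "- a * I - K * 0 \<le> c * - b * I"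
  proof (rule tendsto_le[OF trivial_limit_at_right_real])
    show "((\<lambda>s. (exp (- a * s) - 1) / s * I - K * s) \<longlongrightarrow> - a * I - K * 0) (at_right 0)"
      by (intro tendsto_intros D)
    show "((\<lambda>s. c * ((exp (- b * s) - 1) / s) * I) \<longlongrightarrow> c * - b * I) (at_right 0)"
      by (intro tendsto_intros D)
    have "eventually (\<lambda>s::real. 0 < s \<and> s < 1) (at_right 0)"
      unfolding eventually_at_right_field by (intro exI[of _ 1]) auto
    then show "eventually (\<lambda>s. (exp (- a * s) - 1) / s * I - K * s \<le> c * ((exp (- b * s) - 1) / s) * I) (at_right 0)"
    proof eventually_elim
      case (elim s)
      then have "((exp (- a * s) - 1) * I - K * s\<^sup>2) / s \<le> c * (exp (- b * s) - 1) * I / s"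
        using ineq[of s] by (intro divide_right_mono) auto
      moreover have "((exp (- a * s) - 1) * I - K * s\<^sup>2) / s = (exp (- a * s) - 1) / s * I - K * s"
        "c * (exp (- b * s) - 1) * I / s = c * ((exp (- b * s) - 1) / s) * I"
        using elim by (simp_all add: field_simps power2_eq_square)
      ultimately show ?case by simp
    qed
  qed
  then show ?thesis by simp
qed

section \<open>The Pohozaev inequality\<close>

text \<open>Fixes one solution together with the witnesses \<open>A\<close>, \<open>B\<close>,
  \<open>C\<close> hidden in the existential of \<open>S2_solution\<close>.\<close>

locale pohozaev =
  fixes \<alpha> p :: real and \<Omega> :: "(real^3) set" and u A B C :: "real^3 \<Rightarrow> real"
  assumes \<alpha>: "\<alpha> > 0" and p: "p > 5"
    and sbd: "smooth_bounded_domain \<Omega>" and star: "G_star_shaped \<alpha> \<Omega>"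
    and C10: "C1_0_closure \<Omega> u"
    and cA: "continuous_on (closure \<Omega>) A" and cB: "continuous_on (closure \<Omega>) B"
    and cC: "continuous_on (closure \<Omega>) C"
    and weakA: "\<And>\<psi>. test_fun \<Omega> \<psi> \<Longrightarrow>
      integral \<Omega> (\<lambda>z. u z * iter_pdiff [1, 1] \<psi> z) = integral \<Omega> (\<lambda>z. A z * \<psi> z)"
    and weakB: "\<And>\<psi>. test_fun \<Omega> \<psi> \<Longrightarrow>
      integral \<Omega> (\<lambda>z. u z * iter_pdiff [2, 2] \<psi> z) = integral \<Omega> (\<lambda>z. B z * \<psi> z)"
    and weakC: "\<And>\<psi>. test_fun (\<Omega> - {z. z $ 1 = 0 \<and> z $ 2 = 0}) \<psi> \<Longrightarrow>
      integral \<Omega> (\<lambda>z. u z * iter_pdiff [3, 3] \<psi> z)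
      = integral \<Omega> (\<lambda>z. C z / (xnorm z powr (2 * \<alpha>)) * \<psi> z)"
    and pde: "\<And>z. z \<in> \<Omega> \<Longrightarrow>
      - A z - B z - C z = xnorm z powr (2 * \<alpha>) * (\<bar>u z\<bar> powr (p - 1) * u z)"
begin

definition coef :: "3 \<Rightarrow> real^3 \<Rightarrow> real" where
  "coef i z = (if i = 3 then xnorm z powr (2 * \<alpha>) else 1)"

definition U0 :: "real^3 \<Rightarrow> real" where
  "U0 z = (if z \<in> \<Omega> then u z else 0)"

definition P0 :: "3 \<Rightarrow> real^3 \<Rightarrow> real" where
  "P0 i z = (if z \<in> \<Omega> then pdiff i u z else 0)"

text \<open>\<open>dil \<alpha> (- s)\<close> expands for positive \<open>s\<close>, so composing
  with it shrinks the support.\<close>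

definition U :: "real \<Rightarrow> real^3 \<Rightarrow> real" where
  "U s z = U0 (dil \<alpha> (- s) z)"

text \<open>The derivative of \<open>U s\<close> along axis \<open>i\<close> by the chain rule,
  valid almost everywhere; the value 0 of \<open>P0\<close> off \<open>\<Omega>\<close> fills the
  null set where there may be none.\<close>

definition P :: "real \<Rightarrow> 3 \<Rightarrow> real^3 \<Rightarrow> real" where
  "P s i z = exp (weight \<alpha> i * s) * P0 i (dil \<alpha> (- s) z)"

definition bdd :: "(real^3 \<Rightarrow> real) \<Rightarrow> bool" where
  "bdd f \<longleftrightarrow> (\<exists>M. \<forall>z\<in>\<Omega>. \<bar>f z\<bar> \<le> M)"

section \<open>Regularity, measurability and bounds of the data\<close>

lemma domain_open: "open \<Omega>" and domain_bounded: "bounded \<Omega>" and frontier_negligible: "negligible (frontier \<Omega>)"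
  using sbd negligible_frontier_smooth by (auto simp: smooth_bounded_domain_def)

lemma u_continuous: "continuous_on (closure \<Omega>) u"
  and u_differentiable: "\<And>z. z \<in> \<Omega> \<Longrightarrow> u differentiable (at z)"
  and u_frontier: "\<And>z. z \<in> frontier \<Omega> \<Longrightarrow> u z = 0"
  using C10 by (auto simp: C1_0_closure_def)

lemma bddI: "(\<And>z. z \<in> \<Omega> \<Longrightarrow> \<bar>f z\<bar> \<le> M) \<Longrightarrow> bdd f"
  by (auto simp: bdd_def)

lemma bdd_mult: "bdd f \<Longrightarrow> bdd g \<Longrightarrow> bdd (\<lambda>z. f z * g z)"
  unfolding bdd_def
proof (elim exE)
  fix M N assume "\<forall>z\<in>\<Omega>. \<bar>f z\<bar> \<le> M" "\<forall>z\<in>\<Omega>. \<bar>g z\<bar> \<le> N"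
  then have "\<bar>f z * g z\<bar> \<le> M * N" if "z \<in> \<Omega>" for z
    using that unfolding abs_mult by (intro mult_mono) (auto intro: order_trans[OF abs_ge_zero])
  then show "\<exists>K. \<forall>z\<in>\<Omega>. \<bar>f z * g z\<bar> \<le> K" by blast
qed

lemma bdd_closure: "continuous_on (closure \<Omega>) f \<Longrightarrow> bdd f"
proof -
  assume f: "continuous_on (closure \<Omega>) f"
  have "compact (closure \<Omega>)" using domain_bounded by (simp add: compact_closure)
  then have "bounded (f ` closure \<Omega>)" using f by (intro compact_imp_bounded compact_continuous_image)
  then obtain M where "\<And>z. z \<in> closure \<Omega> \<Longrightarrow> \<bar>f z\<bar> \<le> M"
    unfolding bounded_iff real_norm_def by blast
  then show "bdd f" using closure_subset by (intro bddI) blast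
qed

lemma set_integrable_bdd:
  assumes "set_borel_measurable borel \<Omega> f" "bdd f"
  shows "set_integrable lborel \<Omega> f"
  using assms(2) set_integrable_bounded_open[OF domain_open domain_bounded assms(1)] by (auto simp: bdd_def)

lemma set_borel_measurableI: "f \<in> borel_measurable borel \<Longrightarrow> set_borel_measurable borel \<Omega> f"
  for f :: "real^3 \<Rightarrow> real"
  unfolding set_borel_measurable_def using domain_open by (intro borel_measurable_scaleR borel_measurable_indicator) auto

lemma pdiff_cont: "continuous_on \<Omega> (pdiff i u)" and pdiff_bdd: "bdd (pdiff i u)"
proof -
  obtain g where g: "continuous_on (closure \<Omega>) g" "\<forall>z\<in>\<Omega>. pdiff i u z = g z"
    using C10 unfolding C1_0_closure_def by blast
  show "continuous_on \<Omega> (pdiff i u)"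
    using continuous_on_subset[OF g(1) closure_subset] g(2) continuous_on_cong[of \<Omega> \<Omega> "pdiff i u" g] by simp
  show "bdd (pdiff i u)" using bdd_closure[OF g(1)] g(2) by (simp add: bdd_def)
qed

lemma P0_measurable [measurable]: "P0 i \<in> borel_measurable borel"
proof -
  have "(\<lambda>z. indicator \<Omega> z *\<^sub>R pdiff i u z) \<in> borel_measurable borel"
    using set_borel_measurable_continuous_open[OF domain_open pdiff_cont] by (simp add: set_borel_measurable_def)
  moreover have "(\<lambda>z. indicator \<Omega> z *\<^sub>R pdiff i u z) = P0 i" by (auto simp: P0_def indicator_def)
  ultimately show ?thesis by simp
qed

lemma U0_lipschitz: obtains L where "L \<ge> 0" "\<And>x y. \<bar>U0 x - U0 y\<bar> \<le> L * norm (x - y)"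
proof -
  have "\<forall>i. \<exists>M. \<forall>z\<in>\<Omega>. \<bar>pdiff i u z\<bar> \<le> M" using pdiff_bdd by (auto simp: bdd_def)
  then obtain M where M: "\<And>i z. z \<in> \<Omega> \<Longrightarrow> \<bar>pdiff i u z\<bar> \<le> M i" by metis
  define L where "L = (\<Sum>i\<in>UNIV. M i)"
  have L: "norm (grad3 u z) \<le> L" if "z \<in> \<Omega>" for z
    unfolding L_def using norm_le_l1_cart[of "grad3 u z"] M[OF that]
    by (intro order_trans[OF norm_le_l1_cart sum_mono]) (simp add: grad3_def)
  have "0 \<in> \<Omega>" using star by (simp add: G_star_shaped_def)
  then have L0: "L \<ge> 0" using L order_trans[OF norm_ge_zero] by blast
  show ?thesis
    using that[OF L0] zero_extension_lipschitz[OF domain_open u_continuous u_differentiable L L0 u_frontier] unfolding U0_def by blast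
qed

lemma U0_cont: "continuous_on S U0"
proof -
  obtain L where L: "L \<ge> 0" "\<And>x y. \<bar>U0 x - U0 y\<bar> \<le> L * norm (x - y)" using U0_lipschitz by blast
  have "L-lipschitz_on S U0" using L by (intro lipschitz_onI) (auto simp: dist_norm)
  then show ?thesis by (rule lipschitz_on_continuous_on)
qed

lemma measurable_parts [measurable]:
  "U0 \<in> borel_measurable borel" "U s \<in> borel_measurable borel" "P s i \<in> borel_measurable borel"
  "dil \<alpha> s \<in> borel_measurable borel" "xnorm \<in> borel_measurable borel" "coef i \<in> borel_measurable borel"
proof -
  show d [measurable]: "dil \<alpha> s \<in> borel_measurable borel" for s
    by (intro borel_measurable_continuous_onI continuous_on_dil)
  show u [measurable]: "U0 \<in> borel_measurable borel"
    by (intro borel_measurable_continuous_onI U0_cont)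
  show "U s \<in> borel_measurable borel" unfolding U_def by measurable
  show "P s i \<in> borel_measurable borel" unfolding P_def by measurable
  show x [measurable]: "xnorm \<in> borel_measurable borel"
    unfolding xnorm_def by (intro borel_measurable_continuous_onI continuous_intros)
  show "coef i \<in> borel_measurable borel" unfolding coef_def by (cases "i = 3") simp_all
qed

lemma coef_cont: "continuous_on S (coef i)"
proof (cases "i = 3")
  case True
  have "continuous_on S xnorm" unfolding xnorm_def by (intro continuous_intros)
  then have "continuous_on S (\<lambda>z. xnorm z powr (2 * \<alpha>))"
    by (rule continuous_on_powr') (use \<alpha> in \<open>auto simp: xnorm_def\<close>)
  then show ?thesis using True by (simp add: coef_def[abs_def])
qed (simp add: coef_def)

lemma coef_nonneg: "coef i z \<ge> 0"
  by (simp add: coef_def)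

lemma coef_bdd: "bdd (coef i)"
  by (rule bdd_closure[OF coef_cont])

lemma U0_bdd_all: obtains M where "\<And>z. \<bar>U0 z\<bar> \<le> M"
proof -
  obtain M where M: "\<forall>z\<in>\<Omega>. \<bar>u z\<bar> \<le> M" using bdd_closure[OF u_continuous] by (auto simp: bdd_def)
  show ?thesis by (rule that[of "max M 0"]) (use M in \<open>auto simp: U0_def max_def intro: order_trans\<close>)
qed

lemma P0_bdd_all: obtains M where "\<And>z. \<bar>P0 i z\<bar> \<le> M"
proof -
  obtain M where M: "\<forall>z\<in>\<Omega>. \<bar>pdiff i u z\<bar> \<le> M" using pdiff_bdd by (auto simp: bdd_def)
  show ?thesis by (rule that[of "max M 0"]) (use M in \<open>auto simp: P0_def max_def intro: order_trans\<close>)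
qed

lemma bdd_parts: "bdd U0" "bdd (U s)" "bdd (P0 i)" "bdd (P s i)"
proof -
  obtain M where M: "\<And>z. \<bar>U0 z\<bar> \<le> M" using U0_bdd_all by blast
  show "bdd U0" "bdd (U s)" unfolding U_def using M by (auto intro!: bddI)
  obtain N where N: "\<And>z. \<bar>P0 i z\<bar> \<le> N" using P0_bdd_all by blast
  show "bdd (P0 i)" using N by (auto intro!: bddI)
  show "bdd (P s i)" unfolding P_def using N
    by (auto intro!: bddI[where M="exp (weight \<alpha> i * s) * N"] simp: abs_mult)
qed

section \<open>The dilated zero extension as a test function\<close>

lemma dil_minus_mem: "s \<ge> 0 \<Longrightarrow> dil \<alpha> (- s) z \<in> \<Omega> \<Longrightarrow> z \<in> \<Omega>"
  using dil_mem[OF sbd star, of "dil \<alpha> (- s) z" s] by simp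

lemma U_eq_0: "s \<ge> 0 \<Longrightarrow> z \<notin> \<Omega> \<Longrightarrow> U s z = 0"
  using dil_minus_mem by (auto simp: U_def U0_def)

lemma P_eq_0: "s \<ge> 0 \<Longrightarrow> z \<notin> \<Omega> \<Longrightarrow> P s i z = 0"
  using dil_minus_mem by (auto simp: P_def P0_def)

lemma U0_derivative:
  assumes "y \<notin> frontier \<Omega>"
  shows "((\<lambda>t. U0 (y + t *\<^sub>R axis i 1)) has_real_derivative P0 i y) (at 0)"
proof -
  have tend: "((\<lambda>t. y + t *\<^sub>R axis i 1) \<longlongrightarrow> y) (nhds 0)"
    by (auto intro!: tendsto_eq_intros filterlim_ident)
  show ?thesis
  proof (cases "y \<in> \<Omega>")
    case True
    have "eventually (\<lambda>t. u (y + t *\<^sub>R axis i 1) = U0 (y + t *\<^sub>R axis i 1)) (nhds 0)"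
      using topological_tendstoD[OF tend domain_open True] by eventually_elim (simp add: U0_def)
    then show ?thesis
      using axis_shift_derivative[OF u_differentiable[OF True], of i] True
      by (subst (asm) DERIV_cong_ev[OF refl _ refl]) (auto simp: P0_def)
  next
    case False
    then have "y \<in> - closure \<Omega>" using assms domain_open by (simp add: frontier_def interior_open)
    then have "eventually (\<lambda>t. y + t *\<^sub>R axis i 1 \<in> - closure \<Omega>) (nhds 0)"
      using topological_tendstoD[OF tend open_Compl[OF closed_closure]] by simp
    then have "eventually (\<lambda>t. U0 (y + t *\<^sub>R axis i 1) = 0) (nhds 0)"
      by eventually_elim (use closure_subset in \<open>auto simp: U0_def\<close>)
    then have "((\<lambda>t. U0 (y + t *\<^sub>R axis i 1)) has_real_derivative 0) (at 0)"
      by (subst DERIV_cong_ev[OF refl _ refl]) auto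
    then show ?thesis using False by (simp add: P0_def)
  qed
qed

lemma dil_axis_shift:
  "dil \<alpha> (- s) (z + t *\<^sub>R axis i 1) = dil \<alpha> (- s) z + (exp (weight \<alpha> i * s) * t) *\<^sub>R axis i 1"
  by (simp add: vec_eq_iff axis_def algebra_simps)

text \<open>The exceptional points are those sent to the frontier by the inverse dilation: the image
  of a null set under a linear map, hence null.\<close>

lemma U_derivative_AE: "AE z in lborel. ((\<lambda>t. U s (z + t *\<^sub>R axis i 1)) has_real_derivative P s i z) (at 0)"
proof -
  have "linear (dil \<alpha> s)" by (rule linearI) (simp_all add: vec_eq_iff algebra_simps)
  then have "negligible (dil \<alpha> s ` frontier \<Omega>)" using frontier_negligible by (intro negligible_differentiable_image_negligible linear_imp_differentiable_on) auto
  moreover have "dil \<alpha> s ` frontier \<Omega> = {z. dil \<alpha> (- s) z \<in> frontier \<Omega>}"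
    by (force simp: image_iff intro: bexI[of _ "dil \<alpha> (- s) _"])
  ultimately have "AE z in lebesgue. dil \<alpha> (- s) z \<notin> frontier \<Omega>"
    by (auto simp: eventually_ae_filter_negligible)
  \<comment> \<open>Borel measurability of the predicate carries the almost-everywhere statement
    from \<open>lebesgue\<close> back to \<open>lborel\<close>.\<close>
  moreover have "Measurable.pred borel (\<lambda>z. dil \<alpha> (- s) z \<notin> frontier \<Omega>)"
  proof -
    have [measurable]: "frontier \<Omega> \<in> sets borel" by simp
    show ?thesis by measurable
  qed
  ultimately have "AE z in lborel. dil \<alpha> (- s) z \<notin> frontier \<Omega>" by (simp add: AE_completion_iff)
  then show ?thesis
  proof eventually_elim
    case (elim z)
    let ?c = "exp (weight \<alpha> i * s)"
    have d1: "((\<lambda>t. ?c * t) has_real_derivative ?c) (at 0)" by (auto intro!: derivative_eq_intros)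
    have d2: "((\<lambda>t. U0 (dil \<alpha> (- s) z + t *\<^sub>R axis i 1)) has_real_derivative P0 i (dil \<alpha> (- s) z)) (at (?c * 0))"
      using U0_derivative[OF elim] by simp
    show ?case
      unfolding U_def P_def dil_axis_shift
      using DERIV_chain2[where f="\<lambda>t. U0 (dil \<alpha> (- s) z + t *\<^sub>R axis i 1)" and g="\<lambda>t. ?c * t" and x=0, OF d2 d1]
      by (simp only: mult.commute[of _ ?c])
  qed
qed

text \<open>For \<open>s \<ge> 0\<close> star-shapedness makes \<open>U s\<close> vanish off
  \<open>\<Omega>\<close>, and it inherits a Lipschitz constant from \<open>U0\<close>; there are no
  boundary terms.\<close>

lemma integration_by_parts_U:
  assumes s: "s \<ge> 0" and "set_borel_measurable borel \<Omega> f" "set_borel_measurable borel \<Omega> f'" "bdd f" "bdd f'"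
    and df: "\<And>z. z \<in> \<Omega> \<Longrightarrow> ((\<lambda>t. f (z + t *\<^sub>R axis i 1)) has_real_derivative f' z) (at 0)"
  shows "(LINT z:\<Omega>|lborel. f z * P s i z) = - (LINT z:\<Omega>|lborel. f' z * U s z)"
proof -
  obtain L where L: "L \<ge> 0" "\<And>x y. \<bar>U0 x - U0 y\<bar> \<le> L * norm (x - y)" using U0_lipschitz by blast
  obtain M M' where M: "\<And>z. z \<in> \<Omega> \<Longrightarrow> \<bar>f z\<bar> \<le> M" "\<And>z. z \<in> \<Omega> \<Longrightarrow> \<bar>f' z\<bar> \<le> M'"
    using assms(4,5) unfolding bdd_def by blast
  obtain V where V: "\<And>z. \<bar>U0 z\<bar> \<le> V" using U0_bdd_all by blast
  obtain V' where V': "\<And>z. z \<in> \<Omega> \<Longrightarrow> \<bar>P s i z\<bar> \<le> V'" using bdd_parts(4)[of s i] by (auto simp: bdd_def)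
  show ?thesis
  proof (rule directional_integration_by_parts[OF domain_open domain_bounded frontier_negligible assms(2,3) _ _ M df])
    show "\<bar>U s (z + t *\<^sub>R axis i 1) - U s z\<bar> \<le> L * exp (weight \<alpha> i * s) * \<bar>t\<bar>" for z t
      using L(2)[of "dil \<alpha> (- s) (z + t *\<^sub>R axis i 1)" "dil \<alpha> (- s) z"]
      by (simp add: U_def dil_axis_shift abs_mult mult.assoc)
    show "\<bar>U s z\<bar> \<le> V" for z unfolding U_def by (rule V)
    show "AE z in lborel. z \<in> \<Omega> \<longrightarrow> ((\<lambda>t. U s (z + t *\<^sub>R axis i 1)) has_real_derivative P s i z) (at 0)"
      using U_derivative_AE[of s i] by (rule AE_mp) auto
  qed (use V' U_eq_0[OF s] in \<open>auto intro: set_borel_measurableI measurable_parts\<close>)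
qed

section \<open>The weak form of the equation\<close>

text \<open>The third entry is set to 0 on the axis, where coef 3 vanishes and C carries no information.\<close>

definition rhs :: "3 \<Rightarrow> real^3 \<Rightarrow> real" where
  "rhs i z = (if i = 1 then A z else if i = 2 then B z else if xnorm z = 0 then 0 else C z)"

lemma xnorm_eq_0_iff: "xnorm z = 0 \<longleftrightarrow> z $ 1 = 0 \<and> z $ 2 = 0"
  by (simp add: xnorm_def sum_power2_eq_zero_iff)

text \<open>No derivative ever falls on a coefficient: \<open>coef 3\<close> depends on x alone and
  the third derivative runs along y. Hence the flux is differentiable at every point of
  \<open>\<Omega>\<close>, those on the line x = 0 included.\<close>

lemma flux_derivative:
  assumes z: "z \<in> \<Omega>"
  shows "((\<lambda>t. coef i (z + t *\<^sub>R axis i 1) * pdiff i u (z + t *\<^sub>R axis i 1)) has_real_derivative rhs i z) (at 0)"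
proof -
  obtain M where M: "\<And>z. z \<in> \<Omega> \<Longrightarrow> \<bar>u z\<bar> \<le> M" using bdd_closure[OF u_continuous] by (auto simp: bdd_def)
  obtain M' where M': "\<And>z. z \<in> \<Omega> \<Longrightarrow> \<bar>pdiff i u z\<bar> \<le> M'" using pdiff_bdd[of i] by (auto simp: bdd_def)
  have classical: "((\<lambda>t. pdiff i u (z + t *\<^sub>R axis i 1)) has_real_derivative G z) (at 0)"
    if "open V" "V \<subseteq> \<Omega>" "continuous_on V G" "z \<in> V"
      "\<And>\<psi>. test_fun V \<psi> \<Longrightarrow>
        integral \<Omega> (\<lambda>z. u z * iter_pdiff [i, i] \<psi> z) = integral \<Omega> (\<lambda>z. G z * \<psi> z)" for V G
    by (rule distributional_second_derivative[OF domain_open domain_bounded frontier_negligible that(1,2) u_differentiable M pdiff_cont M' that(3,5,4)])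
  consider "i = 1" | "i = 2" | "i = 3" using exhaust_3 by blast
  then show ?thesis
  proof cases
    case 1
    then show ?thesis
      using classical[OF domain_open order_refl continuous_on_subset[OF cA closure_subset] z] weakA
      by (simp add: coef_def rhs_def)
  next
    case 2
    then show ?thesis
      using classical[OF domain_open order_refl continuous_on_subset[OF cB closure_subset] z] weakB
      by (simp add: coef_def rhs_def)
  next
    case 3
    have xn: "xnorm (z + t *\<^sub>R axis 3 1) = xnorm z" for t by (simp add: xnorm_def axis_def)
    show ?thesis
    proof (cases "xnorm z = 0")
      case True
      \<comment> \<open>The whole line through \<open>z\<close> in direction y has
        \<open>xnorm\<close> zero, so the flux is identically 0 on it.\<close>
      then show ?thesis using 3 by (simp add: coef_def rhs_def xn)
    next
      case False
      let ?V = "\<Omega> - {z. z $ 1 = 0 \<and> z $ 2 = 0}"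
      have oV: "open ?V"
        by (intro open_Diff domain_open closed_Collect_conj closed_Collect_eq continuous_intros)
      have "continuous_on ?V xnorm" unfolding xnorm_def by (intro continuous_intros)
      then have cV: "continuous_on ?V (\<lambda>z. C z / (xnorm z powr (2 * \<alpha>)))"
        using xnorm_eq_0_iff closure_subset
        by (intro continuous_intros continuous_on_subset[OF cC]) auto
      have "((\<lambda>t. pdiff 3 u (z + t *\<^sub>R axis 3 1)) has_real_derivative C z / (xnorm z powr (2 * \<alpha>))) (at 0)"
        using classical[OF oV _ cV] weakC z False xnorm_eq_0_iff[of z] 3 by simp
      from DERIV_cmult[OF this, of "xnorm z powr (2 * \<alpha>)"]
      show ?thesis using 3 False by (simp add: coef_def rhs_def xn)
    qed
  qed
qed

lemma AE_xnorm: "AE z in lborel. xnorm z \<noteq> 0"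
proof -
  \<comment> \<open>The plane x1 = 0 contains the line x = 0 and is already null.\<close>
  have "negligible {z :: real^3. axis 1 1 \<bullet> z = 0}" by (rule negligible_hyperplane) (simp add: axis_eq_0_iff)
  then have "AE z in lebesgue. xnorm z \<noteq> 0"
    unfolding eventually_ae_filter_negligible
    by (intro exI[of _ "{z :: real^3. axis 1 1 \<bullet> z = 0}"]) (auto simp: xnorm_eq_0_iff inner_axis')
  then show ?thesis by (simp add: AE_completion_iff)
qed

lemma rhs_measurable: "set_borel_measurable borel \<Omega> (rhs i)" and rhs_bdd: "bdd (rhs i)"
proof -
  have m: "set_borel_measurable borel \<Omega> f" if "continuous_on (closure \<Omega>) f" for f :: "real^3 \<Rightarrow> real"
    using set_borel_measurable_continuous_open[OF domain_open continuous_on_subset[OF that closure_subset]] .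
  have [measurable]: "(\<lambda>z. indicator \<Omega> z *\<^sub>R C z) \<in> borel_measurable borel"
    using m[OF cC] by (simp add: set_borel_measurable_def)
  have "(\<lambda>z. if xnorm z = 0 then 0 else indicator \<Omega> z *\<^sub>R C z) \<in> borel_measurable borel" by measurable
  moreover have "(\<lambda>z. if xnorm z = 0 then 0 else indicator \<Omega> z *\<^sub>R C z)
      = (\<lambda>z. indicator \<Omega> z *\<^sub>R (if xnorm z = 0 then 0 else C z))" by auto
  ultimately have C': "set_borel_measurable borel \<Omega> (\<lambda>z. if xnorm z = 0 then 0 else C z)"
    by (simp add: set_borel_measurable_def)
  consider "i = 1" | "i = 2" | "i = 3" using exhaust_3 by blast
  then show "set_borel_measurable borel \<Omega> (rhs i)"
    by cases (use m[OF cA] m[OF cB] C' in \<open>simp_all add: rhs_def[abs_def]\<close>)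
  obtain MA MB MC where M: "\<forall>z\<in>\<Omega>. \<bar>A z\<bar> \<le> MA" "\<forall>z\<in>\<Omega>. \<bar>B z\<bar> \<le> MB" "\<forall>z\<in>\<Omega>. \<bar>C z\<bar> \<le> MC"
    using bdd_closure[OF cA] bdd_closure[OF cB] bdd_closure[OF cC] unfolding bdd_def by blast
  show "bdd (rhs i)"
  proof (rule bddI)
    fix z assume "z \<in> \<Omega>"
    with M have "\<bar>A z\<bar> \<le> MA" "\<bar>B z\<bar> \<le> MB" "\<bar>C z\<bar> \<le> MC" by auto
    then show "\<bar>rhs i z\<bar> \<le> \<bar>MA\<bar> + \<bar>MB\<bar> + \<bar>MC\<bar>" by (auto simp: rhs_def)
  qed
qed

lemma set_borel_measurable_times:
  fixes f g :: "real^3 \<Rightarrow> real"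
  assumes "set_borel_measurable borel \<Omega> f" "g \<in> borel_measurable borel"
  shows "set_borel_measurable borel \<Omega> (\<lambda>z. f z * g z)"
  using borel_measurable_times[OF assms(1)[unfolded set_borel_measurable_def] assms(2)]
  by (simp add: set_borel_measurable_def mult.assoc)

text \<open>Each flux is integrated by parts against \<open>U s\<close> separately, and the equation
  is inserted only after summation, since it controls the sum of the three right-hand sides
  alone.\<close>

lemma weak_form:
  assumes s: "s \<ge> 0"
  shows "(\<Sum>i\<in>UNIV. LINT z:\<Omega>|lborel. coef i z * P0 i z * P s i z)
    = (LINT z:\<Omega>|lborel. coef 3 z * (\<bar>U0 z\<bar> powr (p - 1) * U0 z) * U s z)"
proof -
  have "(LINT z:\<Omega>|lborel. coef i z * P0 i z * P s i z) = - (LINT z:\<Omega>|lborel. rhs i z * U s z)" for i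
  proof -
    have "(LINT z:\<Omega>|lborel. coef i z * P0 i z * P s i z) = (LINT z:\<Omega>|lborel. coef i z * pdiff i u z * P s i z)"
      using domain_open by (intro set_lebesgue_integral_cong) (auto simp: P0_def)
    also have "\<dots> = - (LINT z:\<Omega>|lborel. rhs i z * U s z)"
      by (intro integration_by_parts_U s rhs_measurable rhs_bdd flux_derivative bdd_mult coef_bdd pdiff_bdd
          set_borel_measurable_continuous_open domain_open continuous_on_mult coef_cont pdiff_cont)
    finally show ?thesis .
  qed
  then have "(\<Sum>i\<in>UNIV. LINT z:\<Omega>|lborel. coef i z * P0 i z * P s i z)
      = - (\<Sum>i\<in>UNIV. \<integral>z. indicator \<Omega> z * (rhs i z * U s z) \<partial>lborel)"
    by (simp add: sum_negf set_lebesgue_integral_def)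
  also have "(\<Sum>i\<in>UNIV. \<integral>z. indicator \<Omega> z * (rhs i z * U s z) \<partial>lborel)
      = (\<integral>z. (\<Sum>i\<in>UNIV. indicator \<Omega> z * (rhs i z * U s z)) \<partial>lborel)"
  proof (rule Bochner_Integration.integral_sum[symmetric])
    fix i
    have "set_integrable lborel \<Omega> (\<lambda>z. rhs i z * U s z)"
      by (intro set_integrable_bdd set_borel_measurable_times rhs_measurable bdd_mult rhs_bdd bdd_parts measurable_parts)
    then show "integrable lborel (\<lambda>z. indicator \<Omega> z * (rhs i z * U s z))"
      by (simp add: set_integrable_def)
  qed
  also have "- \<dots> = (\<integral>z. - (\<Sum>i\<in>UNIV. indicator \<Omega> z * (rhs i z * U s z)) \<partial>lborel)" by simp
  also have "\<dots> = (\<integral>z. indicator \<Omega> z * (coef 3 z * (\<bar>U0 z\<bar> powr (p - 1) * U0 z) * U s z) \<partial>lborel)"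
  proof (rule integral_cong_AE)
    have [measurable]: "\<Omega> \<in> sets borel" using domain_open by simp
    have "(\<lambda>z. indicator \<Omega> z * rhs i z) \<in> borel_measurable borel" for i
      using rhs_measurable[of i] by (simp add: set_borel_measurable_def)
    then have "(\<lambda>z. indicator \<Omega> z * rhs i z * U s z) \<in> borel_measurable borel" for i
      by (rule borel_measurable_times[OF _ measurable_parts(2)])
    then have "(\<lambda>z. indicator \<Omega> z * (rhs i z * U s z)) \<in> borel_measurable borel" for i
      by (simp only: mult.assoc)
    then show "(\<lambda>z. - (\<Sum>i\<in>UNIV. indicator \<Omega> z * (rhs i z * U s z))) \<in> borel_measurable lborel"
      unfolding measurable_lborel2 by (intro borel_measurable_uminus borel_measurable_sum)
    show "(\<lambda>z. indicator \<Omega> z * (coef 3 z * (\<bar>U0 z\<bar> powr (p - 1) * U0 z) * U s z)) \<in> borel_measurable lborel"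
      by measurable
    show "AE z in lborel. - (\<Sum>i\<in>UNIV. indicator \<Omega> z * (rhs i z * U s z))
        = indicator \<Omega> z * (coef 3 z * (\<bar>U0 z\<bar> powr (p - 1) * U0 z) * U s z)"
      \<comment> \<open>On the line x = 0 the entry \<open>rhs 3\<close> need not be
        \<open>C\<close>, so the pointwise equation is used only off that null set.\<close>
      using AE_xnorm
    proof eventually_elim
      case (elim z)
      show ?case
      proof (cases "z \<in> \<Omega>")
        case True
        then have "(- A z - B z - C z) * U s z = coef 3 z * (\<bar>U0 z\<bar> powr (p - 1) * U0 z) * U s z"
          by (simp add: pde[OF True] coef_def U0_def)
        then show ?thesis using True elim by (simp add: sum_3 rhs_def algebra_simps)
      qed simp
    qed
  qed
  finally show ?thesis by (simp add: set_lebesgue_integral_def)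
qed

section \<open>Homogeneity of the energy and of the potential integral\<close>

definition E :: "3 \<Rightarrow> real^3 \<Rightarrow> real" where
  "E i z = coef i z * (P0 i z)\<^sup>2"

definition N :: "real^3 \<Rightarrow> real" where
  "N z = coef 3 z * \<bar>U0 z\<bar> powr (p + 1)"

lemma EN_measurable [measurable]: "E i \<in> borel_measurable borel" "N \<in> borel_measurable borel"
  unfolding E_def[abs_def] N_def[abs_def] by measurable

text \<open>One formula for all three: the exponent is 0 for the first two directions, and 2
  \<alpha> s for the third because |x| scales with degree 1.\<close>

lemma coef_dil: "coef i (dil \<alpha> (- s) z) = exp (2 * (weight \<alpha> i - 1) * s) * coef i z"
proof (cases "i = 3")
  case True
  have "xnorm (dil \<alpha> (- s) z) = exp s * xnorm z"
  proof -
    have "(exp s * z $ 1)\<^sup>2 + (exp s * z $ 2)\<^sup>2 = (exp s)\<^sup>2 * ((z $ 1)\<^sup>2 + (z $ 2)\<^sup>2)"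
      by (simp add: power_mult_distrib distrib_left)
    then show ?thesis by (simp add: xnorm_def weight_def real_sqrt_mult)
  qed
  then show ?thesis
    using True by (simp add: coef_def weight_def powr_mult xnorm_def exp_powr_real mult_ac)
qed (simp add: coef_def weight_def)

text \<open>Twice the weight from the squared derivative minus 2 (weight - 1) from the coefficient
  leaves 2 in every direction, and the Jacobian contributes -(3 + \<alpha>). The integral over
  \<open>\<Omega>\<close> is one over the whole space because \<open>P s i\<close> vanishes
  outside.\<close>

lemma integral_E_scaled:
  assumes "s \<ge> 0"
  shows "(LINT z:\<Omega>|lborel. coef i z * (P s i z)\<^sup>2) = exp (- (1 + \<alpha>) * s) * (LINT z:\<Omega>|lborel. E i z)"
proof -
  have "indicator \<Omega> z *\<^sub>R (coef i z * (P s i z)\<^sup>2) = exp (2 * s) * E i (dil \<alpha> (- s) z)" for z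
  proof -
    have "coef i z * (P s i z)\<^sup>2 = exp (2 * s) * E i (dil \<alpha> (- s) z)"
      by (simp add: E_def coef_dil P_def power_mult_distrib exp_double[symmetric])
         (simp add: exp_add[symmetric] algebra_simps flip: exp_add)
    then show ?thesis using P_eq_0[OF assms, of z i] by (auto simp: indicator_def)
  qed
  then have "(LINT z:\<Omega>|lborel. coef i z * (P s i z)\<^sup>2) = exp (2 * s) * (\<integral>z. E i (dil \<alpha> (- s) z) \<partial>lborel)"
    by (simp add: set_lebesgue_integral_def)
  also have "\<dots> = exp (2 * s) * (exp (- (3 + \<alpha>) * s) * (\<integral>z. E i z \<partial>lborel))"
    by (simp only: integral_dil[OF EN_measurable(1)])
  also have "\<dots> = exp (- (1 + \<alpha>) * s) * (\<integral>z. E i z \<partial>lborel)"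
    unfolding mult.assoc[symmetric] exp_add[symmetric] by (simp add: algebra_simps)
  also have "(\<integral>z. E i z \<partial>lborel) = (LINT z:\<Omega>|lborel. E i z)"
    unfolding set_lebesgue_integral_def
    by (rule arg_cong[where f="integral\<^sup>L lborel"]) (auto simp: E_def P0_def indicator_def fun_eq_iff)
  finally show ?thesis .
qed

text \<open>The coefficient gives -2 \<alpha> and the Jacobian -(3 + \<alpha>), together -3 (1 +
  \<alpha>).\<close>

lemma integral_N_scaled:
  assumes "s \<ge> 0"
  shows "(LINT z:\<Omega>|lborel. coef 3 z * \<bar>U s z\<bar> powr (p + 1)) = exp (- (3 * (1 + \<alpha>)) * s) * (LINT z:\<Omega>|lborel. N z)"
proof -
  have "indicator \<Omega> z *\<^sub>R (coef 3 z * \<bar>U s z\<bar> powr (p + 1)) = exp (- 2 * \<alpha> * s) * N (dil \<alpha> (- s) z)" for z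
  proof -
    have "coef 3 z * \<bar>U s z\<bar> powr (p + 1) = exp (- 2 * \<alpha> * s) * N (dil \<alpha> (- s) z)"
      by (simp add: N_def coef_dil U_def weight_def flip: exp_add mult.assoc)
    then show ?thesis using U_eq_0[OF assms, of z] by (auto simp: indicator_def)
  qed
  then have "(LINT z:\<Omega>|lborel. coef 3 z * \<bar>U s z\<bar> powr (p + 1)) = exp (- 2 * \<alpha> * s) * (\<integral>z. N (dil \<alpha> (- s) z) \<partial>lborel)"
    by (simp add: set_lebesgue_integral_def)
  also have "\<dots> = exp (- 2 * \<alpha> * s) * (exp (- (3 + \<alpha>) * s) * (\<integral>z. N z \<partial>lborel))"
    by (simp only: integral_dil[OF EN_measurable(2)])
  also have "\<dots> = exp (- (3 * (1 + \<alpha>)) * s) * (\<integral>z. N z \<partial>lborel)"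
    by (simp add: algebra_simps flip: exp_add mult.assoc)
  also have "(\<integral>z. N z \<partial>lborel) = (LINT z:\<Omega>|lborel. N z)"
    unfolding set_lebesgue_integral_def
    by (rule arg_cong[where f="integral\<^sup>L lborel"]) (auto simp: N_def U0_def indicator_def fun_eq_iff)
  finally show ?thesis .
qed

lemma abs_powr_bdd: "r > 0 \<Longrightarrow> bdd (\<lambda>z. \<bar>U s z\<bar> powr r)" "r > 0 \<Longrightarrow> bdd (\<lambda>z. \<bar>U0 z\<bar> powr r)"
proof -
  obtain M where M: "\<And>z. \<bar>U0 z\<bar> \<le> M" using U0_bdd_all by blast
  show "r > 0 \<Longrightarrow> bdd (\<lambda>z. \<bar>U s z\<bar> powr r)" "r > 0 \<Longrightarrow> bdd (\<lambda>z. \<bar>U0 z\<bar> powr r)"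
    unfolding U_def using M by (auto intro!: bddI[where M="M powr r"] powr_mono2)
qed

lemma integrable_parts:
  "set_integrable lborel \<Omega> (\<lambda>z. coef i z * P0 i z * P s i z)"
  "set_integrable lborel \<Omega> (\<lambda>z. coef i z * (P s i z)\<^sup>2)"
  "set_integrable lborel \<Omega> (E i)"
  "set_integrable lborel \<Omega> N"
  "set_integrable lborel \<Omega> (\<lambda>z. coef 3 z * (\<bar>U0 z\<bar> powr (p - 1) * U0 z) * U s z)"
  "set_integrable lborel \<Omega> (\<lambda>z. coef 3 z * \<bar>U s z\<bar> powr (p + 1))"
proof -
  have r: "p - 1 > 0" "p + 1 > 0" using p by auto
  note int = set_integrable_bdd[OF set_borel_measurableI]
  note bdds = bdd_mult bdd_parts coef_bdd abs_powr_bdd r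
  show "set_integrable lborel \<Omega> (\<lambda>z. coef i z * P0 i z * P s i z)"
    by (rule int, measurable) (intro bdds)
  show "set_integrable lborel \<Omega> (\<lambda>z. coef i z * (P s i z)\<^sup>2)"
    unfolding power2_eq_square by (rule int, measurable) (intro bdds)
  show "set_integrable lborel \<Omega> (E i)"
    unfolding E_def[abs_def] power2_eq_square by (rule int, measurable) (intro bdds)
  show "set_integrable lborel \<Omega> N"
    unfolding N_def[abs_def] by (rule int, measurable) (intro bdds)
  show "set_integrable lborel \<Omega> (\<lambda>z. coef 3 z * (\<bar>U0 z\<bar> powr (p - 1) * U0 z) * U s z)"
    by (rule int, measurable) (intro bdds)
  show "set_integrable lborel \<Omega> (\<lambda>z. coef 3 z * \<bar>U s z\<bar> powr (p + 1))"
    by (rule int, measurable) (intro bdds)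
qed

lemma energy_identity: "(\<Sum>i\<in>UNIV. LINT z:\<Omega>|lborel. E i z) = (LINT z:\<Omega>|lborel. N z)"
proof -
  have "P 0 i z = P0 i z" "U 0 z = U0 z" for i z by (simp_all add: P_def U_def)
  moreover have "\<bar>x\<bar> powr (p - 1) * x * x = \<bar>x\<bar> powr (p + 1)" for x :: real
    using abs_powr_mult_self[of x "p + 1"] by simp
  ultimately show ?thesis
    using weak_form[of 0] by (simp add: E_def N_def power2_eq_square mult.assoc)
qed

text \<open>The cross term \<open>F\<close> is bounded above by the energy and below by convexity up
  to second order. The form is chosen so that both sides vanish at \<open>s = 0\<close>;
  \<open>K\<close> depends on the solution but not on \<open>s\<close>.\<close>

lemma pohozaev_inequality:
  obtains K where "\<And>s. 0 < s \<Longrightarrow> s \<le> 1 \<Longrightarrow>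
    (exp (- (3 * (1 + \<alpha>)) * s) - 1) * (LINT z:\<Omega>|lborel. N z) - K * s\<^sup>2
      \<le> (p + 1) / 2 * (exp (- (1 + \<alpha>) * s) - 1) * (LINT z:\<Omega>|lborel. N z)"
proof -
  define I where "I = (LINT z:\<Omega>|lborel. N z)"
  obtain L where L: "L \<ge> 0" "\<And>x y. \<bar>U0 x - U0 y\<bar> \<le> L * norm (x - y)" using U0_lipschitz by blast
  obtain M where M: "\<And>z. \<bar>U0 z\<bar> \<le> M" using U0_bdd_all by blast
  obtain R where R: "\<And>z. z \<in> \<Omega> \<Longrightarrow> norm z \<le> R" using domain_bounded by (auto simp: bounded_iff)
  obtain W where W: "\<And>z. z \<in> \<Omega> \<Longrightarrow> \<bar>coef 3 z\<bar> \<le> W" using coef_bdd[of 3] by (auto simp: bdd_def)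
  \<comment> \<open>The Taylor constant q (q - 1) M^(q - 2) at q = p + 1.\<close>
  define T where "T = (p + 1) * p * M powr (p - 1)"
  \<comment> \<open>Lipschitz constant of \<open>U0\<close> times the displacement bound, so that
    \<open>D * s\<close> bounds \<open>U s - U0\<close> on \<open>\<Omega>\<close>.\<close>
  define D where "D = L * (3 * (1 + \<alpha>) * exp (1 + \<alpha>) * R)"
  define K where "K = W * T * D\<^sup>2 * measure lborel \<Omega>"
  have T0: "T \<ge> 0" using p by (simp add: T_def)
  have fin: "emeasure lborel \<Omega> < \<infinity>" using domain_bounded by (rule emeasure_bounded_finite)
  have "(exp (- (3 * (1 + \<alpha>)) * s) - 1) * I - K * s\<^sup>2 \<le> (p + 1) / 2 * (exp (- (1 + \<alpha>) * s) - 1) * I"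
    if s: "0 < s" "s \<le> 1" for s
  proof -
    have s0: "s \<ge> 0" using s by simp
    define F where "F = (LINT z:\<Omega>|lborel. coef 3 z * (\<bar>U0 z\<bar> powr (p - 1) * U0 z) * U s z)"
    have "(LINT z:\<Omega>|lborel. coef i z * P0 i z * P s i z)
        \<le> (LINT z:\<Omega>|lborel. (1 / 2) * (E i z + coef i z * (P s i z)\<^sup>2))" for i
    proof (rule set_integral_mono)
      show "set_integrable lborel \<Omega> (\<lambda>z. 1 / 2 * (E i z + coef i z * (P s i z)\<^sup>2))"
        by (intro set_integrable_mult_right set_integral_add integrable_parts)
      fix z
      \<comment> \<open>Pointwise version of a(u - u_s, u - u_s) >= 0, direction by
        direction.\<close>
      have "0 \<le> coef i z * (P0 i z - P s i z)\<^sup>2" by (simp add: coef_nonneg)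
      then show "coef i z * P0 i z * P s i z \<le> 1 / 2 * (E i z + coef i z * (P s i z)\<^sup>2)"
        by (simp add: E_def power2_eq_square algebra_simps)
    qed (rule integrable_parts)
    also have "(LINT z:\<Omega>|lborel. (1 / 2) * (E i z + coef i z * (P s i z)\<^sup>2))
        = (1 / 2) * ((1 + exp (- (1 + \<alpha>) * s)) * (LINT z:\<Omega>|lborel. E i z))" for i
      using set_integral_add(2)[OF integrable_parts(3)[of i] integrable_parts(2)[of i s]] integral_E_scaled[OF s0, of i]
      by (simp add: distrib_right)
    finally have "F \<le> (\<Sum>i\<in>UNIV. (1 / 2) * ((1 + exp (- (1 + \<alpha>) * s)) * (LINT z:\<Omega>|lborel. E i z)))"
      unfolding F_def weak_form[OF s0, symmetric] by (intro sum_mono)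
    also have "\<dots> = (1 / 2) * ((1 + exp (- (1 + \<alpha>) * s)) * I)"
      unfolding I_def energy_identity[symmetric] by (simp add: sum_distrib_left)
    finally have upper: "F \<le> (1 / 2) * ((1 + exp (- (1 + \<alpha>) * s)) * I)" .
    have int_F: "set_integrable lborel \<Omega> (\<lambda>z. coef 3 z * (\<bar>U0 z\<bar> powr (p - 1) * U0 z) * U s z)"
      and int_N: "set_integrable lborel \<Omega> N" by (rule integrable_parts)+
    have int_c: "set_integrable lborel \<Omega> (\<lambda>z. W * T * D\<^sup>2 * s\<^sup>2)"
      unfolding set_integrable_def using fin domain_open by simp
    have "exp (- (3 * (1 + \<alpha>)) * s) * I = (LINT z:\<Omega>|lborel. coef 3 z * \<bar>U s z\<bar> powr (p + 1))"
      by (simp add: I_def integral_N_scaled[OF s0])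
    also have "\<dots> \<le> (LINT z:\<Omega>|lborel. - p * N z
        + (p + 1) * (coef 3 z * (\<bar>U0 z\<bar> powr (p - 1) * U0 z) * U s z) + W * T * D\<^sup>2 * s\<^sup>2)"
    proof (rule set_integral_mono)
      show "set_integrable lborel \<Omega> (\<lambda>z. - p * N z
        + (p + 1) * (coef 3 z * (\<bar>U0 z\<bar> powr (p - 1) * U0 z) * U s z) + W * T * D\<^sup>2 * s\<^sup>2)"
        by (intro set_integral_add set_integrable_mult_right int_F int_N int_c)
      fix z assume z: "z \<in> \<Omega>"
      \<comment> \<open>The tangent at \<open>U0 z\<close> contributes 1 - (p + 1) = -p times
        |U0|^(p + 1), plus the integrand of \<open>F\<close>.\<close>
      have "\<bar>U s z\<bar> powr (p + 1) \<le> \<bar>U0 z\<bar> powr (p + 1)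
          + (p + 1) * (\<bar>U0 z\<bar> powr (p + 1 - 2) * U0 z) * (U s z - U0 z)
          + (p + 1) * (p + 1 - 1) * M powr (p + 1 - 2) * (U s z - U0 z)\<^sup>2"
        using p M by (intro abs_powr_taylor) (auto simp: U_def)
      moreover have "\<bar>U0 z\<bar> powr (p - 1) * U0 z * U0 z = \<bar>U0 z\<bar> powr (p + 1)"
        using abs_powr_mult_self[of "U0 z" "p + 1"] by simp
      moreover have "T * (U s z - U0 z)\<^sup>2 \<le> T * (D * s)\<^sup>2"
      proof -
        have "\<bar>U s z - U0 z\<bar> \<le> L * norm (dil \<alpha> (- s) z - z)" unfolding U_def by (rule L)
        also have "\<dots> \<le> L * (3 * (1 + \<alpha>) * exp (1 + \<alpha>) * norm z * s)"
          using dil_displacement[of \<alpha> s z] \<alpha> s L(1) by (intro mult_left_mono) auto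
        also have "\<dots> \<le> L * (3 * (1 + \<alpha>) * exp (1 + \<alpha>) * R * s)"
          using \<alpha> s L(1) R[OF z] by (intro mult_left_mono mult_right_mono) auto
        finally have "\<bar>U s z - U0 z\<bar> \<le> D * s" by (simp add: D_def mult.assoc)
        then have "(U s z - U0 z)\<^sup>2 \<le> (D * s)\<^sup>2" by (metis abs_ge_zero power2_abs power_mono)
        then show ?thesis using T0 by (rule mult_left_mono)
      qed
      ultimately have "\<bar>U s z\<bar> powr (p + 1) \<le> - p * \<bar>U0 z\<bar> powr (p + 1)
          + (p + 1) * ((\<bar>U0 z\<bar> powr (p - 1) * U0 z) * U s z) + T * (D * s)\<^sup>2"
        by (simp add: T_def algebra_simps)
      then have "coef 3 z * \<bar>U s z\<bar> powr (p + 1) \<le> coef 3 z * (- p * \<bar>U0 z\<bar> powr (p + 1)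
          + (p + 1) * ((\<bar>U0 z\<bar> powr (p - 1) * U0 z) * U s z) + T * (D * s)\<^sup>2)"
        by (rule mult_left_mono[OF _ coef_nonneg])
      also have "\<dots> = - p * N z + (p + 1) * (coef 3 z * (\<bar>U0 z\<bar> powr (p - 1) * U0 z) * U s z)
          + coef 3 z * (T * (D * s)\<^sup>2)"
        by (simp add: N_def algebra_simps)
      also have "coef 3 z * (T * (D * s)\<^sup>2) \<le> W * (T * (D * s)\<^sup>2)"
        using W[OF z] T0 by (intro mult_right_mono) auto
      finally show "coef 3 z * \<bar>U s z\<bar> powr (p + 1) \<le> - p * N z
          + (p + 1) * (coef 3 z * (\<bar>U0 z\<bar> powr (p - 1) * U0 z) * U s z) + W * T * D\<^sup>2 * s\<^sup>2"
        by (simp add: power_mult_distrib mult.assoc)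
    qed (rule integrable_parts)
    also have "\<dots> = - p * I + (p + 1) * F + K * s\<^sup>2"
    proof -
      have "(LINT z:\<Omega>|lborel. W * T * D\<^sup>2 * s\<^sup>2) = K * s\<^sup>2"
        using fin domain_open by (simp add: set_lebesgue_integral_def K_def)
      moreover have i1: "set_integrable lborel \<Omega> (\<lambda>z. - p * N z)"
        "set_integrable lborel \<Omega> (\<lambda>z. (p + 1) * (coef 3 z * (\<bar>U0 z\<bar> powr (p - 1) * U0 z) * U s z))"
        by (intro set_integrable_mult_right int_F int_N)+
      moreover have "(LINT z:\<Omega>|lborel. - p * N z) = - p * I"
        "(LINT z:\<Omega>|lborel. (p + 1) * (coef 3 z * (\<bar>U0 z\<bar> powr (p - 1) * U0 z) * U s z)) = (p + 1) * F"
        unfolding I_def F_def by (rule set_integral_mult_right)+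
      ultimately show ?thesis
        using set_integral_add(2)[OF set_integral_add(1)[OF i1] int_c] set_integral_add(2)[OF i1]
        by (simp only:)
    qed
    also have "(p + 1) * F \<le> (p + 1) * ((1 / 2) * ((1 + exp (- (1 + \<alpha>) * s)) * I))"
      using upper p by (intro mult_left_mono) auto
    \<comment> \<open>After subtracting \<open>I\<close> the constant terms cancel: -p + (p + 1) / 2
      - 1 = -(p + 1) / 2, which is the -1 inside the bracket on the right.\<close>
    finally show ?thesis by (simp add: field_simps)
  qed
  then show ?thesis using that unfolding I_def by blast
qed

lemma solution_eq_0: "z \<in> \<Omega> \<Longrightarrow> u z = 0"
proof -
  define I where "I = (LINT z:\<Omega>|lborel. N z)"
  obtain K where "\<And>s. 0 < s \<Longrightarrow> s \<le> 1 \<Longrightarrow>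
    (exp (- (3 * (1 + \<alpha>)) * s) - 1) * I - K * s\<^sup>2 \<le> (p + 1) / 2 * (exp (- (1 + \<alpha>) * s) - 1) * I"
    using pohozaev_inequality unfolding I_def by blast
  from scaling_limit[OF this] have "(p + 1) / 2 * (1 + \<alpha>) * I \<le> 3 * (1 + \<alpha>) * I" .
  \<comment> \<open>(p + 1) / 2 - 3 = (p - 5) / 2, positive by hypothesis.\<close>
  then have "(1 + \<alpha>) * ((p - 5) / 2 * I) \<le> 0" by (simp add: field_simps)
  then have I0: "I \<le> 0" using \<alpha> p by (simp add: mult_le_0_iff)
  have int: "integrable lborel (\<lambda>z. indicator \<Omega> z * N z)"
    using integrable_parts(4) by (simp add: set_integrable_def)
  have nonneg: "indicator \<Omega> z * N z \<ge> 0" for z by (simp add: N_def coef_nonneg)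
  have I_eq: "I = (\<integral>z. indicator \<Omega> z * N z \<partial>lborel)" by (simp add: I_def set_lebesgue_integral_def)
  then have "I \<ge> 0" using nonneg by (simp only:) (rule Bochner_Integration.integral_nonneg)
  then have "(\<integral>z. indicator \<Omega> z * N z \<partial>lborel) = 0" using I0 I_eq by simp
  then have "AE z in lborel. indicator \<Omega> z * N z = 0"
    using integral_nonneg_eq_0_iff_AE[OF int] nonneg by auto
  \<comment> \<open>The weight in \<open>N\<close> vanishes only on the null line x = 0, so
    elsewhere the power of \<open>U0\<close> must vanish.\<close>
  then have "AE z in lborel. U0 z = 0"
    using AE_xnorm by eventually_elim (auto simp: N_def coef_def U0_def split: if_splits)
  then have "AE z in lebesgue. U0 z = 0" by (rule AE_completion)
  \<comment> \<open>The zero set of a continuous function is closed, so almost everywhere becomes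
    everywhere.\<close>
  then have "z \<in> {z. U0 z = 0}" for z
    by (intro mem_closed_if_AE_lebesgue closed_Collect_eq continuous_intros U0_cont) auto
  then have "U0 z = 0" by blast
  then show "z \<in> \<Omega> \<Longrightarrow> u z = 0" by (simp add: U0_def)
qed

end

theorem theorem4p1:
  fixes \<alpha> p :: real and \<Omega> :: "(real^3) set"
  assumes "\<alpha> > 0"
    and "smooth_bounded_domain \<Omega>"
    and "G_star_shaped \<alpha> \<Omega>"
    and "p > 5"
  shows "\<not> (\<exists>u. S2_solution \<alpha> p \<Omega> u \<and> (\<exists>z\<in>\<Omega>. u z \<noteq> 0))"
proof
  assume "\<exists>u. S2_solution \<alpha> p \<Omega> u \<and> (\<exists>z\<in>\<Omega>. u z \<noteq> 0)"
  then obtain u z where u: "S2_solution \<alpha> p \<Omega> u" and z: "z \<in> \<Omega>" "u z \<noteq> 0" by blast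
  from u obtain A B C where "pohozaev \<alpha> p \<Omega> u A B C"
    unfolding S2_solution_def pohozaev_def using assms by blast
  then have "u z = 0" using z(1) by (rule pohozaev.solution_eq_0)
  with z(2) show False by contradiction
qed

end
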